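(* Let $M$ be a map on the torus of one of the types $\{3^{3},4^{2}\}$, $\{3^{2},4,3,4\}$, $\{6,3,6,3\}$, $\{6,4,3,4\}$, $\{3^{4},6\}$, $\{4,8^{2}\}$, $\{4,6,12\}$. Then $M$ is Hamiltonian, i.e. its edge graph has a cycle containing all vertices of $M$.
   Context: A map $M$ on a surface $S$ is an embedding of a finite simple graph $G$ (the edge graph of $M$) in $S$ such that the closures of the components of $S\setminus G$ (the faces of $M$) are closed $2$-cells, i.e. each homeomorphic to a $2$-disk. A face whose boundary is a cycle of length $a$ is called an $a$-gon. A map has type $\{a^p,b^q,\dots,m^r\}$ (semi-equivelar of that type) if around every vertex the cyclic sequence of face lengths is: $p$ consecutive $a$-gons, then $q$ consecutive $b$-gons, and so on (up to cyclic rotation and reversal). *)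

theory Defs
  imports "HOL-Analysis.Analysis"
begin

definition simple_graph :: "'v set \<Rightarrow> 'v set set \<Rightarrow> bool" where
  "simple_graph V E \<longleftrightarrow> finite V \<and> (\<forall>e\<in>E. e \<subseteq> V \<and> card e = 2)"

text \<open>A cycle is given by the list of its vertices, without repeating the first one at the end.\<close>

definition cycle_edges :: "'v list \<Rightarrow> 'v set set" where
  "cycle_edges c = {{c ! i, c ! (Suc i mod length c)} | i. i < length c}"

definition graph_cycle :: "'v set \<Rightarrow> 'v set set \<Rightarrow> 'v list \<Rightarrow> bool" where
  "graph_cycle V E c \<longleftrightarrow>
     3 \<le> length c \<and> distinct c \<and> set c \<subseteq> V \<and> cycle_edges c \<subseteq> E"

definition hamiltonian :: "'v set \<Rightarrow> 'v set set \<Rightarrow> bool" where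
  "hamiltonian V E \<longleftrightarrow> (\<exists>c. graph_cycle V E c \<and> set c = V)"

definition torus :: "(complex \<times> complex) set" where
  "torus = sphere 0 1 \<times> sphere 0 1"

text \<open>
  A simple graph drawn in a space: \<open>point\<close> places the vertices, and \<open>curve\<close> assigns to every edge
  a parametrised arc. Values outside \<open>verts\<close> and \<open>edges\<close> are irrelevant.
\<close>

record ('v, 'a) drawing =
  verts :: "'v set"
  edges :: "'v set set"
  point :: "'v \<Rightarrow> 'a"
  curve :: "'v set \<Rightarrow> real \<Rightarrow> 'a"

definition edge_arc :: "('v, 'a::topological_space) drawing \<Rightarrow> 'v set \<Rightarrow> 'a set" where
  "edge_arc M e = path_image (curve M e)"

definition embedded_in :: "('v, 'a::topological_space) drawing \<Rightarrow> 'a set \<Rightarrow> bool" where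
  "embedded_in M S \<longleftrightarrow>
     inj_on (point M) (verts M) \<and> point M ` verts M \<subseteq> S \<and>
     (\<forall>e\<in>edges M. arc (curve M e) \<and> edge_arc M e \<subseteq> S \<and>
        {pathstart (curve M e), pathfinish (curve M e)} = point M ` e \<and>
        edge_arc M e \<inter> point M ` verts M = point M ` e) \<and>
     (\<forall>e\<in>edges M. \<forall>e'\<in>edges M. e \<noteq> e' \<longrightarrow>
        edge_arc M e \<inter> edge_arc M e' = point M ` (e \<inter> e'))"

definition skeleton :: "('v, 'a::topological_space) drawing \<Rightarrow> 'a set" where
  "skeleton M = point M ` verts M \<union> (\<Union>e\<in>edges M. edge_arc M e)"

text \<open>Faces are the open regions; their closures are taken relative to the surface.\<close>

definition faces :: "'a::topological_space set \<Rightarrow> ('v, 'a) drawing \<Rightarrow> 'a set set" where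
  "faces S M = components (S - skeleton M)"

definition closed_face :: "'a::topological_space set \<Rightarrow> 'a set \<Rightarrow> 'a set" where
  "closed_face S f = S \<inter> closure f"

definition map_on :: "'a::topological_space set \<Rightarrow> ('v, 'a) drawing \<Rightarrow> bool" where
  "map_on S M \<longleftrightarrow>
     simple_graph (verts M) (edges M) \<and> embedded_in M S \<and>
     (\<forall>f\<in>faces S M. closed_face S f homeomorphic cball (0::complex) 1)"

definition is_gon :: "'a::topological_space set \<Rightarrow> ('v, 'a) drawing \<Rightarrow> nat \<Rightarrow> 'a set \<Rightarrow> bool" where
  "is_gon S M a f \<longleftrightarrow>
     (\<exists>c. graph_cycle (verts M) (edges M) c \<and> length c = a \<and>
        closed_face S f - f = (\<Union>e\<in>cycle_edges c. edge_arc M e))"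

text \<open>
  The list \<open>fs\<close> runs once through the faces around \<open>v\<close> in cyclic order: there is an enumeration
  \<open>es\<close> of the edges at \<open>v\<close> such that the \<open>i\<close>-th face lies between the \<open>i\<close>-th and the next edge.
  The starting face and the direction are free, so every rotation and the reversal of a face cycle
  are again face cycles.
\<close>

definition face_cycle ::
    "'a::topological_space set \<Rightarrow> ('v, 'a) drawing \<Rightarrow> 'v \<Rightarrow> 'a set list \<Rightarrow> bool" where
  "face_cycle S M v fs \<longleftrightarrow>
     distinct fs \<and> set fs = {f \<in> faces S M. point M v \<in> closed_face S f} \<and>
     (\<exists>es. distinct es \<and> set es = {e \<in> edges M. v \<in> e} \<and> length es = length fs \<and>
        (\<forall>i < length fs. edge_arc M (es ! i) \<subseteq> closed_face S (fs ! i) \<and>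
           edge_arc M (es ! (Suc i mod length es)) \<subseteq> closed_face S (fs ! i)))"

text \<open>
  The type is written out as a list, e.g. \<open>[3, 3, 3, 4, 4]\<close> for \<open>{3\<^sup>3, 4\<^sup>2}\<close>. Rotations and the
  reversal of the list give the same notion, by the freedom in \<^const>\<open>face_cycle\<close>.
\<close>

definition has_type ::
    "'a::topological_space set \<Rightarrow> ('v, 'a) drawing \<Rightarrow> nat list \<Rightarrow> bool" where
  "has_type S M as \<longleftrightarrow>
     (\<forall>v\<in>verts M. \<exists>fs. face_cycle S M v fs \<and> list_all2 (is_gon S M) as fs)"

end

theory Submission imports Defs "HOL-Complex_Analysis.Complex_Analysis"
begin

text \<open>
  The torus enters only through its universal cover. Each closed face lifts to the plane, where
  winding numbers direct its boundary cycle counterclockwise; then every directed edge lies on the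
  boundary of at most one face. Together with the local structure at the vertices and with
  connectedness, this coherent orientation is all that the combinatorial argument uses.

  For every type except \<open>{6, 3, 6, 3}\<close> the vertices are covered by disjoint cycles: the hexagons for
  \<open>{6, 4, 3, 4}\<close> and \<open>{3\<^sup>4, 6}\<close>, half of the squares for \<open>{3\<^sup>2, 4, 3, 4}\<close> (those with one of the two
  orientations relative to the edges between triangles), the rows for \<open>{3\<^sup>3, 4\<^sup>2}\<close>, and for
  the cubic types the cycles that use two opposite sides of each square and the edges between squares.
  Two cycles containing opposite sides \<open>ab\<close>, \<open>cd\<close> of a quadrilateral \<open>abcd\<close> merge into one
  when these sides are exchanged for \<open>bc\<close> and \<open>da\<close>, and connectedness of the graph yields such
  quadrilaterals until one cycle is left.

  For \<open>{6, 3, 6, 3}\<close> the rotations about hexagons and vertices act on the darts; their relations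
  exhibit the map as a quotient of the trihexagonal tiling by a lattice of translations, and a
  Hamiltonian cycle can be written down row by row.
\<close>

section \<open>Cycles in graphs\<close>

text \<open>An exchange needs a quadrilateral: a square face, or two triangles with a common side.
  The difficulty is that an exchange deletes edges on which a later quadrilateral may depend. For
  most types the quadrilaterals can be chosen so that each cycle edge belongs to at most one of
  them; then they never interfere. In \<open>{3\<^sup>3, 4\<^sup>2}\<close> every row edge borders a
  square and a triangle, so the exchanges on the two sides of a row compete, and one quadrilateral
  per strip has to be selected. In \<open>{6, 3, 6, 3}\<close> triangles meet only hexagons along
  edges, no such quadrilateral exists, and explicit coordinates take over. Orientation matters where
  a local choice of side has to be consistent: it separates the two classes of squares in
  \<open>{3\<^sup>2, 4, 3, 4}\<close>, and it makes the rotation about a hexagon a well-defined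
  permutation for \<open>{6, 3, 6, 3}\<close>. On the topological side the type speaks only of faces
  at vertices, so a face without vertices has to be excluded before every face is known to be a
  polygon.\<close>

fun steps :: "'v list \<Rightarrow> ('v \<times> 'v) set" where
  "steps [] = {}"
| "steps [x] = {}"
| "steps (x # y # zs) = insert (x, y) (steps (y # zs))"

text \<open>The closing pair \<open>(last c, hd c)\<close> is kept apart from \<open>steps\<close>:
  rotating a list changes only which dart closes it, so cutting a cycle at a chosen dart means
  making that dart the closing one.\<close>

definition darts :: "'v list \<Rightarrow> ('v \<times> 'v) set" where
  "darts c = (if c = [] then {} else insert (last c, hd c) (steps c))"

definition uedge :: "'v \<times> 'v \<Rightarrow> 'v set" where
  "uedge d = {fst d, snd d}"

lemma uedge_Pair [simp]: "uedge (u, v) = {u, v}"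
  by (simp add: uedge_def)

lemma steps_append:
  "xs \<noteq> [] \<Longrightarrow> ys \<noteq> [] \<Longrightarrow> steps (xs @ ys) = steps xs \<union> steps ys \<union> {(last xs, hd ys)}"
proof (induction xs rule: steps.induct)
  case (2 x)
  then show ?case by (cases ys) auto
qed auto

lemma steps_conv_nth: "steps xs = {(xs ! i, xs ! Suc i) | i. Suc i < length xs}"
proof (induction xs rule: steps.induct)
  case (3 x y zs)
  have "{((x # y # zs) ! i, (x # y # zs) ! Suc i) |i. Suc i < length (x # y # zs)} =
     insert (x, y) {((y # zs) ! i, (y # zs) ! Suc i) |i. Suc i < length (y # zs)}" (is "?L = ?R")
  proof
    show "?L \<subseteq> ?R"
    proof
      fix p assume "p \<in> ?L"
      then obtain i where i: "p = ((x # y # zs) ! i, (x # y # zs) ! Suc i)" "Suc i < length (x # y # zs)"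
        by blast
      then show "p \<in> ?R" by (cases i) auto
    qed
    show "?R \<subseteq> ?L"
      by (force intro: exI[of _ 0] exI[of _ "Suc _"])
  qed
  then show ?case using 3 by simp
qed auto

lemma darts_conv_nth: "darts c = {(c ! i, c ! (Suc i mod length c)) | i. i < length c}"
proof (cases "c = []")
  case False
  then obtain n where n: "length c = Suc n" by (cases c) auto
  have l: "last c = c ! n" "hd c = c ! 0" using False n by (simp_all add: last_conv_nth hd_conv_nth)
  show ?thesis
  proof
    show "darts c \<subseteq> {(c ! i, c ! (Suc i mod length c)) | i. i < length c}"
    proof
      fix p assume "p \<in> darts c"
      then consider "p = (c ! n, c ! 0)" | i where "p = (c ! i, c ! Suc i)" "Suc i < length c"
        using False l by (auto simp: darts_def steps_conv_nth)
      then show "p \<in> {(c ! i, c ! (Suc i mod length c)) | i. i < length c}"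
      proof cases
        case 1
        then show ?thesis using n by (intro CollectI exI[of _ n]) auto
      next
        case 2
        then show ?thesis by (intro CollectI exI[of _ i]) auto
      qed
    qed
    show "{(c ! i, c ! (Suc i mod length c)) | i. i < length c} \<subseteq> darts c"
    proof clarsimp
      fix i assume i: "i < length c"
      show "(c ! i, c ! (Suc i mod length c)) \<in> darts c"
        using i n l False by (cases "i = n") (auto simp: darts_def steps_conv_nth)
    qed
  qed
qed (simp add: darts_def)

lemma cycle_edges_darts: "cycle_edges c = uedge ` darts c"
  unfolding cycle_edges_def darts_conv_nth uedge_def by (force simp: image_iff)

lemma steps_rev: "steps (rev xs) = (steps xs)\<inverse>"
proof (induction xs rule: steps.induct)
  case (3 x y zs)
  have "steps (rev (x # y # zs)) = steps (rev (y # zs) @ [x])" by simp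
  also have "\<dots> = steps (rev (y # zs)) \<union> {(y, x)}" by (subst steps_append) auto
  finally show ?case using 3 by auto
qed auto

lemma darts_rev: "darts (rev c) = (darts c)\<inverse>"
  by (auto simp: darts_def steps_rev last_rev hd_rev)

lemma cycle_edges_rev: "cycle_edges (rev c) = cycle_edges c"
proof -
  have "uedge ` R\<inverse> = uedge ` R" for R :: "('a \<times> 'a) set"
    by (force simp: uedge_def image_iff)
  then show ?thesis by (simp add: cycle_edges_darts darts_rev)
qed

lemma graph_cycle_rev: "graph_cycle V E (rev c) = graph_cycle V E c"
  by (simp add: graph_cycle_def cycle_edges_rev)

lemma steps_subset: "steps xs \<subseteq> set xs \<times> set xs"
  by (induction xs rule: steps.induct) auto

lemma darts_subset: "darts c \<subseteq> set c \<times> set c"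
  using steps_subset by (auto simp: darts_def)

lemma steps_split:
  "(u, v) \<in> steps xs \<Longrightarrow> \<exists>ys zs. xs = ys @ zs \<and> ys \<noteq> [] \<and> zs \<noteq> [] \<and> last ys = u \<and> hd zs = v"
proof (induction xs rule: steps.induct)
  case (3 x y zs)
  show ?case
  proof (cases "(u, v) = (x, y)")
    case True
    then show ?thesis by (intro exI[of _ "[x]"] exI[of _ "y # zs"]) auto
  next
    case False
    then obtain as bs where "y # zs = as @ bs" "as \<noteq> []" "bs \<noteq> []" "last as = u" "hd bs = v"
      using 3 by auto
    then show ?thesis by (intro exI[of _ "x # as"] exI[of _ bs]) auto
  qed
qed auto

lemma darts_rotate:
  "xs \<noteq> [] \<Longrightarrow> ys \<noteq> [] \<Longrightarrow> darts (xs @ ys) = darts (ys @ xs)"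
  by (auto simp: darts_def steps_append)

lemma rotate_to_dart:
  assumes "(u, v) \<in> darts c"
  obtains c' where "darts c' = darts c" "set c' = set c" "length c' = length c"
    "distinct c' \<longleftrightarrow> distinct c" "c' \<noteq> []" "hd c' = v" "last c' = u"
proof (cases "(u, v) \<in> steps c")
  case True
  then obtain ys zs where "c = ys @ zs" "ys \<noteq> []" "zs \<noteq> []" "last ys = u" "hd zs = v"
    using steps_split by metis
  then show thesis using that[of "zs @ ys"] darts_rotate[of ys zs] by auto
next
  case False
  then have "c \<noteq> []" "u = last c" "v = hd c" using assms by (auto simp: darts_def split: if_splits)
  then show thesis using that[of c] by blast
qed

text \<open>Unlike a dart, an undirected edge may be run through either way by \<open>c\<close>; in
  the second case the reversed list is rotated, which has the same edges.\<close>

lemma rotate_to_edge: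
  assumes "{a, b} \<in> cycle_edges c" "distinct c"
  obtains c' where "cycle_edges c' = cycle_edges c" "set c' = set c" "length c' = length c"
    "distinct c'" "c' \<noteq> []" "hd c' = b" "last c' = a"
proof -
  have "(a, b) \<in> darts c \<or> (b, a) \<in> darts c"
    using assms(1) by (auto simp: cycle_edges_darts uedge_def doubleton_eq_iff)
  then consider "(a, b) \<in> darts c" | "(a, b) \<in> darts (rev c)"
    by (auto simp: darts_rev)
  then show thesis
  proof cases
    case 1
    from rotate_to_dart[OF this] obtain c' where "darts c' = darts c" "set c' = set c"
      "length c' = length c" "distinct c' = distinct c" "c' \<noteq> []" "hd c' = b" "last c' = a" .
    then show thesis using that[of c'] assms by (simp add: cycle_edges_darts)
  next
    case 2
    from rotate_to_dart[OF this] obtain c' where "darts c' = darts (rev c)" "set c' = set (rev c)"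
      "length c' = length (rev c)" "distinct c' = distinct (rev c)" "c' \<noteq> []" "hd c' = b" "last c' = a" .
    then show thesis using that[of c'] assms
      by (metis cycle_edges_darts cycle_edges_rev distinct_rev length_rev set_rev)
  qed
qed

lemma cycle_edges_nonempty_conv:
  "c \<noteq> [] \<Longrightarrow> cycle_edges c = insert {last c, hd c} (uedge ` steps c)"
  by (simp add: cycle_edges_darts darts_def)

text \<open>Cut open at \<open>ab\<close>, the first cycle is a path from \<open>a\<close> to
  \<open>b\<close>; cut open at \<open>cd\<close>, the second is a path from \<open>c\<close> to
  \<open>d\<close>. Concatenated, the paths are joined by \<open>bc\<close> and closed by
  \<open>da\<close>. The survival of all other edges is what the induction in
  \<open>merge_cycles\<close> relies on.\<close>

lemma merge_two_cycles:
  assumes "graph_cycle V E c1" "graph_cycle V E c2" "set c1 \<inter> set c2 = {}"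
    and "{a, b} \<in> cycle_edges c1" "{c, d} \<in> cycle_edges c2" "{b, c} \<in> E" "{d, a} \<in> E"
  obtains c' where "graph_cycle V E c'" "set c' = set c1 \<union> set c2"
    "cycle_edges c1 \<union> cycle_edges c2 - {{a, b}, {c, d}} \<subseteq> cycle_edges c'"
proof -
  obtain c1' where c1': "cycle_edges c1' = cycle_edges c1" "set c1' = set c1"
    "length c1' = length c1" "distinct c1'" "c1' \<noteq> []" "hd c1' = a" "last c1' = b"
    using assms rotate_to_edge[of b a c1] by (auto simp: graph_cycle_def insert_commute)
  obtain c2' where c2': "cycle_edges c2' = cycle_edges c2" "set c2' = set c2"
    "length c2' = length c2" "distinct c2'" "c2' \<noteq> []" "hd c2' = c" "last c2' = d"
    using assms rotate_to_edge[of d c c2] by (auto simp: graph_cycle_def insert_commute)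
  have e: "cycle_edges (c1' @ c2') = uedge ` steps c1' \<union> uedge ` steps c2' \<union> {{b, c}, {d, a}}"
    using c1' c2' by (auto simp: cycle_edges_nonempty_conv steps_append image_Un)
  have e1: "cycle_edges c1 = insert {a, b} (uedge ` steps c1')"
    using c1' cycle_edges_nonempty_conv[of c1'] by (auto simp: insert_commute)
  have e2: "cycle_edges c2 = insert {c, d} (uedge ` steps c2')"
    using c2' cycle_edges_nonempty_conv[of c2'] by (auto simp: insert_commute)
  have "graph_cycle V E (c1' @ c2')"
    using assms c1' c2' e e1 e2 by (auto simp: graph_cycle_def)
  then show thesis using that[of "c1' @ c2'"] c1' c2' e e1 e2 by auto
qed

text \<open>Two squares may share a removed edge only if they remove the same pair, so that performing an
  exchange never spoils another one that is still needed.\<close>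

lemma merge_cycles:
  assumes "finite P" "\<And>c. c \<in> P \<Longrightarrow> graph_cycle V E c"
    and "\<And>c d. c \<in> P \<Longrightarrow> d \<in> P \<Longrightarrow> c \<noteq> d \<Longrightarrow> set c \<inter> set d = {}"
    and "V = \<Union>(set ` P)" "V \<noteq> {}"
    and "\<And>a b c d. Q a b c d \<Longrightarrow> {a, b} \<in> \<Union>(cycle_edges ` P) \<and> {c, d} \<in> \<Union>(cycle_edges ` P)
      \<and> {b, c} \<in> E \<and> {d, a} \<in> E"
    and "\<And>a b c d a' b' c' d'. Q a b c d \<Longrightarrow> Q a' b' c' d' \<Longrightarrow>
      {{a, b}, {c, d}} \<inter> {{a', b'}, {c', d'}} \<noteq> {} \<Longrightarrow> {{a, b}, {c, d}} = {{a', b'}, {c', d'}}"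
    and "\<And>U. U \<subseteq> V \<Longrightarrow> U \<noteq> {} \<Longrightarrow> U \<noteq> V \<Longrightarrow> (\<And>c. c \<in> P \<Longrightarrow> set c \<subseteq> U \<or> set c \<inter> U = {}) \<Longrightarrow>
      \<exists>a b c d. Q a b c d \<and> (a \<in> U \<longleftrightarrow> c \<notin> U)"
  shows "hamiltonian V E"
  using assms
proof (induction "card P" arbitrary: P Q rule: less_induct)
  case less
  note cyc = less.prems(2) and disj = less.prems(3) and V = less.prems(4)
    and quad = less.prems(6) and share = less.prems(7) and conn = less.prems(8)
  obtain c0 where c0: "c0 \<in> P" using less.prems(4,5) by auto
  show ?case
  proof (cases "set c0 = V")
    case True
    then show ?thesis using c0 cyc by (auto simp: hamiltonian_def)
  next
    case False
    have "c0 \<noteq> []" using cyc[OF c0] by (auto simp: graph_cycle_def)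
    \<comment> \<open>A single cycle is a union of members of the family, hence an admissible side
      of a cut.\<close>
    then have "\<exists>a b c d. Q a b c d \<and> (a \<in> set c0 \<longleftrightarrow> c \<notin> set c0)"
    proof (intro conn)
      show "set c0 \<subseteq> V" using c0 V by blast
      show "set c0 \<noteq> V" by fact
      show "set c \<subseteq> set c0 \<or> set c \<inter> set c0 = {}" if "c \<in> P" for c
        using disj[OF that c0] by blast
    qed simp
    then obtain a b c d where q: "Q a b c d" and cr: "a \<in> set c0 \<longleftrightarrow> c \<notin> set c0"
      by blast
    obtain c1 where c1: "c1 \<in> P" "{a, b} \<in> cycle_edges c1" using quad[OF q] by auto
    obtain c2 where c2: "c2 \<in> P" "{c, d} \<in> cycle_edges c2" using quad[OF q] by auto
    have ab: "a \<in> set c1" "b \<in> set c1" using c1 darts_subset[of c1]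
      by (auto simp: cycle_edges_darts uedge_def doubleton_eq_iff)
    have cd: "c \<in> set c2" "d \<in> set c2" using c2 darts_subset[of c2]
      by (auto simp: cycle_edges_darts uedge_def doubleton_eq_iff)
    have ne: "c1 \<noteq> c2" using cr ab cd c1 c2 c0 disj by blast
    obtain c' where c': "graph_cycle V E c'" "set c' = set c1 \<union> set c2"
      "cycle_edges c1 \<union> cycle_edges c2 - {{a, b}, {c, d}} \<subseteq> cycle_edges c'"
      using merge_two_cycles[OF cyc[OF c1(1)] cyc[OF c2(1)] disj[OF c1(1) c2(1) ne] c1(2) c2(2)]
        quad[OF q] by metis
    define P' where "P' = insert c' (P - {c1, c2})"
    \<comment> \<open>A quadrilateral that meets the removed edges removes exactly the same pair, by
      \<open>share\<close>; it joins the two cycles just merged and is dropped. All the others keep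
      both of their cycle edges.\<close>
    define Q' where "Q' = (\<lambda>a' b' c' d'. Q a' b' c' d' \<and> {{a', b'}, {c', d'}} \<inter> {{a, b}, {c, d}} = {})"
    have "card P' \<le> Suc (card (P - {c1, c2}))"
      unfolding P'_def using less.prems(1) by (simp add: card_insert_if)
    moreover have "card (P - {c1, c2}) = card P - 2"
      using c1 c2 ne less.prems(1) by (simp add: card_Diff_subset)
    moreover have "card P \<ge> 2" using c1 c2 ne less.prems(1)
      by (metis card_2_iff card_mono empty_subsetI insert_subset)
    ultimately have card: "card P' < card P" by linarith
    show ?thesis
    proof (rule less.hyps[OF card, of Q'])
      show "finite P'" using less.prems(1) by (simp add: P'_def)
      show "graph_cycle V E e" if "e \<in> P'" for e using that c' cyc by (auto simp: P'_def)
      show "set x \<inter> set y = {}" if "x \<in> P'" "y \<in> P'" "x \<noteq> y" for x y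
        using that disj c1 c2 c'(2) unfolding P'_def by (auto; blast)
      show "V = \<Union>(set ` P')" using V c1 c2 c'(2) by (auto simp: P'_def)
      show "V \<noteq> {}" by fact
      have E': "\<Union>(cycle_edges ` P) - {{a, b}, {c, d}} \<subseteq> \<Union>(cycle_edges ` P')"
        using c'(3) by (auto simp: P'_def)
      show "{a', b'} \<in> \<Union>(cycle_edges ` P') \<and> {c', d'} \<in> \<Union>(cycle_edges ` P')
          \<and> {b', c'} \<in> E \<and> {d', a'} \<in> E" if "Q' a' b' c' d'" for a' b' c' d'
      proof -
        have q': "Q a' b' c' d'" "{{a', b'}, {c', d'}} \<inter> {{a, b}, {c, d}} = {}"
          using that unfolding Q'_def by simp_all
        then have "{a', b'} \<notin> {{a, b}, {c, d}}" "{c', d'} \<notin> {{a, b}, {c, d}}" by blast+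
        then have "{a', b'} \<in> \<Union>(cycle_edges ` P) - {{a, b}, {c, d}}"
          "{c', d'} \<in> \<Union>(cycle_edges ` P) - {{a, b}, {c, d}}" using quad[OF q'(1)] by simp_all
        then show ?thesis using quad[OF q'(1)] subsetD[OF E'] by metis
      qed
      show "{{w, x}, {y, z}} = {{w', x'}, {y', z'}}"
        if "Q' w x y z" "Q' w' x' y' z'" "{{w, x}, {y, z}} \<inter> {{w', x'}, {y', z'}} \<noteq> {}"
        for w x y z w' x' y' z'
        using share[OF _ _ that(3)] that(1,2) unfolding Q'_def by simp
      show "\<exists>w x y z. Q' w x y z \<and> (w \<in> U \<longleftrightarrow> y \<notin> U)"
        if U: "U \<subseteq> V" "U \<noteq> {}" "U \<noteq> V" "\<And>e. e \<in> P' \<Longrightarrow> set e \<subseteq> U \<or> set e \<inter> U = {}" for U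
      proof -
        \<comment> \<open>A union of cycles of the new family is also a union of cycles of the old
          one, so the old family supplies a crossing quadrilateral.\<close>
        have cU: "set c1 \<union> set c2 \<subseteq> U \<or> (set c1 \<union> set c2) \<inter> U = {}"
          using U(4)[of c'] c'(2) by (auto simp: P'_def)
        have "set e \<subseteq> U \<or> set e \<inter> U = {}" if "e \<in> P" for e
        proof (cases "e = c1 \<or> e = c2")
          case True
          then show ?thesis using cU by blast
        next
          case False
          then show ?thesis using U(4)[of e] that by (auto simp: P'_def)
        qed
        then obtain w x y z where w: "Q w x y z" "w \<in> U \<longleftrightarrow> y \<notin> U"
          using conn[OF U(1-3)] by blast
        \<comment> \<open>If it had been dropped, its corners \<open>w\<close> and \<open>y\<close>
          would both lie on the merged cycle, which is entirely on one side of \<open>U\<close>,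
          whereas the quadrilateral crosses \<open>U\<close>.\<close>
        have "{{w, x}, {y, z}} \<inter> {{a, b}, {c, d}} = {}"
        proof (rule ccontr)
          assume "\<not> ?thesis"
          then have "{{w, x}, {y, z}} = {{a, b}, {c, d}}" by (rule share[OF w(1) q])
          then have "\<Union>{{w, x}, {y, z}} = \<Union>{{a, b}, {c, d}}" by (rule arg_cong)
          then have "w \<in> {a, b, c, d}" "y \<in> {a, b, c, d}" by auto
          then have "w \<in> set c1 \<union> set c2" "y \<in> set c1 \<union> set c2" using ab cd by auto
          then show False using cU w(2) by blast
        qed
        then show ?thesis using w unfolding Q'_def by blast
      qed
    qed
  qed
qed

section \<open>Decomposition of two-regular symmetric relations into cycles\<close>

lemma longest_walk:
  assumes "finite V" "v \<in> V" "\<And>x. x \<in> V \<Longrightarrow> N x \<subseteq> V"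
  obtains xs where "xs \<noteq> []" "distinct xs" "set xs \<subseteq> V"
    "\<And>i. Suc i < length xs \<Longrightarrow> xs ! Suc i \<in> N (xs ! i)" "N (last xs) \<subseteq> set xs"
proof -
  define W where "W = {xs. xs \<noteq> [] \<and> distinct xs \<and> set xs \<subseteq> V \<and>
    (\<forall>i. Suc i < length xs \<longrightarrow> xs ! Suc i \<in> N (xs ! i))}"
  have "[v] \<in> W" using assms by (simp add: W_def)
  moreover have "length xs < Suc (card V)" if "xs \<in> W" for xs
    using that assms(1) by (metis (mono_tags, lifting) W_def card_mono distinct_card le_imp_less_Suc mem_Collect_eq)
  ultimately obtain xs where xs: "xs \<in> W" "\<And>ys. ys \<in> W \<Longrightarrow> length ys \<le> length xs"
    using ex_has_greatest_nat[of "\<lambda>xs. xs \<in> W" "[v]" length "Suc (card V)"] by blast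
  have ne: "xs \<noteq> []" using xs(1) by (simp add: W_def)
  have "y \<in> set xs" if y: "y \<in> N (last xs)" for y
  proof (rule ccontr)
    assume no: "y \<notin> set xs"
    have "last xs \<in> V" using xs(1) by (auto simp: W_def)
    then have yV: "y \<in> V" using y assms(3) by blast
    have "(xs @ [y]) ! Suc i \<in> N ((xs @ [y]) ! i)" if "Suc i < length (xs @ [y])" for i
    proof (cases "Suc i < length xs")
      case True
      then show ?thesis using xs(1) by (simp add: W_def nth_append)
    next
      case False
      then have "Suc i = length xs" using that by simp
      then have "i = length xs - 1" "i < length xs" by simp_all
      then show ?thesis using y ne by (simp add: nth_append last_conv_nth)
    qed
    then have "xs @ [y] \<in> W"
      using xs(1) yV no by (simp add: W_def)
    then show False using xs(2)[of "xs @ [y]"] by simp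
  qed
  then show thesis using that[of xs] xs(1) by (simp add: W_def subset_iff)
qed

text \<open>On a longest walk the last vertex has both neighbours on the walk. Inner vertices have
  already spent their two neighbours on the vertices before and after them, so besides its
  predecessor the last vertex can only be joined to the first one: the walk closes up.\<close>

lemma closed_walk:
  assumes "finite V" "V \<noteq> {}" "\<forall>v\<in>V. N v \<subseteq> V - {v} \<and> card (N v) = 2"
    and "\<forall>u\<in>V. \<forall>v\<in>V. u \<in> N v \<longrightarrow> v \<in> N u"
  shows "\<exists>xs. 3 \<le> length xs \<and> distinct xs \<and> set xs \<subseteq> V \<and>
    (\<forall>i<length xs. N (xs ! i) = {xs ! (Suc i mod length xs), xs ! ((i + length xs - 1) mod length xs)})"
proof -
  have N: "N v \<subseteq> V - {v} \<and> card (N v) = 2" if "v \<in> V" for v using assms(3) that by blast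
  have sym: "v \<in> N u" if "u \<in> V" "v \<in> V" "u \<in> N v" for u v using assms(4) that by blast
  obtain v where "v \<in> V" using assms(2) by blast
  then obtain xs where xs: "xs \<noteq> []" "distinct xs" "set xs \<subseteq> V"
    "\<And>i. Suc i < length xs \<Longrightarrow> xs ! Suc i \<in> N (xs ! i)" "N (last xs) \<subseteq> set xs"
    using longest_walk[of V v N] assms(1) N by blast
  define n where "n = length xs"
  have n: "n > 0" using xs(1) by (simp add: n_def)
  have V: "xs ! i \<in> V" if "i < n" for i using that xs(3) n_def by auto
  have inj: "xs ! i = xs ! j \<longleftrightarrow> i = j" if "i < n" "j < n" for i j
    using that xs(2) n_def nth_eq_iff_index_eq by metis
  have two: "N x = {y, z}" if "x \<in> V" "y \<in> N x" "z \<in> N x" "y \<noteq> z" for x y z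
  proof -
    have "finite (N x)" "card (N x) = 2" using N[OF that(1)] by (auto intro: card_ge_0_finite)
    then show ?thesis using that by (intro card_subset_eq[symmetric]) auto
  qed
  have prev: "xs ! i \<in> N (xs ! Suc i)" if "Suc i < n" for i
    using sym[of "xs ! Suc i" "xs ! i"] V xs(4)[of i] that n_def by simp
  have inner: "N (xs ! i) = {xs ! Suc i, xs ! (i - 1)}" if "0 < i" "Suc i < n" for i
    using two[of "xs ! i" "xs ! Suc i" "xs ! (i - 1)"] V[of i] xs(4)[of i] prev[of "i - 1"] that inj n_def by simp
  define z where "z = xs ! (n - 1)"
  have z: "z \<in> V" "N z \<subseteq> set xs" using V n xs(1,5) by (auto simp: z_def n_def last_conv_nth)
  have Nz: "N z \<subseteq> {xs ! 0, xs ! (n - 2)}"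
  proof
    fix y assume y: "y \<in> N z"
    then obtain j where j: "j < n" "y = xs ! j" using z(2) n_def by (metis in_set_conv_nth subsetD)
    have "j \<noteq> n - 1" using y j N[OF z(1)] z_def by auto
    show "y \<in> {xs ! 0, xs ! (n - 2)}"
    proof (cases "j = 0")
      case False
      have "z \<in> N y" using sym[of y z] y z(1) j V by simp
      then have "z \<in> {xs ! Suc j, xs ! (j - 1)}" using inner[of j] False j \<open>j \<noteq> n - 1\<close> by simp
      then have "Suc j = n - 1" using inj[of "n - 1" "Suc j"] inj[of "n - 1" "j - 1"] j \<open>j \<noteq> n - 1\<close> n
        unfolding z_def by auto
      then have "j = n - 2" by simp
      then show ?thesis using j by simp
    qed (use j in simp)
  qed
  have "card (N z) = 2" using N[OF z(1)] by simp
  then have ne: "xs ! 0 \<noteq> xs ! (n - 2)" using Nz card_mono[of "{xs ! 0}" "N z"] by auto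
  then have Nz': "N z = {xs ! 0, xs ! (n - 2)}"
    using \<open>card (N z) = 2\<close> Nz by (intro card_subset_eq) auto
  \<comment> \<open>Natural subtraction makes \<open>n - 2\<close> equal to 0 for
    \<open>n = 1\<close> as well as for \<open>n = 2\<close>, so the inequality just shown excludes
    both.\<close>
  have "n \<noteq> 1" "n \<noteq> 2" using ne by auto
  then have n3: "3 \<le> n" using n by linarith
  have N0: "N (xs ! 0) = {xs ! 1, z}"
  proof (rule two)
    show "xs ! 0 \<in> V" using V n by simp
    show "xs ! 1 \<in> N (xs ! 0)" using xs(4)[of 0] n3 n_def by simp
    show "z \<in> N (xs ! 0)" using sym[of "xs ! 0" z] Nz' z(1) V[of 0] n by simp
    show "xs ! 1 \<noteq> z" using inj[of 1 "n - 1"] n3 by (simp add: z_def)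
  qed
  show ?thesis
  proof (intro exI[of _ xs] conjI allI impI)
    show "3 \<le> length xs" using n3 n_def by simp
    show "N (xs ! i) = {xs ! (Suc i mod length xs), xs ! ((i + length xs - 1) mod length xs)}"
      if il: "i < length xs" for i
    proof -
      consider "i = 0" | "0 < i" "Suc i < n" | "i = n - 1" "i > 0" using il n_def by linarith
      then show ?thesis
      proof cases
        case 1
        then show ?thesis using N0 n3 unfolding z_def n_def by simp
      next
        case 2
        then have "i + n - 1 = (i - 1) + n" by simp
        then have "(i + n - 1) mod n = (i - 1) mod n" by (metis mod_add_self2)
        then have "(i + n - 1) mod n = i - 1" using 2 by simp
        then show ?thesis using inner[OF 2] 2 unfolding n_def by simp
      next
        case 3
        then have "i + n - 1 = (n - 2) + n" using n3 by simp
        then have "(i + n - 1) mod n = (n - 2) mod n" by (metis mod_add_self2)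
        then have a: "(i + n - 1) mod n = n - 2" using n3 by simp
        have b: "Suc i mod n = 0" using 3 n by simp
        show ?thesis using Nz' 3 a b unfolding z_def n_def by auto
      qed
    qed
  qed (use xs in auto)
qed

text \<open>Closed walks are split off one at a time. By symmetry no vertex outside a closed walk
  has a neighbour on it, so the rest is again two-regular with the same \<open>N\<close>.\<close>

lemma two_factor:
  assumes "finite V" "\<forall>v\<in>V. N v \<subseteq> V - {v} \<and> card (N v) = 2"
    and "\<forall>u\<in>V. \<forall>v\<in>V. u \<in> N v \<longrightarrow> v \<in> N u"
  shows "\<exists>P. finite P \<and> (\<forall>c \<in> P. 3 \<le> length c \<and> distinct c) \<and>
    (\<forall>c \<in> P. \<forall>d \<in> P. c \<noteq> d \<longrightarrow> set c \<inter> set d = {}) \<and> \<Union>(set ` P) = V \<and>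
    \<Union>(cycle_edges ` P) = {{u, v} | u v. u \<in> V \<and> v \<in> N u}"
  using assms
proof (induction "card V" arbitrary: V rule: less_induct)
  case less
  have N: "N v \<subseteq> V - {v} \<and> card (N v) = 2" if "v \<in> V" for v using less.prems(2) that by blast
  have sym: "v \<in> N u" if "u \<in> V" "v \<in> V" "u \<in> N v" for u v using less.prems(3) that by blast
  show ?case
  proof (cases "V = {}")
    case True
    then show ?thesis by (intro exI[of _ "{}"]) auto
  next
    case False
    obtain xs where xs: "3 \<le> length xs" "distinct xs" "set xs \<subseteq> V"
      "\<forall>i<length xs. N (xs ! i) = {xs ! (Suc i mod length xs), xs ! ((i + length xs - 1) mod length xs)}"
      using closed_walk[OF less.prems(1) False less.prems(2,3)] by (elim exE conjE)
    define n where "n = length xs"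
    have n: "n \<ge> 3" using xs(1) n_def by simp
    have cl: "N x \<subseteq> set xs" if x: "x \<in> set xs" for x
    proof -
      obtain i where i: "i < length xs" "x = xs ! i" using x by (metis in_set_conv_nth)
      have "Suc i mod length xs < length xs" "(i + length xs - 1) mod length xs < length xs"
        by (rule mod_less_divisor; use xs(1) in linarith)+
      then show ?thesis using xs(4) i(1) i by simp
    qed
    define V' where "V' = V - set xs"
    have ne: "set xs \<noteq> {}" using xs(1) by auto
    have "xs ! 0 \<in> V" "xs ! 0 \<notin> V'" using nth_mem[of 0 xs] xs(1,3) unfolding V'_def by fastforce+
    then have "V' \<subset> V" unfolding V'_def by blast
    then have 1: "card V' < card V" by (rule psubset_card_mono[OF less.prems(1)])
    have 2: "finite V'" using less.prems(1) by (simp add: V'_def)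
    have 3: "N u \<subseteq> V' - {u} \<and> card (N u) = 2" if u: "u \<in> V'" for u
    proof -
      have uV: "u \<in> V" "u \<notin> set xs" using u by (auto simp: V'_def)
      have "y \<notin> set xs" if y: "y \<in> N u" for y
      proof
        assume "y \<in> set xs"
        then have "N y \<subseteq> set xs" "y \<in> V" using cl xs(3) by auto
        then show False using sym[of y u] uV y by auto
      qed
      then have "N u \<inter> set xs = {}" by auto
      moreover have "N u \<subseteq> V - {u}" "card (N u) = 2" using N[OF uV(1)] by auto
      ultimately show ?thesis unfolding V'_def by auto
    qed
    have 4: "v \<in> N u" if "u \<in> V'" "v \<in> V'" "u \<in> N v" for u v
      using sym[of u v] that by (simp add: V'_def)
    have 34: "\<forall>v\<in>V'. N v \<subseteq> V' - {v} \<and> card (N v) = 2" "\<forall>u\<in>V'. \<forall>v\<in>V'. u \<in> N v \<longrightarrow> v \<in> N u"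
      using 3 4 by simp_all
    obtain P where P: "finite P" "\<forall>c \<in> P. 3 \<le> length c \<and> distinct c"
      "\<forall>c \<in> P. \<forall>d \<in> P. c \<noteq> d \<longrightarrow> set c \<inter> set d = {}" "\<Union>(set ` P) = V'"
      "\<Union>(cycle_edges ` P) = {{u, v} | u v. u \<in> V' \<and> v \<in> N u}"
      using less.hyps[OF 1 2 34] by (elim exE conjE)
    have ce: "cycle_edges xs = {{u, v} | u v. u \<in> set xs \<and> v \<in> N u}"
    proof
      show "cycle_edges xs \<subseteq> {{u, v} | u v. u \<in> set xs \<and> v \<in> N u}"
      proof
        fix e assume "e \<in> cycle_edges xs"
        then obtain i where i: "i < length xs" "e = {xs ! i, xs ! (Suc i mod length xs)}"
          unfolding cycle_edges_def by blast
        then have "xs ! i \<in> set xs" "xs ! (Suc i mod length xs) \<in> N (xs ! i)" using xs(4) by simp_all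
        then show "e \<in> {{u, v} | u v. u \<in> set xs \<and> v \<in> N u}" using i(2) by blast
      qed
      show "{{u, v} | u v. u \<in> set xs \<and> v \<in> N u} \<subseteq> cycle_edges xs"
      proof clarify
        fix u v assume u: "u \<in> set xs" "v \<in> N u"
        obtain i where i: "i < n" "u = xs ! i" using u n_def by (metis in_set_conv_nth)
        define j where "j = (i + n - 1) mod n"
        have j: "j < n" using n by (simp add: j_def)
        have sj: "Suc j mod n = i"
        proof -
          have "Suc j mod n = Suc (i + n - 1) mod n" unfolding j_def by (simp only: mod_Suc_eq)
          also have "Suc (i + n - 1) = i + n" using n by simp
          finally show ?thesis using i by simp
        qed
        have "v = xs ! (Suc i mod n) \<or> v = xs ! j" using u xs(4) i n_def j_def by auto
        then show "{u, v} \<in> cycle_edges xs"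
        proof
          assume "v = xs ! (Suc i mod n)"
          then show ?thesis using i n_def by (auto simp: cycle_edges_def)
        next
          assume "v = xs ! j"
          then have "{u, v} = {xs ! j, xs ! (Suc j mod n)}" using sj i by auto
          then show ?thesis using j n_def by (auto simp: cycle_edges_def)
        qed
      qed
    qed
    have xsP: "\<forall>c\<in>P. set xs \<inter> set c = {}" using P(4) unfolding V'_def by blast
    show ?thesis
    proof (intro exI[of _ "insert xs P"] conjI)
      show "\<forall>c\<in>insert xs P. 3 \<le> length c \<and> distinct c" using P xs by auto
      show "\<forall>c\<in>insert xs P. \<forall>d\<in>insert xs P. c \<noteq> d \<longrightarrow> set c \<inter> set d = {}"
        using P(3) xsP by blast
      show "\<Union>(set ` insert xs P) = V" using P(4) xs(3) unfolding V'_def by auto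
      have "V = V' \<union> set xs" using xs(3) unfolding V'_def by auto
      then show "\<Union>(cycle_edges ` insert xs P) = {{u, v} | u v. u \<in> V \<and> v \<in> N u}"
        using P(5) ce by auto
      show "finite (insert xs P)" using P(1) by simp
    qed
  qed
qed

section \<open>Polygonal maps\<close>

lemma darts_functional:
  assumes "distinct c" "(u, v) \<in> darts c" "(u, w) \<in> darts c"
  shows "v = w"
  using assms by (auto simp: darts_conv_nth nth_eq_iff_index_eq)

lemma darts_functional':
  assumes "distinct c" "(v, u) \<in> darts c" "(w, u) \<in> darts c"
  shows "v = w"
  using darts_functional[of "rev c" u v w] assms by (simp add: darts_rev)

text \<open>Rotated so that \<open>(u, v)\<close> closes the list, the cycle starts with
  \<open>v\<close> followed by some \<open>x\<close>, and having at least three vertices makes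
  \<open>x\<close> different from the last vertex \<open>u\<close>. On a cycle of length two both
  directions would occur.\<close>

lemma darts_asym:
  assumes "distinct c" "3 \<le> length c" "(u, v) \<in> darts c"
  shows "(v, u) \<notin> darts c" "u \<noteq> v"
proof -
  obtain c' where c': "darts c' = darts c" "length c' = length c" "distinct c'" "c' \<noteq> []" "hd c' = v" "last c' = u"
    using rotate_to_dart[OF assms(3)] assms(1) by blast
  have "Suc (Suc (Suc 0)) \<le> length c'" using assms(2) c'(2) by simp
  then obtain v' x y zs where "c' = v' # x # y # zs" by (auto simp: Suc_le_length_iff)
  then have xs: "c' = v # x # y # zs" using c'(5) by simp
  have "last c' \<noteq> x" "last c' \<noteq> v" using c'(3) xs by auto
  then show "u \<noteq> v" using c'(6) by simp
  have "(v, x) \<in> darts c'" using xs by (simp add: darts_def)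
  moreover have "x \<noteq> u" using \<open>last c' \<noteq> x\<close> c'(6) by simp
  ultimately show "(v, u) \<notin> darts c" using darts_functional[OF c'(3)] c'(1) by metis
qed

lemma darts_total:
  assumes "x \<in> set c"
  shows "\<exists>y. (x, y) \<in> darts c" "\<exists>y. (y, x) \<in> darts c"
proof -
  have *: "\<exists>y. (x, y) \<in> darts c" if "x \<in> set c" for c
    using that by (auto simp: darts_conv_nth in_set_conv_nth)
  from *[OF assms] show "\<exists>y. (x, y) \<in> darts c" .
  show "\<exists>y. (y, x) \<in> darts c" using *[of "rev c"] assms by (simp add: darts_rev)
qed

text \<open>\<open>orient\<close> says that the face cycles are directed coherently, so the surface is orientable.\<close>

locale polygonal_map =
  fixes V :: "'v set" and E :: "'v set set" and F :: "'f set" and cyc :: "'f \<Rightarrow> 'v list"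
    and as :: "nat list"
  assumes finV: "finite V" and Vne: "V \<noteq> {}"
    and edgeE: "\<And>e. e \<in> E \<Longrightarrow> \<exists>u v. e = {u, v} \<and> u \<noteq> v \<and> u \<in> V \<and> v \<in> V"
    and cyc: "\<And>f. f \<in> F \<Longrightarrow> graph_cycle V E (cyc f)"
    and degree: "3 \<le> length as"
    and star: "\<And>v. v \<in> V \<Longrightarrow> \<exists>ns fs. distinct ns \<and> distinct fs \<and> length ns = length as \<and>
      set ns = {u. {v, u} \<in> E} \<and> set fs = {f \<in> F. v \<in> set (cyc f)} \<and> map (\<lambda>f. length (cyc f)) fs = as \<and>
      (\<forall>i<length as. {v, ns ! i} \<in> cycle_edges (cyc (fs ! i)) \<and>
        {v, ns ! (Suc i mod length as)} \<in> cycle_edges (cyc (fs ! i)))"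
    and conn: "\<And>U. U \<subseteq> V \<Longrightarrow> U \<noteq> {} \<Longrightarrow> U \<noteq> V \<Longrightarrow> \<exists>u\<in>U. \<exists>w\<in>V - U. {u, w} \<in> E"
    and orient: "\<And>f g d. f \<in> F \<Longrightarrow> g \<in> F \<Longrightarrow> d \<in> darts (cyc f) \<Longrightarrow> d \<in> darts (cyc g) \<Longrightarrow> f = g"
begin

section \<open>Edges, faces and stars in a polygonal map\<close>

definition sz :: "'f \<Rightarrow> nat" where "sz f = length (cyc f)"

definition dd :: "'f \<Rightarrow> 'v \<Rightarrow> 'v \<Rightarrow> bool" where "dd f u v \<longleftrightarrow> f \<in> F \<and> (u, v) \<in> darts (cyc f)"

definition ed :: "'f \<Rightarrow> 'v \<Rightarrow> 'v \<Rightarrow> bool" where "ed f u v \<longleftrightarrow> f \<in> F \<and> {u, v} \<in> cycle_edges (cyc f)"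

lemma ed_dd: "ed f u v \<longleftrightarrow> dd f u v \<or> dd f v u"
  by (force simp: ed_def dd_def cycle_edges_darts uedge_def image_iff doubleton_eq_iff)

lemma ed_sym: "ed f u v \<Longrightarrow> ed f v u"
  by (simp add: ed_def insert_commute)

lemma ed_comm: "ed f u v \<longleftrightarrow> ed f v u"
  using ed_sym by blast

lemma cycD: "f \<in> F \<Longrightarrow> distinct (cyc f)" "f \<in> F \<Longrightarrow> 3 \<le> length (cyc f)"
  "f \<in> F \<Longrightarrow> set (cyc f) \<subseteq> V" "f \<in> F \<Longrightarrow> cycle_edges (cyc f) \<subseteq> E"
  using cyc by (auto simp: graph_cycle_def)

lemma dd_out: "dd f u v \<Longrightarrow> dd f u w \<Longrightarrow> v = w"
  unfolding dd_def using darts_functional[OF cycD(1)] by blast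

lemma dd_in: "dd f v u \<Longrightarrow> dd f w u \<Longrightarrow> v = w"
  unfolding dd_def using darts_functional'[OF cycD(1)] by blast

lemma dd_asym: "dd f u v \<Longrightarrow> \<not> dd f v u"
  unfolding dd_def using darts_asym(1)[OF cycD(1,2)] by blast

lemma dd_face: "dd f u v \<Longrightarrow> dd g u v \<Longrightarrow> f = g"
  using orient by (auto simp: dd_def)

lemma ed_E: "ed f u v \<Longrightarrow> {u, v} \<in> E" "ed f u v \<Longrightarrow> u \<in> V" "ed f u v \<Longrightarrow> v \<in> V"
  "ed f u v \<Longrightarrow> u \<noteq> v" "ed f u v \<Longrightarrow> f \<in> F" "ed f u v \<Longrightarrow> u \<in> set (cyc f)" "ed f u v \<Longrightarrow> v \<in> set (cyc f)"
proof -
  assume e: "ed f u v"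
  show 1: "{u, v} \<in> E" "f \<in> F" using e cycD(4) by (auto simp: ed_def)
  show "u \<in> set (cyc f)" "v \<in> set (cyc f)" using e darts_subset[of "cyc f"] unfolding ed_dd dd_def by auto
  then show "u \<in> V" "v \<in> V" using cycD(3) 1(2) by auto
  show "u \<noteq> v" using e darts_asym(2) cycD(1,2) unfolding ed_dd dd_def by metis
qed

lemma E_sym: "{u, v} \<in> E \<longleftrightarrow> {v, u} \<in> E"
  by (simp add: insert_commute)

lemma two_darts:
  assumes "f \<in> F" "v \<in> set (cyc f)"
  obtains u w where "dd f u v" "dd f v w" "u \<noteq> w" "\<And>x. ed f v x \<longleftrightarrow> x = u \<or> x = w"
proof -
  obtain u w where uw: "dd f u v" "dd f v w" using darts_total assms by (metis dd_def)
  moreover have "u \<noteq> w" using uw dd_asym by blast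
  moreover have "ed f v x \<longleftrightarrow> x = u \<or> x = w" for x
    using uw dd_out dd_in unfolding ed_dd by blast
  ultimately show thesis using that by blast
qed

lemma ed_two:
  assumes "ed f v x" "ed f v y" "x \<noteq> y"
  shows "ed f v z \<longleftrightarrow> z = x \<or> z = y"
proof -
  obtain u w where uw: "\<And>x. ed f v x \<longleftrightarrow> x = u \<or> x = w"
    using two_darts[OF ed_E(5,6)[OF assms(1)]] by blast
  show ?thesis using assms unfolding uw by blast
qed

text \<open>The implication in \<open>star\<close> becomes an equivalence: a boundary cycle has only
  two edges at \<open>v\<close>, and the star already provides two different ones for each face.
  With everything at \<open>v\<close> described in this way, local case distinctions become
  propositional reasoning.\<close>

lemma star_ed:
  assumes "v \<in> V"
  shows "\<exists>ns fs. distinct ns \<and> distinct fs \<and> length ns = length as \<and> length fs = length as \<and>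
    map sz fs = as \<and> (\<forall>x. {v, x} \<in> E \<longleftrightarrow> x \<in> set ns) \<and>
    (\<forall>f x. ed f v x \<longleftrightarrow> (\<exists>i<length as. f = fs ! i \<and> (x = ns ! i \<or> x = ns ! (Suc i mod length as))))"
proof -
  obtain ns fs where *: "distinct ns" "distinct fs" "length ns = length as"
    "set ns = {u. {v, u} \<in> E}" "set fs = {f \<in> F. v \<in> set (cyc f)}" "map (\<lambda>f. length (cyc f)) fs = as"
    "\<forall>i<length as. {v, ns ! i} \<in> cycle_edges (cyc (fs ! i)) \<and>
        {v, ns ! (Suc i mod length as)} \<in> cycle_edges (cyc (fs ! i))"
    using star[OF assms] by (elim exE conjE)
  have l: "length fs = length as" using *(6) by (metis length_map)
  have e: "ed (fs ! i) v (ns ! i) \<and> ed (fs ! i) v (ns ! (Suc i mod length as))" if "i < length as" for i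
    using *(5,7) l that nth_mem[of i fs] by (auto simp: ed_def)
  have ne: "ns ! i \<noteq> ns ! (Suc i mod length as)" if "i < length as" for i
  proof -
    have "Suc i mod length as < length as" using degree by (intro mod_less_divisor) linarith
    moreover have "Suc i mod length as \<noteq> i" using that degree by (cases "Suc i = length as") auto
    ultimately show ?thesis using *(1,3) that by (metis nth_eq_iff_index_eq)
  qed
  have "ed f v x \<longleftrightarrow> (\<exists>i<length as. f = fs ! i \<and> (x = ns ! i \<or> x = ns ! (Suc i mod length as)))" for f x
  proof
    assume f: "ed f v x"
    then have "f \<in> set fs" using ed_E(5,6)[OF f] *(5) by simp
    then obtain i where i: "i < length as" "f = fs ! i" using l by (metis in_set_conv_nth)
    have "ed f v (ns ! i)" "ed f v (ns ! (Suc i mod length as))" using e[OF i(1)] i by simp_all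
    from ed_two[OF this ne[OF i(1)], of x] f
    show "\<exists>i<length as. f = fs ! i \<and> (x = ns ! i \<or> x = ns ! (Suc i mod length as))" using i by blast
  next
    assume "\<exists>i<length as. f = fs ! i \<and> (x = ns ! i \<or> x = ns ! (Suc i mod length as))"
    then obtain i where "i < length as" "f = fs ! i" "x = ns ! i \<or> x = ns ! (Suc i mod length as)" by blast
    then show "ed f v x" using e by metis
  qed
  moreover have "map sz fs = as" using *(6) by (simp add: sz_def[abs_def])
  moreover have "\<forall>x. {v, x} \<in> E \<longleftrightarrow> x \<in> set ns" using *(4) by simp
  ultimately show ?thesis using *(1,2,3) l by (intro exI[of _ ns] exI[of _ fs] conjI) simp_all
qed

text \<open>The star written out for degree 3 without indices and remainders; the next two lemmas do
  the same for degrees 4 and 5.\<close>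

lemma star3:
  assumes "v \<in> V" "as = [a, b, c]"
  shows "\<exists>n0 n1 n2 f0 f1 f2. distinct [n0, n1, n2] \<and> distinct [f0, f1, f2] \<and>
    sz f0 = a \<and> sz f1 = b \<and> sz f2 = c \<and> (\<forall>x. {v, x} \<in> E \<longleftrightarrow> x \<in> {n0, n1, n2}) \<and>
    (\<forall>f x. ed f v x \<longleftrightarrow> f = f0 \<and> x \<in> {n0, n1} \<or> f = f1 \<and> x \<in> {n1, n2} \<or> f = f2 \<and> x \<in> {n2, n0})"
proof -
  have l: "length as = Suc (Suc (Suc (0)))" using assms(2) by simp
  obtain ns fs where s: "distinct ns" "distinct fs" "length ns = length as" "length fs = length as"
    "map sz fs = as" "\<forall>x. {v, x} \<in> E \<longleftrightarrow> x \<in> set ns"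
    "\<forall>f x. ed f v x \<longleftrightarrow> (\<exists>i<length as. f = fs ! i \<and> (x = ns ! i \<or> x = ns ! (Suc i mod length as)))"
    using star_ed[OF assms(1)] by (elim exE conjE)
  obtain n0 n1 n2 where n: "ns = [n0, n1, n2]" using s(3) l by (auto simp: length_Suc_conv)
  obtain f0 f1 f2 where f: "fs = [f0, f1, f2]" using s(4) l by (auto simp: length_Suc_conv)
  have e: "\<forall>f x. ed f v x \<longleftrightarrow> f = f0 \<and> x \<in> {n0, n1} \<or> f = f1 \<and> x \<in> {n1, n2} \<or> f = f2 \<and> x \<in> {n2, n0}"
    using s(7) unfolding l n f by (simp add: Ex_less_Suc2)
  show ?thesis
    by (rule exI[where x = n0], rule exI[where x = n1], rule exI[where x = n2], rule exI[where x = f0], rule exI[where x = f1], rule exI[where x = f2])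
      (use e s(1,2,5,6) assms(2) n f in simp)
qed

lemma star4:
  assumes "v \<in> V" "as = [a, b, c, d]"
  shows "\<exists>n0 n1 n2 n3 f0 f1 f2 f3. distinct [n0, n1, n2, n3] \<and> distinct [f0, f1, f2, f3] \<and>
    sz f0 = a \<and> sz f1 = b \<and> sz f2 = c \<and> sz f3 = d \<and> (\<forall>x. {v, x} \<in> E \<longleftrightarrow> x \<in> {n0, n1, n2, n3}) \<and>
    (\<forall>f x. ed f v x \<longleftrightarrow> f = f0 \<and> x \<in> {n0, n1} \<or> f = f1 \<and> x \<in> {n1, n2} \<or> f = f2 \<and> x \<in> {n2, n3} \<or> f = f3 \<and> x \<in> {n3, n0})"
proof -
  have l: "length as = Suc (Suc (Suc (Suc (0))))" using assms(2) by simp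
  obtain ns fs where s: "distinct ns" "distinct fs" "length ns = length as" "length fs = length as"
    "map sz fs = as" "\<forall>x. {v, x} \<in> E \<longleftrightarrow> x \<in> set ns"
    "\<forall>f x. ed f v x \<longleftrightarrow> (\<exists>i<length as. f = fs ! i \<and> (x = ns ! i \<or> x = ns ! (Suc i mod length as)))"
    using star_ed[OF assms(1)] by (elim exE conjE)
  obtain n0 n1 n2 n3 where n: "ns = [n0, n1, n2, n3]" using s(3) l by (auto simp: length_Suc_conv)
  obtain f0 f1 f2 f3 where f: "fs = [f0, f1, f2, f3]" using s(4) l by (auto simp: length_Suc_conv)
  have e: "\<forall>f x. ed f v x \<longleftrightarrow> f = f0 \<and> x \<in> {n0, n1} \<or> f = f1 \<and> x \<in> {n1, n2} \<or> f = f2 \<and> x \<in> {n2, n3} \<or> f = f3 \<and> x \<in> {n3, n0}"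
    using s(7) unfolding l n f by (simp add: Ex_less_Suc2)
  show ?thesis
    by (rule exI[where x = n0], rule exI[where x = n1], rule exI[where x = n2], rule exI[where x = n3], rule exI[where x = f0], rule exI[where x = f1], rule exI[where x = f2], rule exI[where x = f3])
      (use e s(1,2,5,6) assms(2) n f in simp)
qed

lemma star5:
  assumes "v \<in> V" "as = [a, b, c, d, e]"
  shows "\<exists>n0 n1 n2 n3 n4 f0 f1 f2 f3 f4. distinct [n0, n1, n2, n3, n4] \<and> distinct [f0, f1, f2, f3, f4] \<and>
    sz f0 = a \<and> sz f1 = b \<and> sz f2 = c \<and> sz f3 = d \<and> sz f4 = e \<and> (\<forall>x. {v, x} \<in> E \<longleftrightarrow> x \<in> {n0, n1, n2, n3, n4}) \<and>
    (\<forall>f x. ed f v x \<longleftrightarrow> f = f0 \<and> x \<in> {n0, n1} \<or> f = f1 \<and> x \<in> {n1, n2} \<or> f = f2 \<and> x \<in> {n2, n3} \<or> f = f3 \<and> x \<in> {n3, n4} \<or> f = f4 \<and> x \<in> {n4, n0})"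
proof -
  have l: "length as = Suc (Suc (Suc (Suc (Suc (0)))))" using assms(2) by simp
  obtain ns fs where s: "distinct ns" "distinct fs" "length ns = length as" "length fs = length as"
    "map sz fs = as" "\<forall>x. {v, x} \<in> E \<longleftrightarrow> x \<in> set ns"
    "\<forall>f x. ed f v x \<longleftrightarrow> (\<exists>i<length as. f = fs ! i \<and> (x = ns ! i \<or> x = ns ! (Suc i mod length as)))"
    using star_ed[OF assms(1)] by (elim exE conjE)
  obtain n0 n1 n2 n3 n4 where n: "ns = [n0, n1, n2, n3, n4]" using s(3) l by (auto simp: length_Suc_conv)
  obtain f0 f1 f2 f3 f4 where f: "fs = [f0, f1, f2, f3, f4]" using s(4) l by (auto simp: length_Suc_conv)
  have e: "\<forall>f x. ed f v x \<longleftrightarrow> f = f0 \<and> x \<in> {n0, n1} \<or> f = f1 \<and> x \<in> {n1, n2} \<or> f = f2 \<and> x \<in> {n2, n3} \<or> f = f3 \<and> x \<in> {n3, n4} \<or> f = f4 \<and> x \<in> {n4, n0}"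
    using s(7) unfolding l n f by (simp add: Ex_less_Suc2)
  show ?thesis
    by (rule exI[where x = n0], rule exI[where x = n1], rule exI[where x = n2], rule exI[where x = n3], rule exI[where x = n4], rule exI[where x = f0], rule exI[where x = f1], rule exI[where x = f2], rule exI[where x = f3], rule exI[where x = f4])
      (use e s(1,2,5,6) assms(2) n f in simp)
qed

lemma three_ex:
  assumes "sz g = 3" "ed g a b"
  shows "\<exists>c. distinct [a, b, c] \<and> (\<forall>x y. ed g x y \<longleftrightarrow> {x, y} \<in> {{a, b}, {b, c}, {c, a}})"
proof -
  have g: "g \<in> F" using assms ed_E by blast
  obtain c' where c': "cycle_edges c' = cycle_edges (cyc g)" "length c' = length (cyc g)"
    "distinct c'" "c' \<noteq> []" "hd c' = b" "last c' = a"
    using rotate_to_edge[of a b "cyc g"] assms(2) cycD(1)[OF g] by (auto simp: ed_def)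
  have "length c' = Suc (Suc (Suc 0))" using assms(1) c'(2) by (simp add: sz_def)
  then obtain x c z where "c' = [x, c, z]" by (auto simp: length_Suc_conv)
  then have c: "c' = [b, c, a]" using c' by simp
  have "cycle_edges (cyc g) = {{a, b}, {b, c}, {c, a}}"
    using c'(1)[symmetric] c by (auto simp: cycle_edges_nonempty_conv)
  then show ?thesis using c c'(3) g by (intro exI[of _ c]) (auto simp: ed_def)
qed

lemma four_ex:
  assumes "sz g = 4" "ed g a b"
  shows "\<exists>c d. distinct [a, b, c, d] \<and> (\<forall>x y. ed g x y \<longleftrightarrow> {x, y} \<in> {{a, b}, {b, c}, {c, d}, {d, a}})"
proof -
  have g: "g \<in> F" using assms ed_E by blast
  obtain c' where c': "cycle_edges c' = cycle_edges (cyc g)" "length c' = length (cyc g)"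
    "distinct c'" "c' \<noteq> []" "hd c' = b" "last c' = a"
    using rotate_to_edge[of a b "cyc g"] assms(2) cycD(1)[OF g] by (auto simp: ed_def)
  have "length c' = Suc (Suc (Suc (Suc 0)))" using assms(1) c'(2) by (simp add: sz_def)
  then obtain x c d z where "c' = [x, c, d, z]" by (auto simp: length_Suc_conv)
  then have c: "c' = [b, c, d, a]" using c' by simp
  have "cycle_edges (cyc g) = {{a, b}, {b, c}, {c, d}, {d, a}}"
    using c'(1)[symmetric] c by (auto simp: cycle_edges_nonempty_conv)
  then show ?thesis using c c'(3) g by (intro exI[of _ c] exI[of _ d]) (auto simp: ed_def)
qed

lemma dart_rotation:
  assumes "dd g a b"
  obtains c' where "darts c' = darts (cyc g)" "length c' = sz g" "distinct c'" "c' \<noteq> []"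
    "hd c' = b" "last c' = a" "g \<in> F"
proof -
  have g: "g \<in> F" "(a, b) \<in> darts (cyc g)" using assms by (auto simp: dd_def)
  obtain c' where "darts c' = darts (cyc g)" "length c' = length (cyc g)" "distinct c' = distinct (cyc g)"
    "c' \<noteq> []" "hd c' = b" "last c' = a" using rotate_to_dart[OF g(2)] by blast
  then show thesis using cycD(1)[OF g(1)] g(1) by (intro that[of c']) (auto simp: sz_def)
qed

lemma dfour_ex:
  assumes "sz g = 4" "dd g a b"
  shows "\<exists>c d. distinct [a, b, c, d] \<and>
    (\<forall>x y. dd g x y \<longleftrightarrow> (x, y) \<in> {(a, b), (b, c), (c, d), (d, a)})"
proof -
  obtain c' where c': "darts c' = darts (cyc g)" "length c' = sz g"
    "distinct c'" "c' \<noteq> []" "hd c' = b" "last c' = a" "g \<in> F" using dart_rotation[OF assms(2)] by blast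
  have "length c' = Suc (Suc (Suc (Suc 0)))" using assms(1) c'(2) by simp
  then obtain x c d z where "c' = [x, c, d, z]" by (auto simp: length_Suc_conv)
  then have c: "c' = [b, c, d, a]" using c' by simp
  have "darts (cyc g) = {(a, b), (b, c), (c, d), (d, a)}"
    using c'(1)[symmetric] c by (auto simp: darts_def)
  then have "\<forall>x y. dd g x y \<longleftrightarrow> (x, y) \<in> {(a, b), (b, c), (c, d), (d, a)}" using c'(7) by (simp add: dd_def)
  moreover have "distinct [a, b, c, d]" using c c'(3) by simp metis
  ultimately show ?thesis by (intro exI[of _ c] exI[of _ d] conjI)
qed

text \<open>The cycles are the boundaries of a set \<open>G\<close> of faces with every vertex on
  exactly one of them. A union of cycles appears as a set \<open>U\<close> that no face of
  \<open>G\<close> crosses, and connectedness of the graph reduces the search for a crossing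
  quadrilateral to a single edge \<open>uw\<close> leaving \<open>U\<close>.\<close>

lemma face_merge:
  assumes "G \<subseteq> F" "\<forall>v\<in>V. \<exists>!f. f \<in> G \<and> v \<in> set (cyc f)"
    and quad: "\<And>a b c d. Q a b c d \<Longrightarrow> (\<exists>f\<in>G. ed f a b) \<and> (\<exists>f\<in>G. ed f c d) \<and> {b, c} \<in> E \<and> {d, a} \<in> E"
    and share: "\<And>a b c d a' b' c' d'. Q a b c d \<Longrightarrow> Q a' b' c' d' \<Longrightarrow>
      {{a, b}, {c, d}} \<inter> {{a', b'}, {c', d'}} \<noteq> {} \<Longrightarrow> {{a, b}, {c, d}} = {{a', b'}, {c', d'}}"
    and link: "\<And>U u w. {u, w} \<in> E \<Longrightarrow> u \<in> U \<Longrightarrow> w \<notin> U \<Longrightarrow> \<forall>f\<in>G. \<forall>x y. ed f x y \<longrightarrow> (x \<in> U \<longleftrightarrow> y \<in> U) \<Longrightarrow>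
      \<exists>a b c d. Q a b c d \<and> (a \<in> U \<longleftrightarrow> c \<notin> U)"
  shows "hamiltonian V E"
proof (rule merge_cycles[where P = "cyc ` G" and Q = Q])
  have finG: "finite (cyc ` G)"
  proof (rule finite_subset)
    show "cyc ` G \<subseteq> {xs. set xs \<subseteq> V \<and> length xs \<le> card V}"
    proof clarify
      fix f assume "f \<in> G"
      then have f: "f \<in> F" using assms(1) by blast
      show "set (cyc f) \<subseteq> V \<and> length (cyc f) \<le> card V"
        using cycD(1,3)[OF f] card_mono[OF finV] by (simp add: distinct_card[symmetric])
    qed
    show "finite {xs. set xs \<subseteq> V \<and> length xs \<le> card V}" using finite_lists_length_le[OF finV] .
  qed
  then show "finite (cyc ` G)" .
  show "graph_cycle V E c" if "c \<in> cyc ` G" for c using that assms(1) cyc by blast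
  show "set c \<inter> set d = {}" if cd: "c \<in> cyc ` G" "d \<in> cyc ` G" "c \<noteq> d" for c d
  proof -
    obtain f g where fg: "f \<in> G" "c = cyc f" "g \<in> G" "d = cyc g" using cd by blast
    then have "f \<noteq> g" using cd by blast
    show ?thesis
    proof (rule ccontr)
      assume "set c \<inter> set d \<noteq> {}"
      then obtain v where v: "v \<in> set (cyc f)" "v \<in> set (cyc g)" using fg by blast
      then have "v \<in> V" using fg(1) assms(1) cycD(3) by blast
      then show False using assms(2) fg v \<open>f \<noteq> g\<close> by metis
    qed
  qed
  show "V = \<Union>(set ` cyc ` G)"
  proof
    show "V \<subseteq> \<Union>(set ` cyc ` G)" using assms(2) by blast
    show "\<Union>(set ` cyc ` G) \<subseteq> V" using cycD(3) assms(1) by blast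
  qed
  show "V \<noteq> {}" by (rule Vne)
  have ed: "{x, y} \<in> \<Union>(cycle_edges ` cyc ` G)" if "f \<in> G" "ed f x y" for f x y
    using that by (auto simp: ed_def)
  show "{a, b} \<in> \<Union>(cycle_edges ` cyc ` G) \<and> {c, d} \<in> \<Union>(cycle_edges ` cyc ` G) \<and> {b, c} \<in> E \<and> {d, a} \<in> E"
    if "Q a b c d" for a b c d using quad[OF that] ed by meson
  show "{{a, b}, {c, d}} = {{a', b'}, {c', d'}}" if "Q a b c d" "Q a' b' c' d'"
      "{{a, b}, {c, d}} \<inter> {{a', b'}, {c', d'}} \<noteq> {}" for a b c d a' b' c' d'
    using that by (rule share)
  show "\<exists>a b c d. Q a b c d \<and> (a \<in> U \<longleftrightarrow> c \<notin> U)"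
    if "U \<subseteq> V" "U \<noteq> {}" "U \<noteq> V" "\<And>c. c \<in> cyc ` G \<Longrightarrow> set c \<subseteq> U \<or> set c \<inter> U = {}" for U
  proof -
    have "\<exists>u\<in>U. \<exists>w\<in>V - U. {u, w} \<in> E" using conn[OF that(1-3)] .
    then obtain u w where "u \<in> U" "w \<in> V - U" "{u, w} \<in> E" by blast
    moreover have "\<forall>f\<in>G. \<forall>x y. ed f x y \<longrightarrow> (x \<in> U \<longleftrightarrow> y \<in> U)"
    proof (intro ballI allI impI)
      fix f x y assume "f \<in> G" "ed f x y"
      then show "x \<in> U \<longleftrightarrow> y \<in> U" using that(4)[of "cyc f"] ed_E(6,7)[of f x y] by auto
    qed
    ultimately show ?thesis using link[of u w U] by simp
  qed
qed

section \<open>Coherent directions, and the types \<open>{6, 4, 3, 4}\<close>,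
  \<open>{4, 8\<^sup>2}\<close>, \<open>{4, 6, 12}\<close>, \<open>{3\<^sup>4, 6}\<close>\<close>

lemma edge_orient: "ed f a x \<Longrightarrow> ed g a x \<Longrightarrow> f \<noteq> g \<Longrightarrow> dd f a x \<longleftrightarrow> \<not> dd g a x"
  unfolding ed_dd using dd_face dd_asym by blast

text \<open>At a corner the boundary enters along one edge and leaves along the other; together with
  \<open>edge_orient\<close>, directions can be carried from face to face around a vertex.\<close>

lemma corner_orient: "ed f a x \<Longrightarrow> ed f a y \<Longrightarrow> x \<noteq> y \<Longrightarrow> dd f a x \<longleftrightarrow> \<not> dd f a y"
  unfolding ed_dd using dd_in dd_out by blast

text \<open>An edge has two directions and each is used by at most one face, so there is no room for
  a third.\<close>

lemma two_faces: "ed f a x \<Longrightarrow> ed g a x \<Longrightarrow> ed h a x \<Longrightarrow> f \<noteq> g \<Longrightarrow> f \<noteq> h \<Longrightarrow> g = h"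
  using edge_orient[of f a x g] edge_orient[of f a x h] edge_orient[of g a x h] by blast

lemma mem_ed: "f \<in> F \<Longrightarrow> v \<in> set (cyc f) \<longleftrightarrow> (\<exists>x. ed f v x)"
proof -
  assume f: "f \<in> F"
  have "\<exists>x. ed f v x" if "v \<in> set (cyc f)" using two_darts[OF f that] by blast
  then show ?thesis using ed_E(6) by blast
qed

text \<open>Every corner of a square lies between an edge of a hexagon and an edge of a triangle.
  Hence the hexagon edges of a square are opposite sides, and a hexagon edge, whose other face is
  the hexagon, lies on only one square: squares never compete for an edge.\<close>

lemma hamiltonian_6434:
  assumes as: "as = [6, 4, 3, 4]"
  shows "hamiltonian V E"
proof -
  define hex where "hex u v \<longleftrightarrow> (\<exists>h. sz h = 6 \<and> ed h u v)" for u v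
  have hex_sym: "hex u v \<longleftrightarrow> hex v u" for u v unfolding hex_def using ed_comm by blast
  define G where "G = {f \<in> F. sz f = 6}"
  have local: "\<exists>n0 n1 n2 n3 f1 f3. distinct [n0, n1, n2, n3] \<and> f1 \<noteq> f3 \<and> (\<forall>x. hex v x \<longleftrightarrow> x = n0 \<or> x = n1) \<and>
      (\<forall>x. {v, x} \<in> E \<longleftrightarrow> x \<in> {n0, n1, n2, n3}) \<and> (\<exists>h. \<forall>g x. sz g = 6 \<and> ed g v x \<longleftrightarrow> g = h \<and> (x = n0 \<or> x = n1)) \<and>
      (\<forall>g x. sz g = 4 \<and> ed g v x \<longleftrightarrow> g = f1 \<and> (x = n1 \<or> x = n2) \<or> g = f3 \<and> (x = n3 \<or> x = n0))"
    if v: "v \<in> V" for v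
  proof -
    obtain n0 n1 n2 n3 f0 f1 f2 f3 where s: "distinct [n0, n1, n2, n3]" "distinct [f0, f1, f2, f3]"
      "sz f0 = 6 \<and> sz f1 = 4 \<and> sz f2 = 3 \<and> sz f3 = 4" "\<forall>x. {v, x} \<in> E \<longleftrightarrow> x \<in> {n0, n1, n2, n3}"
      "\<forall>f x. ed f v x \<longleftrightarrow> f = f0 \<and> x \<in> {n0, n1} \<or> f = f1 \<and> x \<in> {n1, n2} \<or> f = f2 \<and> x \<in> {n2, n3}
        \<or> f = f3 \<and> x \<in> {n3, n0}"
      using star4[OF v as] by (elim exE conjE) blast
    have 6: "\<forall>g x. sz g = 6 \<and> ed g v x \<longleftrightarrow> g = f0 \<and> (x = n0 \<or> x = n1)"
      using s(3,5) by auto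
    have 4: "\<forall>g x. sz g = 4 \<and> ed g v x \<longleftrightarrow> g = f1 \<and> (x = n1 \<or> x = n2) \<or> g = f3 \<and> (x = n3 \<or> x = n0)"
      using s(3,5) by auto
    have h: "\<forall>x. hex v x \<longleftrightarrow> x = n0 \<or> x = n1" unfolding hex_def using 6 by simp
    show ?thesis
      by (rule exI[of _ n0], rule exI[of _ n1], rule exI[of _ n2], rule exI[of _ n3], rule exI[of _ f1], rule exI[of _ f3])
        (intro conjI exI[of _ f0] 6 4 h s; use s(2) in simp)
  qed
  have corner: "hex v x \<longleftrightarrow> \<not> hex v y" if g: "sz g = 4" "ed g v x" "ed g v y" "x \<noteq> y" for g v x y
  proof -
    have "v \<in> V" using g(2) by (rule ed_E(2))
    from local[OF this] obtain n0 n1 n2 n3 f1 f3 where L: "distinct [n0, n1, n2, n3]" "f1 \<noteq> f3"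
      "\<forall>x. hex v x \<longleftrightarrow> x = n0 \<or> x = n1"
      "\<forall>g x. sz g = 4 \<and> ed g v x \<longleftrightarrow> g = f1 \<and> (x = n1 \<or> x = n2) \<or> g = f3 \<and> (x = n3 \<or> x = n0)"
      by (elim exE conjE)
    have "g = f1 \<and> (x = n1 \<or> x = n2) \<or> g = f3 \<and> (x = n3 \<or> x = n0)"
      "g = f1 \<and> (y = n1 \<or> y = n2) \<or> g = f3 \<and> (y = n3 \<or> y = n0)" using g(1,2,3) L(4) by blast+
    then show ?thesis using g(4) L(1,2,3) by auto
  qed
  have square: "\<exists>g. sz g = 4 \<and> ed g v x" if g: "{v, x} \<in> E" "\<not> hex v x" "v \<in> V" for v x
  proof -
    from local[OF g(3)] obtain n0 n1 n2 n3 f1 f3 where L: "\<forall>x. hex v x \<longleftrightarrow> x = n0 \<or> x = n1"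
      "\<forall>x. {v, x} \<in> E \<longleftrightarrow> x \<in> {n0, n1, n2, n3}"
      "\<forall>g x. sz g = 4 \<and> ed g v x \<longleftrightarrow> g = f1 \<and> (x = n1 \<or> x = n2) \<or> g = f3 \<and> (x = n3 \<or> x = n0)"
      by (elim exE conjE)
    have "x = n2 \<or> x = n3" using g(1,2) L(1,2) by simp
    then show ?thesis using L(3) by blast
  qed
  have square_unique: "g = g'" if g: "hex v x" "sz g = 4" "ed g v x" "sz g' = 4" "ed g' v x" for g g' v x
  proof -
    have "v \<in> V" using g(3) by (rule ed_E(2))
    from local[OF this] obtain n0 n1 n2 n3 f1 f3 where L: "distinct [n0, n1, n2, n3]" "f1 \<noteq> f3"
      "\<forall>x. hex v x \<longleftrightarrow> x = n0 \<or> x = n1"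
      "\<forall>g x. sz g = 4 \<and> ed g v x \<longleftrightarrow> g = f1 \<and> (x = n1 \<or> x = n2) \<or> g = f3 \<and> (x = n3 \<or> x = n0)"
      by (elim exE conjE)
    have "g = f1 \<and> (x = n1 \<or> x = n2) \<or> g = f3 \<and> (x = n3 \<or> x = n0)"
      "g' = f1 \<and> (x = n1 \<or> x = n2) \<or> g' = f3 \<and> (x = n3 \<or> x = n0)" using g(2-5) L(4) by blast+
    then show ?thesis using g(1) L(1,2,3) by auto
  qed
  \<comment> \<open>A labelling of the square that starts with a hexagon edge. It is not unique, but
    the removed pair of edges depends on \<open>g\<close> only, as the next claim shows.\<close>
  define S where "S g a b c d \<longleftrightarrow> sz g = 4 \<and> hex a b \<and> hex c d \<and> distinct [a, b, c, d] \<and>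
    (\<forall>x y. ed g x y \<longleftrightarrow> {x, y} \<in> {{a, b}, {b, c}, {c, d}, {d, a}})" for g a b c d
  have Sset: "{e. \<exists>x y. e = {x, y} \<and> ed g x y \<and> hex x y} = {{a, b}, {c, d}}" if S: "S g a b c d" for g a b c d
  proof -
    have e: "ed g a b" "ed g b c" "ed g c d" "ed g d a" and g: "sz g = 4" and ne: "distinct [a, b, c, d]"
      and h: "hex a b" "hex c d" using S unfolding S_def by auto
    have "\<not> hex b c" using corner[OF g, of b a c] e h ne ed_comm hex_sym by auto
    moreover have "\<not> hex d a" using corner[OF g, of d c a] e h ne ed_comm hex_sym by auto
    ultimately have "ed g x y \<and> hex x y \<longleftrightarrow> {x, y} \<in> {{a, b}, {c, d}}" for x y
      using S h hex_sym unfolding S_def by (auto simp: doubleton_eq_iff)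
    then show ?thesis by blast
  qed
  define Q where "Q a b c d \<longleftrightarrow> (\<exists>g. S g a b c d)" for a b c d
  show ?thesis
  proof (rule face_merge[of G Q])
    show "G \<subseteq> F" by (auto simp: G_def)
    show "\<forall>v\<in>V. \<exists>!f. f \<in> G \<and> v \<in> set (cyc f)"
    proof
      fix v assume v: "v \<in> V"
      from local[OF v] obtain n0 n1 h where "\<forall>g x. sz g = 6 \<and> ed g v x \<longleftrightarrow> g = h \<and> (x = n0 \<or> x = n1)"
        by (elim exE conjE)
      then have "f \<in> G \<and> v \<in> set (cyc f) \<longleftrightarrow> f = h" for f
        unfolding G_def using mem_ed ed_E(5) by blast
      then show "\<exists>!f. f \<in> G \<and> v \<in> set (cyc f)" by simp
    qed
    show "(\<exists>f\<in>G. ed f a b) \<and> (\<exists>f\<in>G. ed f c d) \<and> {b, c} \<in> E \<and> {d, a} \<in> E" if Q: "Q a b c d" for a b c d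
    proof -
      obtain g where g: "S g a b c d" using Q unfolding Q_def by blast
      then have "ed g b c" "ed g d a" unfolding S_def by auto
      then have "{b, c} \<in> E" "{d, a} \<in> E" using ed_E(1) by blast+
      moreover have "\<exists>f\<in>G. ed f x y" if "hex x y" for x y
        using that ed_E(5) unfolding hex_def G_def by blast
      ultimately show ?thesis using g unfolding S_def by simp
    qed
    show "{{a, b}, {c, d}} = {{a', b'}, {c', d'}}"
      if q: "Q a b c d" "Q a' b' c' d'" "{{a, b}, {c, d}} \<inter> {{a', b'}, {c', d'}} \<noteq> {}" for a b c d a' b' c' d'
    proof -
      obtain g g' where g: "S g a b c d" "S g' a' b' c' d'" using q(1,2) unfolding Q_def by blast
      obtain e where e: "e \<in> {{a, b}, {c, d}}" "e \<in> {{a', b'}, {c', d'}}" using q(3) by blast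
      have "e \<in> {e. \<exists>x y. e = {x, y} \<and> ed g x y \<and> hex x y}" using e(1) Sset[OF g(1)] by simp
      then obtain x y where xy: "e = {x, y}" "ed g x y" "hex x y" by blast
      have iff: "ed g' x y \<longleftrightarrow> {x, y} \<in> {{a', b'}, {b', c'}, {c', d'}, {d', a'}}"
        using g(2) unfolding S_def by simp
      have "e \<in> {{a', b'}, {b', c'}, {c', d'}, {d', a'}}" using e(2) by (elim insertE emptyE) simp_all
      then have "ed g' x y" using iff unfolding xy(1) by (rule iffD2[rotated])
      moreover have "sz g = 4" "sz g' = 4" using g unfolding S_def by simp_all
      ultimately have "g = g'" using square_unique xy by simp
      then show ?thesis using Sset[OF g(1)] Sset[OF g(2)] by simp
    qed
    show "\<exists>a b c d. Q a b c d \<and> (a \<in> U \<longleftrightarrow> c \<notin> U)"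
      if uw: "{u, w} \<in> E" "u \<in> U" "w \<notin> U" and cl: "\<forall>f\<in>G. \<forall>x y. ed f x y \<longrightarrow> (x \<in> U \<longleftrightarrow> y \<in> U)" for U u w
    proof -
      have cl': "x \<in> U \<longleftrightarrow> y \<in> U" if xy: "hex x y" for x y
      proof -
        obtain h where h: "sz h = 6" "ed h x y" using xy unfolding hex_def by blast
        then have "h \<in> G" using ed_E(5) unfolding G_def by simp
        then show ?thesis using cl h by blast
      qed
      have "\<not> hex u w" using cl' uw by blast
      moreover have "u \<in> V" using edgeE[OF uw(1)] by (auto simp: doubleton_eq_iff)
      ultimately obtain g where g: "sz g = 4" "ed g u w" using square uw(1) by blast
      obtain c d where cd: "distinct [u, w, c, d]" "\<forall>x y. ed g x y \<longleftrightarrow> {x, y} \<in> {{u, w}, {w, c}, {c, d}, {d, u}}"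
        using four_ex[OF g] by (elim exE conjE)
      have e: "ed g w c" "ed g d u" using cd(2) by auto
      have "hex w c" using corner[OF g(1), of w u c] e ed_comm[of g] g(2) cd(1) \<open>\<not> hex u w\<close> hex_sym by auto
      moreover have "hex u d" using corner[OF g(1), of u w d] e ed_comm[of g] g(2) cd(1) \<open>\<not> hex u w\<close> by auto
      \<comment> \<open>The crossing edge \<open>uw\<close> is a side to be inserted, so the removed
        hexagon edges are \<open>du\<close> and \<open>wc\<close>, and the labelling starts at
        \<open>d\<close>.\<close>
      ultimately have "S g d u w c" unfolding S_def using g cd hex_sym by (auto simp: insert_commute)
      then have "Q d u w c" unfolding Q_def by blast
      moreover have "d \<in> U" using cl' \<open>hex u d\<close> uw by blast
      ultimately show ?thesis using uw by blast
    qed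
  qed
qed

text \<open>Each vertex lies on one square and has one further edge. Two opposite sides of every
  square together with the edges off the squares form a two-factor. As the squares are disjoint, the
  exchanges do not interfere, and either pair of opposite sides will do.\<close>

lemma hamiltonian_cubic_squares:
  assumes loc: "\<And>v. v \<in> V \<Longrightarrow> \<exists>n0 n1 n2 g. distinct [n0, n1, n2] \<and> sz g = 4 \<and> (\<forall>x. {v, x} \<in> E \<longleftrightarrow> x \<in> {n0, n1, n2}) \<and>
    (\<forall>f x. sz f = 4 \<and> ed f v x \<longleftrightarrow> f = g \<and> (x = n0 \<or> x = n1))"
  shows "hamiltonian V E"
proof -
  \<comment> \<open>The list \<open>cyc g\<close> itself serves as the choice: its first and third
    sides enter the two-factor, the other two are held in reserve for the exchange.\<close>
  define sq where "sq g a b c d \<longleftrightarrow> g \<in> F \<and> cyc g = [a, b, c, d]" for g a b c d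
  have sqE: "distinct [a, b, c, d] \<and> sz g = 4 \<and> (\<forall>x y. ed g x y \<longleftrightarrow> {x, y} \<in> {{a, b}, {b, c}, {c, d}, {d, a}})"
    if "sq g a b c d" for g a b c d
  proof -
    have g: "g \<in> F" "cyc g = [a, b, c, d]" using that by (auto simp: sq_def)
    have "cycle_edges (cyc g) = {{a, b}, {b, c}, {c, d}, {d, a}}" unfolding g(2)
      by (auto simp: cycle_edges_nonempty_conv)
    then show ?thesis using g cycD(1)[OF g(1)] by (simp add: ed_def sz_def)
  qed
  have sq_ex: "\<exists>a b c d. sq g a b c d" if "g \<in> F" "sz g = 4" for g
  proof -
    have "length (cyc g) = Suc (Suc (Suc (Suc 0)))" using that by (simp add: sz_def)
    then show ?thesis using that(1) unfolding sq_def by (auto simp: length_Suc_conv)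
  qed
  define par where "par u v \<longleftrightarrow> (\<exists>g a b c d. sq g a b c d \<and> {u, v} \<in> {{a, b}, {c, d}})" for u v
  define third where "third u v \<longleftrightarrow> {u, v} \<in> E \<and> \<not> (\<exists>g. sz g = 4 \<and> ed g u v)" for u v
  define N where "N v = {u. par v u \<or> third v u}" for v
  have par_sym: "par u v \<longleftrightarrow> par v u" for u v unfolding par_def by (simp add: insert_commute)
  have third_sym: "third u v \<longleftrightarrow> third v u" for u v
    unfolding third_def using ed_comm[of _ u v] by (simp add: insert_commute)
  have parE: "{u, v} \<in> E" if uv: "par u v" for u v
  proof -
    obtain g a b c d where "sq g a b c d" "{u, v} \<in> {{a, b}, {c, d}}" using uv unfolding par_def by blast
    then have "ed g u v" using sqE[of g a b c d] by blast
    then show ?thesis by (rule ed_E(1))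
  qed
  have NE: "{u, v} \<in> E" if "u \<in> N v" for u v
    using that parE third_def par_sym third_sym unfolding N_def by blast
  have EV: "u \<in> V \<and> v \<in> V \<and> u \<noteq> v" if "{u, v} \<in> E" for u v
    using edgeE[OF that] by (auto simp: doubleton_eq_iff)
  have card: "card (N v) = 2" if v: "v \<in> V" for v
  proof -
    obtain n0 n1 n2 g where s: "distinct [n0, n1, n2]" "sz g = 4" "\<forall>x. {v, x} \<in> E \<longleftrightarrow> x \<in> {n0, n1, n2}"
      "\<forall>f x. sz f = 4 \<and> ed f v x \<longleftrightarrow> f = g \<and> (x = n0 \<or> x = n1)" using loc[OF v] by blast
    have th: "third v x \<longleftrightarrow> x = n2" for x unfolding third_def using s(1,3,4) by auto
    have gF: "g \<in> F" "ed g v n0" "ed g v n1" using s(2,4) ed_E(5) by blast+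
    obtain a b c d where sq: "sq g a b c d" using sq_ex gF s(2) by blast
    note S = sqE[OF sq]
    have pa: "par v x \<longleftrightarrow> {v, x} \<in> {{a, b}, {c, d}}" for x
    proof
      assume "par v x"
      then obtain g' a' b' c' d' where *: "sq g' a' b' c' d'" "{v, x} \<in> {{a', b'}, {c', d'}}" unfolding par_def by blast
      then have "sz g' = 4" "ed g' v x" using sqE[OF *(1)] by blast+
      then have "g' = g" using s(4) by blast
      then show "{v, x} \<in> {{a, b}, {c, d}}" using * sq unfolding sq_def by auto
    qed (use sq par_def in blast)
    have "\<exists>p. \<forall>x. par v x \<longleftrightarrow> x = p"
    proof -
      have "v \<in> {a, b, c, d}" using gF(2) S by (auto simp: doubleton_eq_iff)
      then show ?thesis using S unfolding pa by (auto simp: doubleton_eq_iff)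
    qed
    then obtain p where p: "\<And>x. par v x \<longleftrightarrow> x = p" by blast
    have "p \<noteq> n2"
    proof
      assume "p = n2"
      then have "{v, n2} \<in> {{a, b}, {c, d}}" using pa p by blast
      then have "ed g v n2" using S by blast
      then show False using s(1,2,4) by auto
    qed
    moreover have "N v = {p, n2}" unfolding N_def using p th by blast
    ultimately show ?thesis by simp
  qed
  have N1: "\<forall>v\<in>V. N v \<subseteq> V - {v} \<and> card (N v) = 2" using card NE EV by blast
  have N2: "\<forall>u\<in>V. \<forall>v\<in>V. u \<in> N v \<longrightarrow> v \<in> N u" unfolding N_def using par_sym third_sym by blast
  obtain P where P: "finite P" "\<forall>c \<in> P. 3 \<le> length c \<and> distinct c"
    "\<forall>c \<in> P. \<forall>d \<in> P. c \<noteq> d \<longrightarrow> set c \<inter> set d = {}" "\<Union>(set ` P) = V"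
    "\<Union>(cycle_edges ` P) = {{u, v} | u v. u \<in> V \<and> v \<in> N u}"
    using two_factor[OF finV N1 N2] by (elim exE conjE)
  have PE: "{u, v} \<in> \<Union>(cycle_edges ` P)" if uv: "v \<in> N u" for u v
  proof -
    have "u \<in> V" using NE[OF uv] EV by blast
    then have "{u, v} \<in> {{u, v} | u v. u \<in> V \<and> v \<in> N u}" using uv by blast
    then show ?thesis using P(5) by simp
  qed
  show ?thesis
  proof (rule merge_cycles[where P = P and Q = "\<lambda>a b c d. \<exists>g. sq g a b c d"])
    show "graph_cycle V E c" if "c \<in> P" for c
    proof -
      have "cycle_edges c \<subseteq> {{u, v} | u v. u \<in> V \<and> v \<in> N u}" using P(5) that by blast
      also have "\<dots> \<subseteq> E" using NE E_sym by fastforce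
      finally show ?thesis using P(2,4) that by (auto simp: graph_cycle_def)
    qed
    show "{a, b} \<in> \<Union>(cycle_edges ` P) \<and> {c, d} \<in> \<Union>(cycle_edges ` P) \<and> {b, c} \<in> E \<and> {d, a} \<in> E"
      if ex: "\<exists>g. sq g a b c d" for a b c d
    proof -
      obtain g where g: "sq g a b c d" using ex by blast
      then have "par a b" "par c d" unfolding par_def by blast+
      moreover have "ed g b c" "ed g d a" using sqE[OF g] by blast+
      ultimately show ?thesis using PE ed_E(1) unfolding N_def by blast
    qed
    show "{{a, b}, {c, d}} = {{a', b'}, {c', d'}}"
      if q: "\<exists>g. sq g a b c d" "\<exists>g. sq g a' b' c' d'" "{{a, b}, {c, d}} \<inter> {{a', b'}, {c', d'}} \<noteq> {}"
      for a b c d a' b' c' d'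
    proof -
      obtain g g' where g: "sq g a b c d" "sq g' a' b' c' d'" using q by blast
      obtain x y where "{x, y} \<in> {{a, b}, {c, d}}" "{x, y} \<in> {{a', b'}, {c', d'}}" using q(3) by blast
      then have "{x, y} \<in> {{a, b}, {b, c}, {c, d}, {d, a}}" "{x, y} \<in> {{a', b'}, {b', c'}, {c', d'}, {d', a'}}"
        by (elim insertE emptyE; simp)+
      moreover have "ed g x y \<longleftrightarrow> {x, y} \<in> {{a, b}, {b, c}, {c, d}, {d, a}}" using sqE[OF g(1)] by simp
      moreover have "ed g' x y \<longleftrightarrow> {x, y} \<in> {{a', b'}, {b', c'}, {c', d'}, {d', a'}}" using sqE[OF g(2)] by simp
      ultimately have xy: "ed g x y" "ed g' x y" by (simp_all only:)
      have sz: "sz g = 4" "sz g' = 4" using sqE[OF g(1)] sqE[OF g(2)] by simp_all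
      have "x \<in> V" using xy(1) by (rule ed_E(2))
      from loc[OF this] obtain n0 n1 h where "\<forall>f y. sz f = 4 \<and> ed f x y \<longleftrightarrow> f = h \<and> (y = n0 \<or> y = n1)"
        by (elim exE conjE)
      then have "g = g'" using xy sz by metis
      then show ?thesis using g unfolding sq_def by auto
    qed
    show "\<exists>a b c d. (\<exists>g. sq g a b c d) \<and> (a \<in> U \<longleftrightarrow> c \<notin> U)"
      if U: "U \<subseteq> V" "U \<noteq> {}" "U \<noteq> V" "\<And>c. c \<in> P \<Longrightarrow> set c \<subseteq> U \<or> set c \<inter> U = {}" for U
    proof -
      have "\<exists>u\<in>U. \<exists>w\<in>V - U. {u, w} \<in> E" using conn[OF U(1-3)] .
      then obtain u w where uw: "u \<in> U" "w \<in> V" "w \<notin> U" "{u, w} \<in> E" by blast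
      have cl: "x \<in> U \<longleftrightarrow> y \<in> U" if xy: "y \<in> N x" for x y
      proof -
        obtain c where c: "c \<in> P" "{x, y} \<in> cycle_edges c" using PE[OF xy] by blast
        then have "x \<in> set c \<and> y \<in> set c" using darts_subset[of c]
          by (auto simp: cycle_edges_darts uedge_def doubleton_eq_iff)
        then show ?thesis using U(4)[OF c(1)] by blast
      qed
      have nN: "w \<notin> N u" using cl uw by blast
      then obtain g where g: "sz g = 4" "ed g u w" using uw(4) unfolding N_def third_def by blast
      then obtain a b c d where sq: "sq g a b c d" using sq_ex ed_E(5) by blast
      have "par a b" "par c d" using sq unfolding par_def by blast+
      then have ab: "a \<in> U \<longleftrightarrow> b \<in> U" "c \<in> U \<longleftrightarrow> d \<in> U" using cl unfolding N_def by blast+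
      have "{u, w} \<notin> {{a, b}, {c, d}}" using nN sq unfolding N_def par_def by blast
      then have "{u, w} \<in> {{b, c}, {d, a}}" using sqE[OF sq] g by auto
      then have "a \<in> U \<longleftrightarrow> c \<notin> U" using ab uw by (auto simp: doubleton_eq_iff)
      then show ?thesis using sq by blast
    qed
  qed (use P Vne in auto)
qed

lemma hamiltonian_4bc:
  assumes as: "as = [4, b, c]" "b \<noteq> 4" "c \<noteq> 4"
  shows "hamiltonian V E"
proof (rule hamiltonian_cubic_squares)
  fix v assume v: "v \<in> V"
  obtain n0 n1 n2 f0 f1 f2 where s: "distinct [n0, n1, n2]" "sz f0 = 4 \<and> sz f1 = b \<and> sz f2 = c"
    "\<forall>x. {v, x} \<in> E \<longleftrightarrow> x \<in> {n0, n1, n2}"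
    "\<forall>f x. ed f v x \<longleftrightarrow> f = f0 \<and> x \<in> {n0, n1} \<or> f = f1 \<and> x \<in> {n1, n2} \<or> f = f2 \<and> x \<in> {n2, n0}"
    using star3[OF v as(1)] by (elim exE conjE) blast
  have "\<forall>f x. sz f = 4 \<and> ed f v x \<longleftrightarrow> f = f0 \<and> (x = n0 \<or> x = n1)" using s(2,4) as by auto
  then show "\<exists>n0 n1 n2 g. distinct [n0, n1, n2] \<and> sz g = 4 \<and> (\<forall>x. {v, x} \<in> E \<longleftrightarrow> x \<in> {n0, n1, n2}) \<and>
    (\<forall>f x. sz f = 4 \<and> ed f v x \<longleftrightarrow> f = g \<and> (x = n0 \<or> x = n1))"
    using s(1,2,3) by blast
qed

text \<open>A hexagon edge \<open>ab\<close> lies on one triangle \<open>abd\<close>, which has no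
  further hexagon edge. Just one of its sides at \<open>d\<close>, say \<open>db\<close>, also
  borders a triangle with a hexagon edge \<open>dc\<close>. The two triangles form a rhombus
  \<open>abcd\<close> with diagonal \<open>bd\<close>, and each hexagon edge belongs to exactly one
  such rhombus.\<close>

lemma hamiltonian_33336:
  assumes as: "as = [3, 3, 3, 3, 6]"
  shows "hamiltonian V E"
proof -
  define hex where "hex u v \<longleftrightarrow> (\<exists>h. sz h = 6 \<and> ed h u v)" for u v
  define tri where "tri t u v \<longleftrightarrow> sz t = 3 \<and> ed t u v" for t u v
  have hex_sym: "hex u v \<longleftrightarrow> hex v u" for u v unfolding hex_def using ed_comm by blast
  have tri_sym: "tri t u v \<longleftrightarrow> tri t v u" for t u v unfolding tri_def using ed_comm by blast
  have hexV: "u \<in> V" "v \<in> V" if "hex u v" for u v using that ed_E(2,3) unfolding hex_def by blast+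
  define G where "G = {f \<in> F. sz f = 6}"
  have local: "\<exists>n0 n1 n2 n3 n4 f0 f1 f2 f3 f4. distinct [n0, n1, n2, n3, n4] \<and> distinct [f0, f1, f2, f3] \<and>
      (\<forall>x. hex v x \<longleftrightarrow> x = n4 \<or> x = n0) \<and> (\<forall>g x. sz g = 6 \<and> ed g v x \<longleftrightarrow> g = f4 \<and> (x = n4 \<or> x = n0)) \<and>
      (\<forall>x. {v, x} \<in> E \<longleftrightarrow> x \<in> {n0, n1, n2, n3, n4}) \<and>
      (\<forall>t x. tri t v x \<longleftrightarrow> t = f0 \<and> (x = n0 \<or> x = n1) \<or> t = f1 \<and> (x = n1 \<or> x = n2) \<or>
        t = f2 \<and> (x = n2 \<or> x = n3) \<or> t = f3 \<and> (x = n3 \<or> x = n4))"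
    if v: "v \<in> V" for v
  proof -
    obtain n0 n1 n2 n3 n4 f0 f1 f2 f3 f4 where s: "distinct [n0, n1, n2, n3, n4]" "distinct [f0, f1, f2, f3, f4]"
      "sz f0 = 3 \<and> sz f1 = 3 \<and> sz f2 = 3 \<and> sz f3 = 3 \<and> sz f4 = 6" "\<forall>x. {v, x} \<in> E \<longleftrightarrow> x \<in> {n0, n1, n2, n3, n4}"
      "\<forall>f x. ed f v x \<longleftrightarrow> f = f0 \<and> x \<in> {n0, n1} \<or> f = f1 \<and> x \<in> {n1, n2} \<or> f = f2 \<and> x \<in> {n2, n3}
        \<or> f = f3 \<and> x \<in> {n3, n4} \<or> f = f4 \<and> x \<in> {n4, n0}"
      using star5[OF v as] by (elim exE conjE) blast
    have 6: "\<forall>g x. sz g = 6 \<and> ed g v x \<longleftrightarrow> g = f4 \<and> (x = n4 \<or> x = n0)"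
      using s(3,5) by auto
    have 3: "\<forall>t x. tri t v x \<longleftrightarrow> t = f0 \<and> (x = n0 \<or> x = n1) \<or> t = f1 \<and> (x = n1 \<or> x = n2) \<or>
        t = f2 \<and> (x = n2 \<or> x = n3) \<or> t = f3 \<and> (x = n3 \<or> x = n4)"
      using s(3,5) unfolding tri_def by auto
    have h: "\<forall>x. hex v x \<longleftrightarrow> x = n4 \<or> x = n0" unfolding hex_def using 6 by simp
    have d: "distinct [f0, f1, f2, f3]" using s(2) by simp
    show ?thesis
      by (rule exI[of _ n0], rule exI[of _ n1], rule exI[of _ n2], rule exI[of _ n3], rule exI[of _ n4],
          rule exI[of _ f0], rule exI[of _ f1], rule exI[of _ f2], rule exI[of _ f3], rule exI[of _ f4])
        (intro conjI 6 3 h d s)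
  qed
  have not_both: "\<not> hex v y" if t: "tri t v x" "tri t v y" "x \<noteq> y" "hex v x" for t v x y
  proof -
    from local[OF hexV(1)[OF t(4)]] obtain n0 n1 n2 n3 n4 f0 f1 f2 f3 where
      L: "distinct [n0, n1, n2, n3, n4]" "distinct [f0, f1, f2, f3]" "\<forall>x. hex v x \<longleftrightarrow> x = n4 \<or> x = n0"
      "\<forall>t x. tri t v x \<longleftrightarrow> t = f0 \<and> (x = n0 \<or> x = n1) \<or> t = f1 \<and> (x = n1 \<or> x = n2) \<or>
        t = f2 \<and> (x = n2 \<or> x = n3) \<or> t = f3 \<and> (x = n3 \<or> x = n4)" by (elim exE conjE)
    show ?thesis using t L by auto
  qed
  have hex_tri: "\<exists>t. tri t v x" if t: "hex v x" for v x
  proof -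
    from local[OF hexV(1)[OF t]] obtain n0 n1 n2 n3 n4 f0 f1 f2 f3 where
      L: "\<forall>x. hex v x \<longleftrightarrow> x = n4 \<or> x = n0"
      "\<forall>t x. tri t v x \<longleftrightarrow> t = f0 \<and> (x = n0 \<or> x = n1) \<or> t = f1 \<and> (x = n1 \<or> x = n2) \<or>
        t = f2 \<and> (x = n2 \<or> x = n3) \<or> t = f3 \<and> (x = n3 \<or> x = n4)" by (elim exE conjE)
    show ?thesis using t L by auto
  qed
  have hex_tri_unique: "t = t'" if t: "hex v x" "tri t v x" "tri t' v x" for t t' v x
  proof -
    obtain h where h: "sz h = 6" "ed h v x" using t(1) unfolding hex_def by blast
    then have "h \<noteq> t" "h \<noteq> t'" using t unfolding tri_def by auto
    then show ?thesis using two_faces[of h v x t t'] h t unfolding tri_def by blast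
  qed
  \<comment> \<open>Of the three edges at \<open>v\<close> that are not on its hexagon,
    \<open>outer\<close> marks the first and the third: those in a triangle with a hexagon edge at
    \<open>v\<close>. The middle one is left out.\<close>
  define outer where "outer v x \<longleftrightarrow> (\<exists>t h. tri t v x \<and> tri t v h \<and> hex v h \<and> h \<noteq> x)" for v x
  have dichotomy: "outer v x \<longleftrightarrow> \<not> outer v y" if t: "v \<in> V" "tri t v x" "tri t v y" "x \<noteq> y" "\<not> hex v x" "\<not> hex v y" for t v x y
  proof -
    from local[OF t(1)] obtain n0 n1 n2 n3 n4 f0 f1 f2 f3 where
      L: "distinct [n0, n1, n2, n3, n4]" "distinct [f0, f1, f2, f3]" "\<forall>x. hex v x \<longleftrightarrow> x = n4 \<or> x = n0"
      "\<forall>t x. tri t v x \<longleftrightarrow> t = f0 \<and> (x = n0 \<or> x = n1) \<or> t = f1 \<and> (x = n1 \<or> x = n2) \<or>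
        t = f2 \<and> (x = n2 \<or> x = n3) \<or> t = f3 \<and> (x = n3 \<or> x = n4)" by (elim exE conjE)
    have o: "outer v n1" "outer v n3" "\<not> outer v n2" unfolding outer_def using L by auto
    have "{x, y} = {n1, n2} \<or> {x, y} = {n2, n3}" using t L by auto
    then show ?thesis using o by (auto simp: doubleton_eq_iff)
  qed
  have edge_tri: "\<exists>t. tri t v x" if t: "v \<in> V" "{v, x} \<in> E" for v x
  proof -
    from local[OF t(1)] obtain n0 n1 n2 n3 n4 f0 f1 f2 f3 where
      L: "\<forall>x. {v, x} \<in> E \<longleftrightarrow> x \<in> {n0, n1, n2, n3, n4}"
      "\<forall>t x. tri t v x \<longleftrightarrow> t = f0 \<and> (x = n0 \<or> x = n1) \<or> t = f1 \<and> (x = n1 \<or> x = n2) \<or>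
        t = f2 \<and> (x = n2 \<or> x = n3) \<or> t = f3 \<and> (x = n3 \<or> x = n4)" by (elim exE conjE)
    show ?thesis using t(2) L by auto
  qed
  have inner_tri: "\<not> hex v y" if t: "v \<in> V" "tri t v x" "tri t v y" "y \<noteq> x" "\<not> outer v x" for t v x y
    using t unfolding outer_def by blast
  have third: "\<exists>c. c \<noteq> a \<and> c \<noteq> b \<and> a \<noteq> b \<and> tri t a c \<and> tri t c a \<and> tri t b c \<and> tri t c b \<and> tri t b a \<and>
     (\<forall>x y. tri t x y \<longrightarrow> x \<in> {a, b, c} \<and> y \<in> {a, b, c})" if t: "tri t a b" for t a b
  proof -
    have t': "sz t = 3" "ed t a b" using t unfolding tri_def by simp_all
    obtain c where c: "distinct [a, b, c]" "\<forall>x y. ed t x y \<longleftrightarrow> {x, y} \<in> {{a, b}, {b, c}, {c, a}}"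
      using three_ex[OF t'] by (elim exE conjE)
    have "\<forall>x y. tri t x y \<longrightarrow> x \<in> {a, b, c} \<and> y \<in> {a, b, c}"
    proof (intro allI impI)
      fix x y assume "tri t x y"
      then have "{x, y} \<in> {{a, b}, {b, c}, {c, a}}" using c(2) unfolding tri_def by simp
      then have "{x, y} \<subseteq> {a, b, c}" by (elim insertE emptyE) simp_all
      then show "x \<in> {a, b, c} \<and> y \<in> {a, b, c}" by simp
    qed
    moreover have "ed t b c" "ed t c a" using c(2) by simp_all
    moreover have "ed t c b" "ed t a c" "ed t b a" using \<open>ed t b c\<close> \<open>ed t c a\<close> t ed_sym unfolding tri_def by blast+
    moreover have "c \<noteq> a" "c \<noteq> b" "a \<noteq> b" using c(1) by auto
    ultimately show ?thesis using t unfolding tri_def by (intro exI[of _ c] conjI) simp_all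
  qed
  have verts: "x \<in> {a, b, d} \<and> y \<in> {a, b, d}" if t: "tri t a b" "tri t b d" "d \<noteq> a" "tri t x y" for t a b d x y
  proof -
    obtain c where c: "\<forall>x y. tri t x y \<longrightarrow> x \<in> {a, b, c} \<and> y \<in> {a, b, c}" using third[OF t(1)] by blast
    have "d \<noteq> b" using t(2) ed_E(4) unfolding tri_def by blast
    then have "d = c" using c t(2,3) by blast
    then show ?thesis using c t(4) by simp
  qed
  define Q where "Q a b c d \<longleftrightarrow> (\<exists>t t'. t \<noteq> t' \<and> hex a b \<and> hex c d \<and> tri t a b \<and> tri t b d \<and> tri t d a \<and>
    tri t' b d \<and> tri t' d c \<and> tri t' c b)" for a b c d
  have Q_sym: "Q c d a b" if "Q a b c d" for a b c d
    using that tri_sym unfolding Q_def by metis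
  have Q_unique: "a = a' \<and> b = b' \<and> c = c' \<and> d = d'" if q: "Q a b c d" "Q a' b' c' d'" "{a, b} = {a', b'}" for a b c d a' b' c' d'
  proof -
    obtain t s where 1: "t \<noteq> s" "hex a b" "hex c d" "tri t a b" "tri t b d" "tri t d a" "tri s b d" "tri s d c" "tri s c b"
      using q(1) unfolding Q_def by blast
    obtain t' s' where 2: "t' \<noteq> s'" "hex a' b'" "hex c' d'" "tri t' a' b'" "tri t' b' d'" "tri t' d' a'" "tri s' b' d'" "tri s' d' c'" "tri s' c' b'"
      using q(2) unfolding Q_def by blast
    have ab: "a' = a \<and> b' = b \<or> a' = b \<and> b' = a" using q(3) by (auto simp: doubleton_eq_iff)
    then have "tri t' a b" using 2(4) tri_sym by auto
    then have t: "t' = t" using hex_tri_unique 1 by blast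
    have ne: "a \<noteq> b" "a \<noteq> d" "b \<noteq> d" "c \<noteq> d" "b \<noteq> c" "b' \<noteq> d'" "a' \<noteq> d'" "d' \<noteq> c'" "c' \<noteq> b'"
      using 1 2 ed_E(4) unfolding tri_def by blast+
    have "tri t x y \<longrightarrow> x \<in> {a, b, d} \<and> y \<in> {a, b, d}" for x y
      using verts[OF 1(4,5)] ne by simp
    then have d: "d' = d" using 2(5) t ab ne by auto
    have dV: "d \<in> V" using 1(3) hexV by blast
    have nh: "\<not> hex d a" "\<not> hex d b"
      using not_both[of t a b d] not_both[of t b a d] 1 ne tri_sym hex_sym by metis+
    \<comment> \<open>Both rhombi leave the triangle \<open>t\<close> through a side that is outer
      at \<open>d\<close>, and only one side is: this identifies \<open>b'\<close> with
      \<open>b\<close>.\<close>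
    have "outer d b" unfolding outer_def using 1(3,7,8) ne tri_sym hex_sym by metis
    moreover have "outer d b'" unfolding outer_def using 2(3,7,8) ne d tri_sym hex_sym by metis
    ultimately have b: "b' = b" using dichotomy[OF dV, of t b a] 1 nh ne ab tri_sym by metis
    then have a: "a' = a" using ab ne by blast
    have "s' = s" using two_faces[of t b d s s'] 1 2 t b d unfolding tri_def by blast
    then have "c' = c" using third[OF 1(7)] 2 1 b d ne nh(2) hex_sym by (metis insert_iff empty_iff)
    then show ?thesis using a b d by simp
  qed
  have apex: "\<exists>c. Q a b c d \<or> Q b a c d" if t: "tri t a b" "tri t b d" "tri t d a" "hex a b" for t a b d
  proof -
    have ne: "a \<noteq> b" "a \<noteq> d" "b \<noteq> d" using t ed_E(4) unfolding tri_def by blast+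
    have dV: "d \<in> V" using t ed_E(2) unfolding tri_def by blast
    have nh: "\<not> hex d a" "\<not> hex d b"
      using not_both[of t a b d] not_both[of t b a d] t ne tri_sym hex_sym by metis+
    have "outer d a \<or> outer d b" using dichotomy[OF dV, of t a b] t nh ne tri_sym by metis
    then show ?thesis
    proof
      assume "outer d b"
      then obtain s h where s: "tri s d b" "tri s d h" "hex d h" "h \<noteq> b" unfolding outer_def by blast
      then have "tri s h b" using third[OF s(1)] ed_E(4) unfolding tri_def by (metis insert_iff empty_iff)
      moreover have "s \<noteq> t"
      proof
        assume "s = t"
        then have "h \<in> {a, b, d}" using verts[OF t(1,2)] ne s(2) by blast
        then show False using s nh ed_E(4) unfolding tri_def by blast
      qed
      ultimately have "Q a b h d" unfolding Q_def using t s tri_sym hex_sym by metis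
      then show ?thesis by blast
    next
      assume "outer d a"
      then obtain s h where s: "tri s d a" "tri s d h" "hex d h" "h \<noteq> a" unfolding outer_def by blast
      then have "tri s h a" using third[OF s(1)] ed_E(4) unfolding tri_def by (metis insert_iff empty_iff)
      moreover have "s \<noteq> t"
      proof
        assume "s = t"
        then have "h \<in> {a, b, d}" using verts[OF t(1,2)] ne s(2) by blast
        then show False using s nh ed_E(4) unfolding tri_def by blast
      qed
      ultimately have "Q b a h d" unfolding Q_def using t s tri_sym hex_sym by metis
      then show ?thesis by blast
    qed
  qed
  show ?thesis
  proof (rule face_merge[of G Q])
    show "G \<subseteq> F" by (auto simp: G_def)
    show "\<forall>v\<in>V. \<exists>!f. f \<in> G \<and> v \<in> set (cyc f)"
    proof
      fix v assume v: "v \<in> V"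
      from local[OF v] obtain n0 n4 h where "\<forall>g x. sz g = 6 \<and> ed g v x \<longleftrightarrow> g = h \<and> (x = n4 \<or> x = n0)"
        by (elim exE conjE)
      then have "f \<in> G \<and> v \<in> set (cyc f) \<longleftrightarrow> f = h" for f
        unfolding G_def using mem_ed ed_E(5) by blast
      then show "\<exists>!f. f \<in> G \<and> v \<in> set (cyc f)" by simp
    qed
    have hexG: "\<exists>f\<in>G. ed f x y" if "hex x y" for x y
      using that ed_E(5) unfolding hex_def G_def by blast
    show "(\<exists>f\<in>G. ed f a b) \<and> (\<exists>f\<in>G. ed f c d) \<and> {b, c} \<in> E \<and> {d, a} \<in> E" if Q: "Q a b c d" for a b c d
    proof -
      have "ed t x y \<Longrightarrow> {x, y} \<in> E \<and> {y, x} \<in> E" for t x y using ed_E(1) E_sym by blast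
      then show ?thesis using Q hexG unfolding Q_def tri_def by blast
    qed
    show "{{a, b}, {c, d}} = {{a', b'}, {c', d'}}"
      if q: "Q a b c d" "Q a' b' c' d'" "{{a, b}, {c, d}} \<inter> {{a', b'}, {c', d'}} \<noteq> {}" for a b c d a' b' c' d'
    proof -
      consider "{a, b} = {a', b'}" | "{a, b} = {c', d'}" | "{c, d} = {a', b'}" | "{c, d} = {c', d'}"
        using q(3) by (auto simp only: insert_iff empty_iff Int_iff)
      then show ?thesis
      proof cases
        case 1
        then show ?thesis using Q_unique[OF q(1,2)] by simp
      next
        case 2
        then show ?thesis using Q_unique[OF q(1) Q_sym[OF q(2)]] by auto
      next
        case 3
        then show ?thesis using Q_unique[OF Q_sym[OF q(1)] q(2)] by auto
      next
        case 4
        then show ?thesis using Q_unique[OF Q_sym[OF q(1)] Q_sym[OF q(2)]] by simp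
      qed
    qed
    show "\<exists>a b c d. Q a b c d \<and> (a \<in> U \<longleftrightarrow> c \<notin> U)"
      if uw: "{u, w} \<in> E" "u \<in> U" "w \<notin> U" and cl: "\<forall>f\<in>G. \<forall>x y. ed f x y \<longrightarrow> (x \<in> U \<longleftrightarrow> y \<in> U)" for U u w
    proof (rule ccontr)
      assume no: "\<not> ?thesis"
      have cl': "x \<in> U \<longleftrightarrow> y \<in> U" if xy: "hex x y" for x y using hexG[OF xy] cl by blast
      have Qcl: "a \<in> U \<longleftrightarrow> d \<in> U" if ab: "Q a b c d" for a b c d
      proof -
        have "c \<in> U \<longleftrightarrow> d \<in> U" using ab cl' unfolding Q_def by blast
        then show ?thesis using no ab by blast
      qed
      \<comment> \<open>An outer edge is a side of a triangle on a hexagon edge. As no rhombus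
        crosses \<open>U\<close>, the three corners of such a triangle are on the same side.\<close>
      have ocl: "v \<in> U \<longleftrightarrow> x \<in> U" if o: "outer v x" for v x
      proof -
        obtain t h where t: "tri t v x" "tri t v h" "hex v h" "h \<noteq> x" using o unfolding outer_def by blast
        then have "tri t h x" using third[OF t(1)] ed_E(4) unfolding tri_def by (metis insert_iff empty_iff)
        then obtain c where "Q v h c x \<or> Q h v c x" using apex[of t v h x] t tri_sym by metis
        then show ?thesis using Qcl cl' t(3) by blast
      qed
      have V: "u \<in> V" "w \<in> V" using edgeE[OF uw(1)] by (auto simp: doubleton_eq_iff)
      obtain t where t: "tri t u w" using edge_tri[OF V(1) uw(1)] by blast
      obtain y where y: "y \<noteq> u" "y \<noteq> w" "tri t u y" "tri t w y" "tri t w u" using third[OF t] by blast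
      have nou: "\<not> outer u w" "\<not> outer w u" "\<not> hex u w" "\<not> hex w u" using ocl cl' uw by blast+
      \<comment> \<open>Being neither outer nor on a hexagon, \<open>uw\<close> is the middle edge
        at both of its ends. So \<open>uy\<close> is outer at \<open>u\<close> and \<open>wy\<close>
        is outer at \<open>w\<close>, and both lead to \<open>y\<close> without crossing
        \<open>U\<close>.\<close>
      have "outer u y" using dichotomy[OF V(1) t y(3)] inner_tri[OF V(1) t y(3)] nou y by metis
      moreover have "outer w y" using dichotomy[OF V(2) y(5) y(4)] inner_tri[OF V(2) y(5) y(4)] nou y by metis
      ultimately show False using ocl uw by blast
    qed
  qed
qed

end

section \<open>Rows glued along strips of two kinds, and the type
  \<open>{3\<^sup>3, 4\<^sup>2}\<close>\<close>

lemma cycle_connected: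
  assumes "\<And>x y. {x, y} \<in> cycle_edges c \<Longrightarrow> p x \<longleftrightarrow> p y" "x \<in> set c" "y \<in> set c"
  shows "p x \<longleftrightarrow> p y"
proof -
  have *: "p (c ! i) \<longleftrightarrow> p (c ! 0)" if "i < length c" for i
    using that
  proof (induction i)
    case (Suc i)
    have "{c ! i, c ! Suc i} \<in> cycle_edges c"
      unfolding cycle_edges_def using Suc.prems by (intro CollectI exI[of _ i]) simp
    then show ?case using assms(1) Suc by simp
  qed simp
  show ?thesis using *[of "SOME i. i < length c"] assms(2,3) * by (auto simp: in_set_conv_nth)
qed

lemma two_cycle_edges:
  assumes "graph_cycle V E c"
  obtains e where "e \<in> cycle_edges c" "e \<noteq> e0"
proof -
  have l: "3 \<le> length c" and d: "distinct c" using assms by (auto simp: graph_cycle_def)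
  have "c \<noteq> []" using l by auto
  have "Suc 0 mod length c = 1" "0 < length c" using l by (auto simp: mod_less)
  then have "{c ! 0, c ! 1} \<in> cycle_edges c"
    unfolding cycle_edges_def by (intro CollectI exI[of _ 0]) simp
  moreover have "{c ! 1, c ! 2} \<in> cycle_edges c"
    unfolding cycle_edges_def using l by (intro CollectI exI[of _ 1]) (simp add: numeral_2_eq_2)
  moreover have "{c ! 0, c ! 1} \<noteq> {c ! 1, c ! 2}"
  proof
    assume "{c ! 0, c ! 1} = {c ! 1, c ! 2}"
    then have "c ! 0 = c ! 2" by (auto simp: doubleton_eq_iff)
    moreover have "0 < length c" "2 < length c" using l by linarith+
    ultimately show False using nth_eq_iff_index_eq[OF d, of 0 2] by simp
  qed
  ultimately show thesis using that by metis
qed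

text \<open>Rows are glued along strips of two kinds, pairing them by the involutions \<open>up\<close> and \<open>down\<close>.
  One square is chosen per strip; those of the second kind avoid the edges removed by the first.\<close>

lemma merge_two_strips:
  fixes up down :: "'v list \<Rightarrow> 'v list"
  assumes P: "finite P" "\<And>c. c \<in> P \<Longrightarrow> graph_cycle V E c"
    "\<And>c d. c \<in> P \<Longrightarrow> d \<in> P \<Longrightarrow> c \<noteq> d \<Longrightarrow> set c \<inter> set d = {}" "V = \<Union>(set ` P)" "V \<noteq> {}"
    and up: "\<And>c. c \<in> P \<Longrightarrow> up c \<in> P \<and> up (up c) = c"
    and down: "\<And>c. c \<in> P \<Longrightarrow> down c \<in> P \<and> down (down c) = c"
    and up_quad: "\<And>x. x \<in> P \<Longrightarrow> \<exists>a b c d. {a, b} \<in> cycle_edges x \<and> {c, d} \<in> cycle_edges (up x) \<and>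
      {b, c} \<in> E \<and> {d, a} \<in> E"
    and down_quad: "\<And>x e e'. x \<in> P \<Longrightarrow> \<exists>a b c d. {a, b} \<in> cycle_edges x - {e} \<and>
      {c, d} \<in> cycle_edges (down x) - {e'} \<and> {b, c} \<in> E \<and> {d, a} \<in> E"
    and conn: "\<And>A. A \<subseteq> P \<Longrightarrow> A \<noteq> {} \<Longrightarrow> A \<noteq> P \<Longrightarrow> \<exists>x\<in>A. up x \<notin> A \<or> down x \<notin> A"
  shows "hamiltonian V E"
proof -
  define good where "good x y q \<longleftrightarrow> (case q of (a, b, c, d) \<Rightarrow>
    {a, b} \<in> cycle_edges x \<and> {c, d} \<in> cycle_edges y \<and> {b, c} \<in> E \<and> {d, a} \<in> E)" for x y q
  define rem where "rem q = (case q of (a, b, c, d) \<Rightarrow> {{a, b :: 'v}, {c, d}})" for q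
  \<comment> \<open>Indexed by the unordered pair of rows, so that both rows of a strip select the
    same square.\<close>
  define sq where "sq S = (SOME q. \<exists>x y. S = {x, y} \<and> x \<in> P \<and> y = up x \<and> good x y q)" for S
  have sq: "\<exists>x y. {z, up z} = {x, y} \<and> x \<in> P \<and> y = up x \<and> good x y (sq {z, up z})" if z: "z \<in> P" for z
  proof -
    have "\<exists>q. good z (up z) q" using up_quad[OF z] unfolding good_def by auto
    then have "\<exists>q x y. {z, up z} = {x, y} \<and> x \<in> P \<and> y = up x \<and> good x y q" using z by blast
    then show ?thesis unfolding sq_def by (rule someI_ex)
  qed
  define Q1 where "Q1 q \<longleftrightarrow> (\<exists>x\<in>P. up x \<noteq> x \<and> q = sq {x, up x})" for q
  define cyc_of where "cyc_of e x \<longleftrightarrow> x \<in> P \<and> e \<in> cycle_edges x" for e and x :: "'v list"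
  have in_set: "u \<in> set c \<and> v \<in> set c" if "{u, v} \<in> cycle_edges c" for u v :: 'v and c
    using that darts_subset[of c] by (auto simp: cycle_edges_darts uedge_def doubleton_eq_iff)
  have unique: "x = y" if xy: "x \<in> P" "y \<in> P" "{u, v} \<in> cycle_edges x" "{u, v} \<in> cycle_edges y" for x y u v
    using in_set[OF xy(3)] in_set[OF xy(4)] P(3)[OF xy(1,2)] by blast
  have rem_sq: "\<exists>x\<in>P. e \<in> cycle_edges x \<and> {z, up z} = {x, up x} \<and> (\<exists>u v. e = {u, v})"
    if z: "z \<in> P" "e \<in> rem (sq {z, up z})" for z e
  proof -
    obtain x y where xy: "{z, up z} = {x, y}" "x \<in> P" "y = up x" "good x y (sq {z, up z})" using sq[OF z(1)] by blast
    obtain a b c d where q: "sq {z, up z} = (a, b, c, d)" by (cases "sq {z, up z}") auto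
    have e: "e = {a, b} \<or> e = {c, d}" using z(2) q unfolding rem_def by simp
    have "{a, b} \<in> cycle_edges x" "{c, d} \<in> cycle_edges (up x)" using xy(3,4) q unfolding good_def by auto
    moreover have "up x \<in> P" "{z, up z} = {up x, up (up x)}" using up[OF xy(2)] xy(1,3) by (auto simp: insert_commute)
    ultimately show ?thesis using e xy(1,2,3) by blast
  qed
  \<comment> \<open>Since \<open>up\<close> is an involution, a row takes part in a single strip of
    the first kind and loses at most one edge there; a row paired with itself loses none.\<close>
  have rem_one: "\<exists>e0. \<forall>q e. Q1 q \<longrightarrow> e \<in> rem q \<longrightarrow> e \<in> cycle_edges x \<longrightarrow> e = e0" if x: "x \<in> P" for x
  proof (cases "up x = x")
    case True
    have "False" if "Q1 q" "e \<in> rem q" "e \<in> cycle_edges x" for q e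
    proof -
      obtain z where z: "z \<in> P" "up z \<noteq> z" "q = sq {z, up z}" using \<open>Q1 q\<close> unfolding Q1_def by blast
      obtain y where y: "y \<in> P" "e \<in> cycle_edges y" "{z, up z} = {y, up y}" "\<exists>u v. e = {u, v}"
        using rem_sq[OF z(1)] \<open>e \<in> rem q\<close> z(3) by blast
      then have "y = x" using unique x \<open>e \<in> cycle_edges x\<close> by blast
      then show False using y(3) True z(2) by auto
    qed
    then show ?thesis by blast
  next
    case False
    obtain x' y' where xy: "{x, up x} = {x', y'}" "x' \<in> P" "y' = up x'" "good x' y' (sq {x, up x})" using sq[OF x] by blast
    obtain a b c d where q: "sq {x, up x} = (a, b, c, d)" by (cases "sq {x, up x}") auto
    have m: "{a, b} \<in> cycle_edges x'" "{c, d} \<in> cycle_edges y'" using xy(4) q unfolding good_def by auto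
    have ne: "x' \<noteq> y'" using xy(1) False by (auto simp: doubleton_eq_iff)
    have y'P: "y' \<in> P" using up[OF xy(2)] xy(3) by simp
    define e0 where "e0 = (if x = x' then {a, b} else {c, d})"
    have "e = e0" if "Q1 q'" "e \<in> rem q'" "e \<in> cycle_edges x" for q' e
    proof -
      obtain z where z: "z \<in> P" "up z \<noteq> z" "q' = sq {z, up z}" using \<open>Q1 q'\<close> unfolding Q1_def by blast
      obtain y where y: "y \<in> P" "e \<in> cycle_edges y" "{z, up z} = {y, up y}" "\<exists>u v. e = {u, v}"
        using rem_sq[OF z(1)] \<open>e \<in> rem q'\<close> z(3) by blast
      then have "y = x" using unique x \<open>e \<in> cycle_edges x\<close> by blast
      then have "q' = (a, b, c, d)" using y(3) z(3) q by simp
      then have e: "e = {a, b} \<or> e = {c, d}" using \<open>e \<in> rem q'\<close> unfolding rem_def by simp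
      show ?thesis
      proof (cases "x = x'")
        case True
        then have "e \<noteq> {c, d}" using unique[OF x y'P, of c d] m(2) \<open>e \<in> cycle_edges x\<close> ne by blast
        then show ?thesis using e True e0_def by simp
      next
        case False
        then have "e \<noteq> {a, b}" using unique[OF x xy(2), of a b] m(1) \<open>e \<in> cycle_edges x\<close> by blast
        then show ?thesis using e False e0_def by simp
      qed
    qed
    then show ?thesis by blast
  qed
  define free where "free q \<longleftrightarrow> (\<forall>q'. Q1 q' \<longrightarrow> rem q \<inter> rem q' = {})" for q
  define rh where "rh S = (SOME q. free q \<and> (\<exists>x y. S = {x, y} \<and> x \<in> P \<and> y = down x \<and> good x y q))" for S
  have rh: "free (rh {z, down z}) \<and> (\<exists>x y. {z, down z} = {x, y} \<and> x \<in> P \<and> y = down x \<and> good x y (rh {z, down z}))"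
    if z: "z \<in> P" for z
  proof -
    obtain e1 where e1: "\<forall>q e. Q1 q \<longrightarrow> e \<in> rem q \<longrightarrow> e \<in> cycle_edges z \<longrightarrow> e = e1" using rem_one[OF z] by blast
    obtain e2 where e2: "\<forall>q e. Q1 q \<longrightarrow> e \<in> rem q \<longrightarrow> e \<in> cycle_edges (down z) \<longrightarrow> e = e2"
      using rem_one down[OF z] by blast
    obtain a b c d where q: "{a, b} \<in> cycle_edges z - {e1}" "{c, d} \<in> cycle_edges (down z) - {e2}"
      "{b, c} \<in> E" "{d, a} \<in> E" using down_quad[OF z, of e1 e2] by (elim exE conjE)
    \<comment> \<open>\<open>down_quad\<close> avoids one prescribed edge in each of the two rows,
      which is just enough, as a row loses at most one edge to the first kind.\<close>
    have "free (a, b, c, d)" unfolding free_def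
    proof (intro allI impI)
      fix q' assume q': "Q1 q'"
      have "{a, b} \<notin> rem q'" using e1 q' q(1) by blast
      moreover have "{c, d} \<notin> rem q'" using e2 q' q(2) by blast
      moreover have "rem (a, b, c, d) = {{a, b}, {c, d}}" by (simp add: rem_def)
      ultimately show "rem (a, b, c, d) \<inter> rem q' = {}" by simp
    qed
    moreover have "good z (down z) (a, b, c, d)" using q unfolding good_def by simp
    ultimately have "\<exists>q. free q \<and> (\<exists>x y. {z, down z} = {x, y} \<and> x \<in> P \<and> y = down x \<and> good x y q)" using z by blast
    then show ?thesis unfolding rh_def by (rule someI_ex)
  qed
  define Q2 where "Q2 q \<longleftrightarrow> (\<exists>x\<in>P. down x \<noteq> x \<and> q = rh {x, down x})" for q
  have rem_rh: "\<exists>x\<in>P. e \<in> cycle_edges x \<and> {z, down z} = {x, down x} \<and> (\<exists>u v. e = {u, v})"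
    if z: "z \<in> P" "e \<in> rem (rh {z, down z})" for z e
  proof -
    obtain x y where xy: "{z, down z} = {x, y}" "x \<in> P" "y = down x" "good x y (rh {z, down z})" using rh[OF z(1)] by blast
    obtain a b c d where q: "rh {z, down z} = (a, b, c, d)" by (cases "rh {z, down z}") auto
    have e: "e = {a, b} \<or> e = {c, d}" using z(2) q unfolding rem_def by simp
    have "{a, b} \<in> cycle_edges x" "{c, d} \<in> cycle_edges (down x)" using xy(3,4) q unfolding good_def by auto
    moreover have "down x \<in> P" "{z, down z} = {down x, down (down x)}" using down[OF xy(2)] xy(1,3) by (auto simp: insert_commute)
    ultimately show ?thesis using e xy(1,2,3) by blast
  qed
  have share1: "q = q'" if "Q1 q" "Q1 q'" "rem q \<inter> rem q' \<noteq> {}" for q q'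
  proof -
    obtain z z' where z: "z \<in> P" "q = sq {z, up z}" "z' \<in> P" "q' = sq {z', up z'}"
      using \<open>Q1 q\<close> \<open>Q1 q'\<close> unfolding Q1_def by blast
    obtain e where e: "e \<in> rem q" "e \<in> rem q'" using \<open>rem q \<inter> rem q' \<noteq> {}\<close> by blast
    obtain x where x: "x \<in> P" "e \<in> cycle_edges x" "{z, up z} = {x, up x}" "\<exists>u v. e = {u, v}" using rem_sq[OF z(1)] e z(2) by blast
    obtain y where y: "y \<in> P" "e \<in> cycle_edges y" "{z', up z'} = {y, up y}" using rem_sq[OF z(3)] e z(4) by blast
    have "x = y" using unique x y by blast
    then show ?thesis using x y z by simp
  qed
  have share2: "q = q'" if "Q2 q" "Q2 q'" "rem q \<inter> rem q' \<noteq> {}" for q q'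
  proof -
    obtain z z' where z: "z \<in> P" "q = rh {z, down z}" "z' \<in> P" "q' = rh {z', down z'}"
      using \<open>Q2 q\<close> \<open>Q2 q'\<close> unfolding Q2_def by blast
    obtain e where e: "e \<in> rem q" "e \<in> rem q'" using \<open>rem q \<inter> rem q' \<noteq> {}\<close> by blast
    obtain x where x: "x \<in> P" "e \<in> cycle_edges x" "{z, down z} = {x, down x}" "\<exists>u v. e = {u, v}" using rem_rh[OF z(1)] e z(2) by blast
    obtain y where y: "y \<in> P" "e \<in> cycle_edges y" "{z', down z'} = {y, down y}" using rem_rh[OF z(3)] e z(4) by blast
    have "x = y" using unique x y by blast
    then show ?thesis using x y z by simp
  qed
  have share12: "rem q \<inter> rem q' = {}" if "Q2 q" "Q1 q'" for q q'
    using rh that unfolding Q2_def free_def by blast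
  have share: "q = q'" if q: "Q1 q \<or> Q2 q" "Q1 q' \<or> Q2 q'" "rem q \<inter> rem q' \<noteq> {}" for q q'
  proof -
    consider "Q1 q" "Q1 q'" | "Q2 q" "Q2 q'" using q share12[of q q'] share12[of q' q] by (auto simp: Int_commute)
    then show ?thesis using share1 share2 q(3) by cases blast+
  qed
  show ?thesis
  proof (rule merge_cycles[where P = P and Q = "\<lambda>a b c d. Q1 (a, b, c, d) \<or> Q2 (a, b, c, d)", OF P])
    show "{a, b} \<in> \<Union>(cycle_edges ` P) \<and> {c, d} \<in> \<Union>(cycle_edges ` P) \<and> {b, c} \<in> E \<and> {d, a} \<in> E"
      if q: "Q1 (a, b, c, d) \<or> Q2 (a, b, c, d)" for a b c d
    proof -
      have "\<exists>x\<in>P. \<exists>y\<in>P. good x y (a, b, c, d)" using q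
      proof
        assume "Q1 (a, b, c, d)"
        then obtain z where "z \<in> P" "(a, b, c, d) = sq {z, up z}" unfolding Q1_def by blast
        then show ?thesis using sq[of z] up by metis
      next
        assume "Q2 (a, b, c, d)"
        then obtain z where "z \<in> P" "(a, b, c, d) = rh {z, down z}" unfolding Q2_def by blast
        then show ?thesis using rh[of z] down by metis
      qed
      then show ?thesis unfolding good_def by blast
    qed
    show "{{a, b}, {c, d}} = {{a', b'}, {c', d'}}"
      if q: "Q1 (a, b, c, d) \<or> Q2 (a, b, c, d)" "Q1 (a', b', c', d') \<or> Q2 (a', b', c', d')"
        "{{a, b}, {c, d}} \<inter> {{a', b'}, {c', d'}} \<noteq> {}" for a b c d a' b' c' d'
      using share[OF q(1,2)] q(3) by (simp add: rem_def)
    show "\<exists>a b c d. (Q1 (a, b, c, d) \<or> Q2 (a, b, c, d)) \<and> (a \<in> U \<longleftrightarrow> c \<notin> U)"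
      if U: "U \<subseteq> V" "U \<noteq> {}" "U \<noteq> V" "\<And>c. c \<in> P \<Longrightarrow> set c \<subseteq> U \<or> set c \<inter> U = {}" for U
    proof -
      \<comment> \<open>A cut that respects the rows is turned into the set of rows inside it;
        \<open>conn\<close> then provides a row whose partner is outside.\<close>
      define A where "A = {c \<in> P. set c \<subseteq> U}"
      have ne: "c \<noteq> []" if "c \<in> P" for c using P(2)[OF that] by (auto simp: graph_cycle_def)
      have A1: "A \<noteq> {}" using U(1,2,4) P(4) unfolding A_def by blast
      have A2: "A \<noteq> P" using U(1,3) P(4) unfolding A_def by blast
      obtain x where x: "x \<in> A" "up x \<notin> A \<or> down x \<notin> A" using conn[of A] A1 A2 unfolding A_def by blast
      have xP: "x \<in> P" "set x \<subseteq> U" using x(1) unfolding A_def by simp_all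
      have cross: "a \<in> U \<longleftrightarrow> c \<notin> U" if g: "good y z (a, b, c, d)" "{x, w} = {y, z}" "w \<in> P" "w \<notin> A" for y z w a b c d
      proof -
        have w: "set w \<inter> U = {}" using U(4)[OF g(3)] g(3,4) unfolding A_def by simp
        have "a \<in> set y" "c \<in> set z" using g(1) in_set unfolding good_def by auto
        moreover have "y = x \<and> z = w \<or> y = w \<and> z = x" using g(2) by (auto simp: doubleton_eq_iff)
        ultimately show ?thesis using w xP(2) by blast
      qed
      from x(2) show ?thesis
      proof
        assume u: "up x \<notin> A"
        then have "up x \<noteq> x" using x(1) by auto
        then have Q: "Q1 (sq {x, up x})" unfolding Q1_def using xP by blast
        obtain a b c d where q: "sq {x, up x} = (a, b, c, d)" by (cases "sq {x, up x}") auto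
        obtain y z where "{x, up x} = {y, z}" "good y z (sq {x, up x})" using sq[OF xP(1)] by blast
        then have "a \<in> U \<longleftrightarrow> c \<notin> U" using cross[of y z a b c d "up x"] q up[OF xP(1)] u by simp
        then show ?thesis using Q q by auto
      next
        assume u: "down x \<notin> A"
        then have "down x \<noteq> x" using x(1) by auto
        then have Q: "Q2 (rh {x, down x})" unfolding Q2_def using xP by blast
        obtain a b c d where q: "rh {x, down x} = (a, b, c, d)" by (cases "rh {x, down x}") auto
        obtain y z where "{x, down x} = {y, z}" "good y z (rh {x, down x})" using rh[OF xP(1)] by blast
        then have "a \<in> U \<longleftrightarrow> c \<notin> U" using cross[of y z a b c d "down x"] q down[OF xP(1)] u by simp
        then show ?thesis using Q q by auto
      qed
    qed
  qed
qed

context polygonal_map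
begin

lemma triangle_third:
  assumes "sz t = 3" "ed t a b"
  shows "\<exists>c. c \<noteq> a \<and> c \<noteq> b \<and> ed t a c \<and> ed t b c \<and> (\<forall>x y. ed t x y \<longrightarrow> x \<in> {a, b, c} \<and> y \<in> {a, b, c})"
proof -
  obtain c where c: "distinct [a, b, c]" "\<forall>x y. ed t x y \<longleftrightarrow> {x, y} \<in> {{a, b}, {b, c}, {c, a}}"
    using three_ex[OF assms] by (elim exE conjE)
  have "\<forall>x y. ed t x y \<longrightarrow> x \<in> {a, b, c} \<and> y \<in> {a, b, c}"
  proof (intro allI impI)
    fix x y assume "ed t x y"
    then have "{x, y} \<in> {{a, b}, {b, c}, {c, a}}" using c(2) by simp
    then have "{x, y} \<subseteq> {a, b, c}" by (elim insertE emptyE) simp_all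
    then show "x \<in> {a, b, c} \<and> y \<in> {a, b, c}" by simp
  qed
  moreover have "ed t b c" "ed t c a" using c(2) by simp_all
  moreover have "ed t a c" using \<open>ed t c a\<close> by (rule ed_sym)
  moreover have "c \<noteq> a" "c \<noteq> b" using c(1) by auto
  ultimately show ?thesis by (intro exI[of _ c] conjI) simp_all
qed

lemma triangle_closed:
  assumes "sz t = 3" "ed t v x" "ed t v y" "x \<noteq> y"
  shows "ed t x y"
proof -
  obtain c where c: "ed t v c" "ed t x c" "\<forall>x' y. ed t x' y \<longrightarrow> x' \<in> {v, x, c} \<and> y \<in> {v, x, c}"
    using triangle_third[OF assms(1,2)] by blast
  have "y = c" using c(3) assms(3,4) ed_E(4)[OF assms(3)] by blast
  then show ?thesis using c(2) by simp
qed

text \<open>Apart from row edges, an edge goes up (between two squares) or down (between two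
  triangles). Both strips beside a row contain its edges, so the exchanges would compete for them.
  On the triangle side each row edge has two quadrilaterals to choose from, one for each row edge at
  the apex of its triangle, and this freedom keeps the exchanges apart.\<close>

lemma hamiltonian_33344:
  assumes as: "as = [3, 3, 3, 4, 4]"
  shows "hamiltonian V E"
proof -
  define tri where "tri t u v \<longleftrightarrow> sz t = 3 \<and> ed t u v" for t u v
  define squ where "squ t u v \<longleftrightarrow> sz t = 4 \<and> ed t u v" for t u v
  have tri_sym: "tri t u v \<longleftrightarrow> tri t v u" for t u v unfolding tri_def using ed_comm by blast
  have squ_sym: "squ t u v \<longleftrightarrow> squ t v u" for t u v unfolding squ_def using ed_comm by blast
  define row where "row u v \<longleftrightarrow> (\<exists>t. tri t u v) \<and> (\<exists>s. squ s u v)" for u v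
  define up where "up u v \<longleftrightarrow> {u, v} \<in> E \<and> \<not> (\<exists>t. tri t u v)" for u v
  define dn where "dn u v \<longleftrightarrow> {u, v} \<in> E \<and> \<not> (\<exists>s. squ s u v)" for u v
  have row_sym: "row u v \<longleftrightarrow> row v u" for u v unfolding row_def using tri_sym squ_sym by blast
  have up_sym: "up u v \<longleftrightarrow> up v u" for u v unfolding up_def using tri_sym E_sym by blast
  have dn_sym: "dn u v \<longleftrightarrow> dn v u" for u v unfolding dn_def using squ_sym E_sym by blast
  have EV: "u \<in> V \<and> v \<in> V \<and> u \<noteq> v" if "{u, v} \<in> E" for u v
    using edgeE[OF that] by (auto simp: doubleton_eq_iff)
  have rowE: "{u, v} \<in> E" if "row u v" for u v using that ed_E(1) unfolding row_def tri_def by blast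
  have triE: "{u, v} \<in> E" if "tri t u v" for t u v using that ed_E(1) unfolding tri_def by blast
  have local: "\<exists>n0 n1 n2 n3 n4 f0 f1 f2 f3 f4. distinct [n0, n1, n2, n3, n4] \<and> distinct [f0, f1, f2, f3, f4] \<and>
      (\<forall>x. {v, x} \<in> E \<longleftrightarrow> x \<in> {n0, n1, n2, n3, n4}) \<and>
      (\<forall>t x. tri t v x \<longleftrightarrow> t = f0 \<and> (x = n0 \<or> x = n1) \<or> t = f1 \<and> (x = n1 \<or> x = n2) \<or> t = f2 \<and> (x = n2 \<or> x = n3)) \<and>
      (\<forall>t x. squ t v x \<longleftrightarrow> t = f3 \<and> (x = n3 \<or> x = n4) \<or> t = f4 \<and> (x = n4 \<or> x = n0)) \<and>
      (\<forall>x. row v x \<longleftrightarrow> x = n0 \<or> x = n3) \<and> (\<forall>x. up v x \<longleftrightarrow> x = n4) \<and> (\<forall>x. dn v x \<longleftrightarrow> x = n1 \<or> x = n2)"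
    if v: "v \<in> V" for v
  proof -
    obtain n0 n1 n2 n3 n4 f0 f1 f2 f3 f4 where s: "distinct [n0, n1, n2, n3, n4]" "distinct [f0, f1, f2, f3, f4]"
      "sz f0 = 3 \<and> sz f1 = 3 \<and> sz f2 = 3 \<and> sz f3 = 4 \<and> sz f4 = 4" "\<forall>x. {v, x} \<in> E \<longleftrightarrow> x \<in> {n0, n1, n2, n3, n4}"
      "\<forall>f x. ed f v x \<longleftrightarrow> f = f0 \<and> x \<in> {n0, n1} \<or> f = f1 \<and> x \<in> {n1, n2} \<or> f = f2 \<and> x \<in> {n2, n3}
        \<or> f = f3 \<and> x \<in> {n3, n4} \<or> f = f4 \<and> x \<in> {n4, n0}"
      using star5[OF v as] by (elim exE conjE) blast
    have 3: "\<forall>t x. tri t v x \<longleftrightarrow> t = f0 \<and> (x = n0 \<or> x = n1) \<or> t = f1 \<and> (x = n1 \<or> x = n2) \<or> t = f2 \<and> (x = n2 \<or> x = n3)"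
      using s(3,5) unfolding tri_def by auto
    have 4: "\<forall>t x. squ t v x \<longleftrightarrow> t = f3 \<and> (x = n3 \<or> x = n4) \<or> t = f4 \<and> (x = n4 \<or> x = n0)"
      using s(3,5) unfolding squ_def by auto
    have r: "\<forall>x. row v x \<longleftrightarrow> x = n0 \<or> x = n3" using s(1) 3 4 unfolding row_def by auto
    have u: "\<forall>x. up v x \<longleftrightarrow> x = n4" using s(1,4) 3 unfolding up_def by auto
    have d: "\<forall>x. dn v x \<longleftrightarrow> x = n1 \<or> x = n2" using s(1,4) 4 unfolding dn_def by auto
    show ?thesis
      by (rule exI[of _ n0], rule exI[of _ n1], rule exI[of _ n2], rule exI[of _ n3], rule exI[of _ n4],
          rule exI[of _ f0], rule exI[of _ f1], rule exI[of _ f2], rule exI[of _ f3], rule exI[of _ f4])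
        (intro conjI s 3 4 r u d)
  qed
  have squ_corner: "row v x \<and> up v y \<or> up v x \<and> row v y" if t: "squ s v x" "squ s v y" "x \<noteq> y" for s v x y
  proof -
    have "v \<in> V" using t(1) ed_E(2) unfolding squ_def by blast
    from local[OF this] obtain n0 n1 n2 n3 n4 f0 f1 f2 f3 f4 where
      L: "distinct [n0, n1, n2, n3, n4]" "distinct [f0, f1, f2, f3, f4]"
      "\<forall>t x. squ t v x \<longleftrightarrow> t = f3 \<and> (x = n3 \<or> x = n4) \<or> t = f4 \<and> (x = n4 \<or> x = n0)"
      "\<forall>x. row v x \<longleftrightarrow> x = n0 \<or> x = n3" "\<forall>x. up v x \<longleftrightarrow> x = n4" by (elim exE conjE)
    show ?thesis using t L by auto
  qed
  have up_unique: "\<exists>!x. up v x" if v: "v \<in> V" for v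
  proof -
    from local[OF v] obtain n4 where "\<forall>x. up v x \<longleftrightarrow> x = n4" by (elim exE conjE)
    then show ?thesis by simp
  qed
  have kinds: "row v x \<or> up v x \<or> dn v x" if x: "{v, x} \<in> E" for v x
    using x unfolding row_def up_def dn_def by blast
  have dn_ex: "\<exists>x. dn v x" if v: "v \<in> V" for v
  proof -
    from local[OF v] obtain n1 n2 where "\<forall>x. dn v x \<longleftrightarrow> x = n1 \<or> x = n2" by (elim exE conjE)
    then show ?thesis by blast
  qed
  have row_tri: "\<exists>t y. tri t v x \<and> tri t v y \<and> dn v y \<and> y \<noteq> x" if x: "row v x" for v x
  proof -
    have "v \<in> V" using rowE[OF x] EV by blast
    from local[OF this] obtain n0 n1 n2 n3 n4 f0 f1 f2 f3 f4 where
      L: "distinct [n0, n1, n2, n3, n4]"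
      "\<forall>t x. tri t v x \<longleftrightarrow> t = f0 \<and> (x = n0 \<or> x = n1) \<or> t = f1 \<and> (x = n1 \<or> x = n2) \<or> t = f2 \<and> (x = n2 \<or> x = n3)"
      "\<forall>x. row v x \<longleftrightarrow> x = n0 \<or> x = n3" "\<forall>x. dn v x \<longleftrightarrow> x = n1 \<or> x = n2" by (elim exE conjE)
    have "tri f0 v n0" "tri f0 v n1" "tri f2 v n3" "tri f2 v n2" "dn v n1" "dn v n2" "x = n0 \<or> x = n3"
      "n1 \<noteq> n0" "n2 \<noteq> n3" using L x by auto
    then show ?thesis by blast
  qed
  have tri_corner: "\<not> row v y \<and> dn v y" if t: "tri t v x" "tri t v y" "x \<noteq> y" "row v x" for t v x y
  proof -
    have "v \<in> V" using rowE[OF t(4)] EV by blast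
    from local[OF this] obtain n0 n1 n2 n3 n4 f0 f1 f2 f3 f4 where
      L: "distinct [n0, n1, n2, n3, n4]" "distinct [f0, f1, f2, f3, f4]"
      "\<forall>t x. tri t v x \<longleftrightarrow> t = f0 \<and> (x = n0 \<or> x = n1) \<or> t = f1 \<and> (x = n1 \<or> x = n2) \<or> t = f2 \<and> (x = n2 \<or> x = n3)"
      "\<forall>x. row v x \<longleftrightarrow> x = n0 \<or> x = n3" "\<forall>x. dn v x \<longleftrightarrow> x = n1 \<or> x = n2" by (elim exE conjE)
    show ?thesis using t L by auto
  qed
  \<comment> \<open>A triangle with two down edges at \<open>v\<close> is the middle one of the
    three; across either of these edges lies a triangle with a row edge at \<open>v\<close>.\<close>
  have middle: "(\<exists>t0 r. t0 \<noteq> t \<and> tri t0 v x \<and> tri t0 v r \<and> row v r \<and> r \<noteq> x) \<and>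
      (\<forall>t0. t0 \<noteq> t \<longrightarrow> tri t0 v x \<longrightarrow> (\<exists>r. tri t0 v r \<and> row v r \<and> r \<noteq> x))"
    if t: "tri t v x" "tri t v y" "dn v x" "dn v y" "x \<noteq> y" for t v x y
  proof -
    have "v \<in> V" using triE[OF t(1)] EV by blast
    from local[OF this] obtain n0 n1 n2 n3 n4 f0 f1 f2 f3 f4 where
      L: "distinct [n0, n1, n2, n3, n4]" "distinct [f0, f1, f2, f3, f4]"
      "\<forall>t x. tri t v x \<longleftrightarrow> t = f0 \<and> (x = n0 \<or> x = n1) \<or> t = f1 \<and> (x = n1 \<or> x = n2) \<or> t = f2 \<and> (x = n2 \<or> x = n3)"
      "\<forall>x. row v x \<longleftrightarrow> x = n0 \<or> x = n3" "\<forall>x. dn v x \<longleftrightarrow> x = n1 \<or> x = n2" by (elim exE conjE)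
    have "t = f1" "x = n1 \<or> x = n2" using t L by auto
    then show ?thesis
    proof (elim disjE)
      assume x: "x = n1" "t = f1"
      have "tri f0 v x" "tri f0 v n0" "row v n0" "n0 \<noteq> x" "f0 \<noteq> t" "\<forall>t0. t0 \<noteq> t \<longrightarrow> tri t0 v x \<longrightarrow> t0 = f0"
        using x L by auto
      then show ?thesis by blast
    next
      assume x: "x = n2" "t = f1"
      have "tri f2 v x" "tri f2 v n3" "row v n3" "n3 \<noteq> x" "f2 \<noteq> t" "\<forall>t0. t0 \<noteq> t \<longrightarrow> tri t0 v x \<longrightarrow> t0 = f2"
        using x L by auto
      then show ?thesis by blast
    qed
  qed
  have tri_closed: "tri t x y" if "tri t v x" "tri t v y" "x \<noteq> y" for t v x y
    using that triangle_closed unfolding tri_def by blast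
  have dn_pair: "\<exists>t. tri t v x \<and> tri t v y" if t: "dn v x" "dn v y" "x \<noteq> y" for v x y
  proof -
    have "v \<in> V" using t(1) EV unfolding dn_def by blast
    from local[OF this] obtain n0 n1 n2 n3 n4 f0 f1 f2 f3 f4 where
      L: "\<forall>t x. tri t v x \<longleftrightarrow> t = f0 \<and> (x = n0 \<or> x = n1) \<or> t = f1 \<and> (x = n1 \<or> x = n2) \<or> t = f2 \<and> (x = n2 \<or> x = n3)"
      "\<forall>x. dn v x \<longleftrightarrow> x = n1 \<or> x = n2" by (elim exE conjE)
    have "tri f1 v n1" "tri f1 v n2" "x = n1 \<or> x = n2" "y = n1 \<or> y = n2" using t L by auto
    then show ?thesis by blast
  qed
  \<comment> \<open>Otherwise \<open>vxy\<close> would be a triangle with three down edges. The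
    triangle across \<open>vx\<close> would then have row edges at both \<open>v\<close> and
    \<open>x\<close>, hence two row edges at its third vertex, which \<open>tri_corner\<close>
    forbids.\<close>
  have dn_row: "row x y" if t: "dn v x" "dn v y" "x \<noteq> y" for v x y
  proof (rule ccontr)
    assume nr: "\<not> row x y"
    obtain t where t': "tri t v x" "tri t v y" using dn_pair[OF t] by blast
    have xy: "tri t x y" using tri_closed[OF t' t(3)] .
    then have dxy: "dn x y" using nr triE[OF xy] unfolding row_def dn_def by blast
    obtain t0 r where r: "t0 \<noteq> t" "tri t0 v x" "tri t0 v r" "row v r" "r \<noteq> x"
      using middle[OF t' t] by blast
    have "y \<noteq> v" using t(2) EV unfolding dn_def by blast
    have "tri t x v" "dn x v" "v \<noteq> y" "tri t0 x v" using t'(1) t(1) r(2) tri_sym dn_sym \<open>y \<noteq> v\<close> by simp_all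
    then obtain r' where r': "tri t0 x r'" "row x r'" "r' \<noteq> v"
      using middle[OF \<open>tri t x v\<close> xy \<open>dn x v\<close> dxy \<open>v \<noteq> y\<close>] r(1) by meson
    have vx: "sz t0 = 3" "ed t0 v x" using r(2) unfolding tri_def by simp_all
    obtain c where c: "\<forall>x' y. ed t0 x' y \<longrightarrow> x' \<in> {v, x, c} \<and> y \<in> {v, x, c}"
      using triangle_third[OF vx] by blast
    have "r \<noteq> v" "r' \<noteq> x" using rowE[OF r(4)] rowE[OF r'(2)] EV by blast+
    then have "r = c" "r' = c" using c r r' unfolding tri_def by blast+
    then have "tri t0 r v" "tri t0 r x" "row r v" "row r x" "v \<noteq> x"
      using r r' tri_sym row_sym ed_E(4)[OF vx(2)] by blast+
    then show False using tri_corner[of t0 r v x] by blast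
  qed
  \<comment> \<open>Row and up edges alternate around a square, as every corner of a square has one
    of each.\<close>
  have square: "\<exists>y z. up v y \<and> up x z \<and> row y z" if x: "row v x" for v x
  proof -
    obtain s where s: "squ s v x" using x unfolding row_def by blast
    then have s': "sz s = 4" "ed s v x" unfolding squ_def by simp_all
    obtain z y where zy: "distinct [v, x, z, y]" "\<forall>a b. ed s a b \<longleftrightarrow> {a, b} \<in> {{v, x}, {x, z}, {z, y}, {y, v}}"
      using four_ex[OF s'] by (elim exE conjE)
    have e: "ed s x z" "ed s z y" "ed s y v" using zy(2) by simp_all
    have q: "squ s x z" "squ s y z" "squ s y v" "squ s v y" "squ s x v" "squ s z x" "squ s z y"
      using e s' ed_sym unfolding squ_def by blast+
    have ne: "x \<noteq> y" "v \<noteq> z" using zy(1) by auto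
    have nu: "\<not> up v x" using x unfolding up_def row_def by blast
    have nu': "\<not> up x v" using nu up_sym by blast
    have uy: "up v y" using squ_corner[OF s q(4) ne(1)] nu by blast
    have uz: "up x z" using squ_corner[OF q(5,1) ne(2)] nu' by blast
    have "up y v" using uy up_sym by blast
    then have "\<not> row y v" unfolding up_def row_def by blast
    then have "row y z" using squ_corner[OF q(3,2) ne(2)] by blast
    then show ?thesis using uy uz by blast
  qed
  \<comment> \<open>The row neighbours \<open>q1\<close> and \<open>q2\<close> of the apex
    \<open>p\<close> provide two quadrilaterals on \<open>vw\<close>, namely \<open>v w p q1\<close>
    and \<open>w v p q2\<close>.\<close>
  have rhombus: "\<exists>q1 q2. q1 \<noteq> q2 \<and> row p q1 \<and> row p q2 \<and> {v, q1} \<in> E \<and> {w, q2} \<in> E"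
    if t: "dn p v" "dn p w" "v \<noteq> w" for p v w
  proof -
    have "p \<in> V" using t(1) EV unfolding dn_def by blast
    from local[OF this] obtain n0 n1 n2 n3 n4 f0 f1 f2 f3 f4 where
      L: "distinct [n0, n1, n2, n3, n4]"
      "\<forall>t x. tri t p x \<longleftrightarrow> t = f0 \<and> (x = n0 \<or> x = n1) \<or> t = f1 \<and> (x = n1 \<or> x = n2) \<or> t = f2 \<and> (x = n2 \<or> x = n3)"
      "\<forall>x. row p x \<longleftrightarrow> x = n0 \<or> x = n3"
      "\<forall>x. dn p x \<longleftrightarrow> x = n1 \<or> x = n2" by (elim exE conjE)
    have "tri f0 p n0" "tri f0 p n1" "tri f2 p n2" "tri f2 p n3" using L(2) by auto
    moreover have "n1 \<noteq> n0" "n2 \<noteq> n3" using L(1) by auto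
    ultimately have "tri f0 n1 n0" "tri f2 n2 n3"
      using tri_closed[of f0 p n1 n0] tri_closed[of f2 p n2 n3] by simp_all
    then have e: "{n1, n0} \<in> E" "{n2, n3} \<in> E" using triE by blast+
    have r: "row p n0" "row p n3" "n0 \<noteq> n3" using L by auto
    have "v = n1 \<and> w = n2 \<or> v = n2 \<and> w = n1" using t L(4) by auto
    then show ?thesis using e r by metis
  qed
  define N where "N v = {x. row v x}" for v
  have N1: "\<forall>v\<in>V. N v \<subseteq> V - {v} \<and> card (N v) = 2"
  proof
    fix v assume v: "v \<in> V"
    from local[OF v] obtain n0 n1 n2 n3 n4 where
      L: "distinct [n0, n1, n2, n3, n4 :: 'v]" "\<forall>x. row v x \<longleftrightarrow> x = n0 \<or> x = n3" by (elim exE conjE)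
    then have "N v = {n0, n3}" "n0 \<noteq> n3" unfolding N_def by auto
    then have "card (N v) = 2" by simp
    moreover have "N v \<subseteq> V - {v}" using rowE EV unfolding N_def by blast
    ultimately show "N v \<subseteq> V - {v} \<and> card (N v) = 2" by blast
  qed
  have N2: "\<forall>u\<in>V. \<forall>v\<in>V. u \<in> N v \<longrightarrow> v \<in> N u" unfolding N_def using row_sym by blast
  obtain P where P: "finite P" "\<forall>c \<in> P. 3 \<le> length c \<and> distinct c"
    "\<forall>c \<in> P. \<forall>d \<in> P. c \<noteq> d \<longrightarrow> set c \<inter> set d = {}" "\<Union>(set ` P) = V"
    "\<Union>(cycle_edges ` P) = {{u, v} | u v. u \<in> V \<and> v \<in> N u}"
    using two_factor[OF finV N1 N2] by (elim exE conjE)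
  have in_set: "u \<in> set c \<and> v \<in> set c" if "{u, v} \<in> cycle_edges c" for u v :: 'v and c
    using that darts_subset[of c] by (auto simp: cycle_edges_darts uedge_def doubleton_eq_iff)
  have row_edge: "row u v" if c: "c \<in> P" "{u, v} \<in> cycle_edges c" for u v c
  proof -
    have "{u, v} \<in> {{u, v} | u v. u \<in> V \<and> v \<in> N u}" using c P(5) by blast
    then obtain a b where ab: "{u, v} = {a, b}" "row a b" unfolding N_def by blast
    then have "u = a \<and> v = b \<or> u = b \<and> v = a" by (auto simp: doubleton_eq_iff)
    then show ?thesis using ab(2) row_sym by blast
  qed
  have Pdisj: "c = d" if "c \<in> P" "d \<in> P" "x \<in> set c" "x \<in> set d" for c d x using P(3) that by blast
  have edge_in: "{u, v} \<in> cycle_edges c" if uv: "row u v" "c \<in> P" "u \<in> set c" for u v c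
  proof -
    have "u \<in> V" using rowE[OF uv(1)] EV by blast
    then have "{u, v} \<in> \<Union>(cycle_edges ` P)" unfolding P(5) N_def using uv(1) by blast
    then obtain d where d: "d \<in> P" "{u, v} \<in> cycle_edges d" by blast
    then have "d = c" using Pdisj uv(2,3) in_set[OF d(2)] by blast
    then show ?thesis using d by simp
  qed
  have row_in: "v \<in> set c" if "row u v" "c \<in> P" "u \<in> set c" for u v c
    using edge_in[OF that] in_set by blast
  have cover: "\<exists>c\<in>P. x \<in> set c" if "x \<in> V" for x using that P(4) by blast
  have ne: "c \<noteq> []" if "c \<in> P" for c using P(2) that by auto
  \<comment> \<open>Abstract form for both directions: if the \<open>r\<close>-neighbours of a
    vertex can be linked within a row, and those of row-adjacent vertices too, then all
    \<open>r\<close>-neighbours of a row lie in a single row. It is applied to \<open>up\<close> and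
    \<open>dn\<close>.\<close>
  have walk: "\<exists>d\<in>P. \<forall>v\<in>set c. \<forall>x. r v x \<longrightarrow> x \<in> set d"
    if c: "c \<in> P" and r: "\<And>v. v \<in> V \<Longrightarrow> \<exists>x. r v x" "\<And>v x y. r v x \<Longrightarrow> r v y \<Longrightarrow> x = y \<or> row x y"
      "\<And>v w. row v w \<Longrightarrow> \<exists>x y. r v x \<and> r w y \<and> (x = y \<or> row x y)" "\<And>v x. r v x \<Longrightarrow> x \<in> V" for c r
  proof -
    have hV: "hd c \<in> V" "hd c \<in> set c" using P(4) c ne[OF c] by auto
    obtain x0 where x0: "r (hd c) x0" using r(1)[OF hV(1)] by blast
    obtain d where d: "d \<in> P" "x0 \<in> set d" using cover r(4)[OF x0] by blast
    define p where "p v \<longleftrightarrow> (\<forall>x. r v x \<longrightarrow> x \<in> set d)" for v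
    have same: "x \<in> set d \<longleftrightarrow> y \<in> set d" if "r v x" "r v y" for v x y
      using r(2)[OF that] row_in[OF _ d(1)] row_sym by blast
    have pE: "p v \<longleftrightarrow> x \<in> set d" if "r v x" for v x using same that unfolding p_def by blast
    have "p v \<longleftrightarrow> p w" if vw: "{v, w} \<in> cycle_edges c" for v w
    proof -
      obtain x y where xy: "r v x" "r w y" "x = y \<or> row x y" using r(3)[OF row_edge[OF c vw]] by blast
      then have "x \<in> set d \<longleftrightarrow> y \<in> set d" using row_in[OF _ d(1)] row_sym by blast
      then show ?thesis using pE xy by simp
    qed
    moreover have "p (hd c)" using pE x0 d by simp
    ultimately have "p v" if "v \<in> set c" for v using cycle_connected[of c p "hd c" v] hV(2) that by blast
    then show ?thesis using d(1) unfolding p_def by blast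
  qed
  have walk_up: "\<exists>d\<in>P. \<forall>v\<in>set c. \<forall>x. up v x \<longrightarrow> x \<in> set d" if c: "c \<in> P" for c
  proof (rule walk[OF c])
    show "\<exists>x. up v x" if "v \<in> V" for v using up_unique[OF that] by blast
    show "x = y \<or> row x y" if "up v x" "up v y" for v x y
      using up_unique[of v] that EV unfolding up_def by blast
    show "\<exists>x y. up v x \<and> up w y \<and> (x = y \<or> row x y)" if "row v w" for v w using square[OF that] by blast
    show "x \<in> V" if "up v x" for v x using that EV unfolding up_def by blast
  qed
  have walk_dn: "\<exists>d\<in>P. \<forall>v\<in>set c. \<forall>x. dn v x \<longrightarrow> x \<in> set d" if c: "c \<in> P" for c
  proof (rule walk[OF c])
    show "\<exists>x. dn v x" if "v \<in> V" for v using dn_ex[OF that] .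
    show "x = y \<or> row x y" if "dn v x" "dn v y" for v x y using dn_row that by blast
    show "\<exists>x y. dn v x \<and> dn w y \<and> (x = y \<or> row x y)" if vw: "row v w" for v w
    proof -
      obtain t y where t: "tri t v w" "tri t v y" "dn v y" "y \<noteq> w" using row_tri[OF vw] by blast
      have "tri t w y" using tri_closed t by blast
      then have "dn w y" using tri_corner[of t w v y] t tri_sym row_sym vw EV unfolding dn_def by blast
      then show ?thesis using t(3) by blast
    qed
    show "x \<in> V" if "dn v x" for v x using that EV unfolding dn_def by blast
  qed
  define upc where "upc c = (SOME d. d \<in> P \<and> (\<forall>v\<in>set c. \<forall>x. up v x \<longrightarrow> x \<in> set d))" for c
  define dnc where "dnc c = (SOME d. d \<in> P \<and> (\<forall>v\<in>set c. \<forall>x. dn v x \<longrightarrow> x \<in> set d))" for c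
  have upc: "upc c \<in> P \<and> (\<forall>v\<in>set c. \<forall>x. up v x \<longrightarrow> x \<in> set (upc c))" if c: "c \<in> P" for c
  proof -
    have "\<exists>d. d \<in> P \<and> (\<forall>v\<in>set c. \<forall>x. up v x \<longrightarrow> x \<in> set d)" using walk_up[OF c] by blast
    then show ?thesis unfolding upc_def by (rule someI_ex)
  qed
  have dnc: "dnc c \<in> P \<and> (\<forall>v\<in>set c. \<forall>x. dn v x \<longrightarrow> x \<in> set (dnc c))" if c: "c \<in> P" for c
  proof -
    have "\<exists>d. d \<in> P \<and> (\<forall>v\<in>set c. \<forall>x. dn v x \<longrightarrow> x \<in> set d)" using walk_dn[OF c] by blast
    then show ?thesis unfolding dnc_def by (rule someI_ex)
  qed
  show ?thesis
  proof (rule merge_two_strips[of P V E upc dnc])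
    show "finite P" by (rule P(1))
    show cyc: "graph_cycle V E c" if c: "c \<in> P" for c
    proof -
      have "cycle_edges c \<subseteq> E"
      proof
        fix e assume e: "e \<in> cycle_edges c"
        then obtain u v where "e = {u, v}" unfolding cycle_edges_def by blast
        then show "e \<in> E" using row_edge[OF c] e rowE by simp
      qed
      moreover have "set c \<subseteq> V" using P(4) c by blast
      ultimately show ?thesis using P(2) c by (simp add: graph_cycle_def)
    qed
    show "set c \<inter> set d = {}" if "c \<in> P" "d \<in> P" "c \<noteq> d" for c d using P(3) that by blast
    show "V = \<Union>(set ` P)" using P(4) by simp
    show "V \<noteq> {}" by (rule Vne)
    \<comment> \<open>The relation \<open>up\<close> is symmetric, so the row reached from the
      partner shares the vertex \<open>hd c\<close> with \<open>c\<close>; rows that meet are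
      equal.\<close>
    show "upc c \<in> P \<and> upc (upc c) = c" if c: "c \<in> P" for c
    proof -
      have h: "hd c \<in> set c" "hd c \<in> V" using ne[OF c] c P(4) by auto
      obtain x where x: "up (hd c) x" using up_unique[OF h(2)] by blast
      have xs: "x \<in> set (upc c)" using upc[OF c] h x by blast
      have "up x (hd c)" using x up_sym by blast
      then have "hd c \<in> set (upc (upc c))" using upc[of "upc c"] upc[OF c] xs by blast
      then show ?thesis using Pdisj[of "upc (upc c)" c "hd c"] upc[OF c] upc[of "upc c"] c h by blast
    qed
    show "dnc c \<in> P \<and> dnc (dnc c) = c" if c: "c \<in> P" for c
    proof -
      have h: "hd c \<in> set c" "hd c \<in> V" using ne[OF c] c P(4) by auto
      obtain x where x: "dn (hd c) x" using dn_ex[OF h(2)] by blast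
      have xs: "x \<in> set (dnc c)" using dnc[OF c] h x by blast
      have "dn x (hd c)" using x dn_sym by blast
      then have "hd c \<in> set (dnc (dnc c))" using dnc[of "dnc c"] dnc[OF c] xs by blast
      then show ?thesis using Pdisj[of "dnc (dnc c)" c "hd c"] dnc[OF c] dnc[of "dnc c"] c h by blast
    qed
    show "\<exists>a b c d. {a, b} \<in> cycle_edges x \<and> {c, d} \<in> cycle_edges (upc x) \<and> {b, c} \<in> E \<and> {d, a} \<in> E"
      if x: "x \<in> P" for x
    proof -
      obtain e where e: "e \<in> cycle_edges x" using two_cycle_edges[OF cyc[OF x]] by blast
      then obtain v w where vw: "{v, w} \<in> cycle_edges x" unfolding cycle_edges_def by blast
      obtain y z where yz: "up v y" "up w z" "row y z" using square[OF row_edge[OF x vw]] by blast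
      have "z \<in> set (upc x)" using upc[OF x] yz(2) in_set[OF vw] by blast
      then have "{z, y} \<in> cycle_edges (upc x)" using edge_in[of z y] upc[OF x] yz(3) row_sym by blast
      moreover have "{w, z} \<in> E" "{y, v} \<in> E" using yz E_sym unfolding up_def by blast+
      ultimately show ?thesis using vw by blast
    qed
    show "\<exists>a b c d. {a, b} \<in> cycle_edges x - {e} \<and> {c, d} \<in> cycle_edges (dnc x) - {e'} \<and> {b, c} \<in> E \<and> {d, a} \<in> E"
      if x: "x \<in> P" for x e e'
    proof -
      obtain e1 where e: "e1 \<in> cycle_edges x" "e1 \<noteq> e" using two_cycle_edges[OF cyc[OF x]] by blast
      then obtain v w where vw': "e1 = {v, w}" unfolding cycle_edges_def by blast
      have vw: "{v, w} \<in> cycle_edges x" "{v, w} \<noteq> e" using e vw' by simp_all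
      have r: "row v w" using row_edge[OF x vw(1)] .
      obtain t p where t: "tri t v w" "tri t v p" "dn v p" "p \<noteq> w" using row_tri[OF r] by blast
      have "tri t w p" using tri_closed t by blast
      then have wp: "dn w p" using tri_corner[of t w v p] t tri_sym row_sym r EV unfolding dn_def by blast
      have vnw: "v \<noteq> w" using EV[OF rowE[OF r]] by blast
      obtain q1 q2 where q: "q1 \<noteq> q2" "row p q1" "row p q2" "{v, q1} \<in> E" "{w, q2} \<in> E"
        using rhombus[of p v w] t(3) wp dn_sym vnw by blast
      have ps: "p \<in> set (dnc x)" using dnc[OF x] t(3) in_set[OF vw(1)] by blast
      have dP: "dnc x \<in> P" using dnc[OF x] by blast
      have q': "{q1, p} \<in> cycle_edges (dnc x)" "{q2, p} \<in> cycle_edges (dnc x)"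
        using edge_in[OF q(2) dP ps] edge_in[OF q(3) dP ps] by (simp_all add: insert_commute)
      have pE: "{p, w} \<in> E" "{p, v} \<in> E" using t(3) wp E_sym unfolding dn_def by blast+
      \<comment> \<open>The edges \<open>q1 p\<close> and \<open>q2 p\<close> differ, so one of them
        is not \<open>e'\<close>; the row edge \<open>vw\<close> was already chosen different from
        \<open>e\<close>.\<close>
      show ?thesis
      proof (cases "{q1, p} = e'")
        case False
        have "{w, v} \<in> cycle_edges x - {e}" using vw by (simp add: insert_commute)
        then show ?thesis using q' False q pE by blast
      next
        case True
        then have "{q2, p} \<noteq> e'" using q(1) by (auto simp: doubleton_eq_iff)
        then show ?thesis using q' vw q pE by blast
      qed
    qed
    show "\<exists>x\<in>A. upc x \<notin> A \<or> dnc x \<notin> A" if A: "A \<subseteq> P" "A \<noteq> {}" "A \<noteq> P" for A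
    proof -
      \<comment> \<open>Connectedness of the graph passes to the rows: an edge leaving the vertices
        of \<open>A\<close> is no row edge, so it goes up or down to the partner of a row of
        \<open>A\<close>.\<close>
      define U where "U = \<Union>(set ` A)"
      have inU: "x \<in> U \<longleftrightarrow> c \<in> A" if c: "c \<in> P" "x \<in> set c" for c x
        using c A(1) Pdisj unfolding U_def by blast
      have hds: "hd c \<in> set c" if "c \<in> P" for c using ne[OF that] by simp
      have "U \<subseteq> V" using A(1) P(4) unfolding U_def by blast
      moreover have "U \<noteq> {}" using A(1,2) hds unfolding U_def by blast
      moreover have "U \<noteq> V"
      proof -
        obtain c where c: "c \<in> P" "c \<notin> A" using A(1,3) by blast
        then have "hd c \<notin> U" "hd c \<in> V" using inU[OF c(1) hds[OF c(1)]] hds P(4) by blast+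
        then show ?thesis by blast
      qed
      ultimately have "\<exists>u\<in>U. \<exists>w\<in>V - U. {u, w} \<in> E" by (rule conn)
      then obtain u w where uw: "u \<in> U" "w \<in> V" "w \<notin> U" "{u, w} \<in> E" by blast
      obtain c where c: "c \<in> A" "u \<in> set c" using uw(1) unfolding U_def by blast
      have cP: "c \<in> P" using c(1) A(1) by blast
      have "\<not> row u w" using row_in[OF _ cP c(2)] inU[OF cP] c(1) uw(3) by blast
      then consider "up u w" | "dn u w" using kinds[OF uw(4)] by blast
      then show ?thesis
      proof cases
        case 1
        then have "w \<in> set (upc c)" using upc[OF cP] c(2) by blast
        then have "upc c \<notin> A" using inU upc[OF cP] uw(3) by blast
        then show ?thesis using c(1) by blast
      next
        case 2
        then have "w \<in> set (dnc c)" using dnc[OF cP] c(2) by blast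
        then have "dnc c \<notin> A" using inU dnc[OF cP] uw(3) by blast
        then show ?thesis using c(1) by blast
      qed
    qed
  qed
qed

text \<open>Every vertex has one edge \<open>m\<close> between two triangles and lies on two
  squares. Directions tell the squares apart: exactly one of them leaves the vertex along its side
  next to \<open>m\<close>. The choice agrees at all four corners of a square, so the chosen squares
  cover the vertices disjointly. The quadrilaterals consist of the two triangles on an
  \<open>m\<close> edge.\<close>

lemma hamiltonian_33434:
  assumes as: "as = [3, 3, 4, 3, 4]"
  shows "hamiltonian V E"
proof -
  define tri where "tri t u v \<longleftrightarrow> sz t = 3 \<and> ed t u v" for t u v
  define squ where "squ t u v \<longleftrightarrow> sz t = 4 \<and> ed t u v" for t u v
  have tri_sym: "tri t u v \<longleftrightarrow> tri t v u" for t u v unfolding tri_def using ed_comm by blast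
  have squ_sym: "squ t u v \<longleftrightarrow> squ t v u" for t u v unfolding squ_def using ed_comm by blast
  define m where "m u v \<longleftrightarrow> {u, v} \<in> E \<and> \<not> (\<exists>s. squ s u v)" for u v
  have m_sym: "m u v \<longleftrightarrow> m v u" for u v unfolding m_def using squ_sym E_sym by blast
  have EV: "u \<in> V \<and> v \<in> V \<and> u \<noteq> v" if "{u, v} \<in> E" for u v
    using edgeE[OF that] by (auto simp: doubleton_eq_iff)
  have triE: "{u, v} \<in> E" if "tri t u v" for t u v using that ed_E(1) unfolding tri_def by blast
  have squE: "{u, v} \<in> E" if "squ t u v" for t u v using that ed_E(1) unfolding squ_def by blast
  have tri_closed: "tri t x y" if "tri t v x" "tri t v y" "x \<noteq> y" for t v x y
    using that triangle_closed unfolding tri_def by blast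
  \<comment> \<open>Listed so that the directed square \<open>g\<close> leaves \<open>v\<close> towards \<open>p\<close>, next to the edge
    \<open>vz\<close> shared by two triangles: so \<open>pl g v p\<close> holds below, and \<open>s\<close> is the other square.\<close>
  have local: "\<exists>p q z y x g s t1 t0 t2. distinct [p, q, z, y, x] \<and> distinct [g, s, t1, t0, t2] \<and>
      (\<forall>w. {v, w} \<in> E \<longleftrightarrow> w \<in> {p, q, z, y, x}) \<and>
      (\<forall>t w. tri t v w \<longleftrightarrow> t = t1 \<and> (w = p \<or> w = z) \<or> t = t0 \<and> (w = z \<or> w = y) \<or> t = t2 \<and> (w = x \<or> w = q)) \<and>
      (\<forall>f w. squ f v w \<longleftrightarrow> f = g \<and> (w = p \<or> w = q) \<or> f = s \<and> (w = y \<or> w = x)) \<and>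
      (\<forall>w. m v w \<longleftrightarrow> w = z) \<and> dd g v p \<and> \<not> dd g v q \<and> dd s v x \<and> \<not> dd s v y"
    if v: "v \<in> V" for v
  proof -
    obtain n0 n1 n2 n3 n4 f0 f1 f2 f3 f4 where s: "distinct [n0, n1, n2, n3, n4]" "distinct [f0, f1, f2, f3, f4]"
      "sz f0 = 3 \<and> sz f1 = 3 \<and> sz f2 = 4 \<and> sz f3 = 3 \<and> sz f4 = 4" "\<forall>x. {v, x} \<in> E \<longleftrightarrow> x \<in> {n0, n1, n2, n3, n4}"
      "\<forall>f x. ed f v x \<longleftrightarrow> f = f0 \<and> x \<in> {n0, n1} \<or> f = f1 \<and> x \<in> {n1, n2} \<or> f = f2 \<and> x \<in> {n2, n3}
        \<or> f = f3 \<and> x \<in> {n3, n4} \<or> f = f4 \<and> x \<in> {n4, n0}"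
      using star5[OF v as] by (elim exE conjE) blast
    have 3: "\<forall>t x. tri t v x \<longleftrightarrow> t = f0 \<and> (x = n0 \<or> x = n1) \<or> t = f1 \<and> (x = n1 \<or> x = n2) \<or> t = f3 \<and> (x = n3 \<or> x = n4)"
      using s(3,5) unfolding tri_def by auto
    have 4: "\<forall>t x. squ t v x \<longleftrightarrow> t = f2 \<and> (x = n2 \<or> x = n3) \<or> t = f4 \<and> (x = n4 \<or> x = n0)"
      using s(3,5) unfolding squ_def by auto
    have m: "\<forall>x. m v x \<longleftrightarrow> x = n1" using s(1,4) 4 unfolding m_def by auto
    have e: "ed f0 v n0" "ed f0 v n1" "ed f1 v n1" "ed f1 v n2" "ed f2 v n2" "ed f2 v n3" "ed f4 v n4" "ed f4 v n0"
      using s(5) by auto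
    have ne: "n0 \<noteq> n1" "n1 \<noteq> n2" "n2 \<noteq> n3" "n4 \<noteq> n0" "f0 \<noteq> f1" "f1 \<noteq> f2" "f0 \<noteq> f4" using s(1,2) by auto
    \<comment> \<open>Five reversals lead from \<open>f2\<close> across the two triangles at the
      \<open>m\<close> edge to \<open>f4\<close>; the number is odd, so exactly one of the two
      squares leaves \<open>v\<close> beside \<open>m\<close>.\<close>
    have "dd f2 v n2 \<longleftrightarrow> \<not> dd f1 v n2" using edge_orient[OF e(5,4)] ne by blast
    moreover have "dd f1 v n2 \<longleftrightarrow> \<not> dd f1 v n1" using corner_orient[OF e(4,3)] ne by blast
    moreover have "dd f1 v n1 \<longleftrightarrow> \<not> dd f0 v n1" using edge_orient[OF e(3,2)] ne by blast
    moreover have "dd f0 v n1 \<longleftrightarrow> \<not> dd f0 v n0" using corner_orient[OF e(2,1)] ne by blast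
    moreover have "dd f0 v n0 \<longleftrightarrow> \<not> dd f4 v n0" using edge_orient[OF e(1,8)] ne by blast
    ultimately have o: "dd f2 v n2 \<longleftrightarrow> \<not> dd f4 v n0" by blast
    have o2: "dd f2 v n2 \<longleftrightarrow> \<not> dd f2 v n3" using corner_orient[OF e(5,6)] ne by blast
    have o4: "dd f4 v n4 \<longleftrightarrow> \<not> dd f4 v n0" using corner_orient[OF e(7,8)] ne by blast
    show ?thesis
    proof (cases "dd f2 v n2")
      case True
      have d: "distinct [n2, n3, n1, n0, n4]" "distinct [f2, f4, f1, f0, f3]" using s(1,2) by auto
      show ?thesis
        by (rule exI[of _ n2], rule exI[of _ n3], rule exI[of _ n1], rule exI[of _ n0], rule exI[of _ n4],
          rule exI[of _ f2], rule exI[of _ f4], rule exI[of _ f1], rule exI[of _ f0], rule exI[of _ f3])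
          (use d s(4) 3 4 m True o o2 o4 in auto)
    next
      case False
      have d: "distinct [n0, n4, n1, n2, n3]" "distinct [f4, f2, f0, f1, f3]" using s(1,2) by auto
      show ?thesis
        by (rule exI[of _ n0], rule exI[of _ n4], rule exI[of _ n1], rule exI[of _ n2], rule exI[of _ n3],
          rule exI[of _ f4], rule exI[of _ f2], rule exI[of _ f0], rule exI[of _ f1], rule exI[of _ f3])
          (use d s(4) 3 4 m False o o2 o4 in auto)
    qed
  qed
  \<comment> \<open>The chosen class of squares: \<open>g\<close> leaves \<open>a\<close> along a
    side of one of the triangles on the \<open>m\<close> edge of \<open>a\<close>.\<close>
  define pl where "pl g a b \<longleftrightarrow> squ g a b \<and> dd g a b \<and> (\<exists>t z. tri t a b \<and> tri t a z \<and> m a z)" for g a b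
  have pl_sq: "squ g a b" "dd g a b" "a \<in> V" "b \<in> V" if "pl g a b" for g a b
    using that squE EV unfolding pl_def by blast+
  \<comment> \<open>The triangle on \<open>ab\<close> contains the \<open>m\<close> edge of
    \<open>a\<close>, which ends in its third corner; so it has no \<open>m\<close> edge at
    \<open>b\<close> and is the isolated triangle there. Of the two squares that border it at
    \<open>b\<close>, the one entering along it is the chosen one.\<close>
  have propagate: "pl g b c" if pl: "pl g a b" and bc: "dd g b c" for g a b c
  proof -
    obtain t z0 where t: "tri t a b" "tri t a z0" "m a z0" using pl unfolding pl_def by blast
    have sq: "squ g a b" "dd g a b" and bV: "b \<in> V" using pl_sq[OF pl] by simp_all
    have "z0 \<noteq> b" using t(3) sq(1) unfolding m_def by blast
    then have t': "tri t b a" "tri t b z0" using t(1,2) tri_closed[of t a b z0] tri_sym by blast+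
    have "a \<noteq> b" "z0 \<in> V" using EV[OF triE[OF t(1)]] EV[OF triE[OF t(2)]] by simp_all
    have ma: "\<not> m b a" using sq(1) squ_sym unfolding m_def by blast
    have mz: "\<not> m b z0"
    proof
      assume "m b z0"
      then have "m z0 b" "m z0 a" using t(3) m_sym by blast+
      moreover from local[OF \<open>z0 \<in> V\<close>] obtain z where "\<forall>w. m z0 w \<longleftrightarrow> w = z" by (elim exE conjE)
      ultimately show False using \<open>a \<noteq> b\<close> by simp
    qed
    from local[OF bV] obtain p q z y x g' s t1 t0 t2 where L: "distinct [p, q, z, y, x]" "distinct [g', s, t1, t0, t2]"
      "\<forall>t w. tri t b w \<longleftrightarrow> t = t1 \<and> (w = p \<or> w = z) \<or> t = t0 \<and> (w = z \<or> w = y) \<or> t = t2 \<and> (w = x \<or> w = q)"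
      "\<forall>f w. squ f b w \<longleftrightarrow> f = g' \<and> (w = p \<or> w = q) \<or> f = s \<and> (w = y \<or> w = x)"
      "\<forall>w. m b w \<longleftrightarrow> w = z" "dd g' b p" "dd s b x" by (elim exE conjE)
    have "a \<noteq> z0" using EV[OF triE[OF t(2)]] by simp
    then have "a = x \<or> a = q" using t' L(1,2,3,5) ma mz by auto
    moreover have "squ g b a" using sq squ_sym by blast
    moreover have "\<not> dd g b a" using dd_asym[OF sq(2)] .
    ultimately have g: "g = g'" using L(1,2,4,7) by auto
    then have c: "c = p" using dd_out bc L(6) by blast
    have "tri t1 b p" "tri t1 b z" "m b z" "squ g b p" using L(3,4,5) g by simp_all
    then show ?thesis using bc c unfolding pl_def by blast
  qed
  have pl_local: "\<exists>p q z y x g s t1 t0 t2. distinct [p, q, z, y, x] \<and> distinct [g, s, t1, t0, t2] \<and>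
      (\<forall>w. {v, w} \<in> E \<longleftrightarrow> w \<in> {p, q, z, y, x}) \<and>
      (\<forall>t w. tri t v w \<longleftrightarrow> t = t1 \<and> (w = p \<or> w = z) \<or> t = t0 \<and> (w = z \<or> w = y) \<or> t = t2 \<and> (w = x \<or> w = q)) \<and>
      (\<forall>f w. squ f v w \<longleftrightarrow> f = g \<and> (w = p \<or> w = q) \<or> f = s \<and> (w = y \<or> w = x)) \<and>
      (\<forall>w. m v w \<longleftrightarrow> w = z) \<and> dd g v p \<and> \<not> dd g v q \<and> dd s v x \<and> \<not> dd s v y \<and>
      (\<forall>f w. pl f v w \<longleftrightarrow> f = g \<and> w = p)"
    if v: "v \<in> V" for v
  proof -
    from local[OF v] obtain p q z y x g s t1 t0 t2 where L: "distinct [p, q, z, y, x]" "distinct [g, s, t1, t0, t2]"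
      "\<forall>w. {v, w} \<in> E \<longleftrightarrow> w \<in> {p, q, z, y, x}"
      "\<forall>t w. tri t v w \<longleftrightarrow> t = t1 \<and> (w = p \<or> w = z) \<or> t = t0 \<and> (w = z \<or> w = y) \<or> t = t2 \<and> (w = x \<or> w = q)"
      "\<forall>f w. squ f v w \<longleftrightarrow> f = g \<and> (w = p \<or> w = q) \<or> f = s \<and> (w = y \<or> w = x)"
      "\<forall>w. m v w \<longleftrightarrow> w = z" "dd g v p" "\<not> dd g v q" "dd s v x" "\<not> dd s v y" by (elim exE conjE)
    have *: "\<forall>f w. pl f v w \<longleftrightarrow> f = g \<and> w = p"
    proof (intro allI iffI)
      fix f w assume "pl f v w"
      then have a: "squ f v w" "dd f v w" and "\<exists>t z. tri t v w \<and> tri t v z \<and> m v z" unfolding pl_def by blast+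
      then obtain t z' where "tri t v w" "tri t v z'" "m v z'" by blast
      then have t: "tri t v w" "tri t v z" using L(6) by simp_all
      have "w \<noteq> q" "w \<noteq> x" using t L(1,2,4) by auto
      moreover have "f = s \<and> w = y \<Longrightarrow> False" using a L(10) by blast
      ultimately show "f = g \<and> w = p" using a(1) L(5) by blast
    next
      fix f w assume f: "f = g \<and> w = p"
      have "tri t1 v p" "tri t1 v z" "m v z" "squ g v p" using L(4,5,6) by simp_all
      then show "pl f v w" using f L(7) unfolding pl_def by blast
    qed
    show ?thesis
      by (rule exI[of _ p], rule exI[of _ q], rule exI[of _ z], rule exI[of _ y], rule exI[of _ x],
        rule exI[of _ g], rule exI[of _ s], rule exI[of _ t1], rule exI[of _ t0], rule exI[of _ t2])
        (intro conjI L *)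
  qed
  \<comment> \<open>Carried through both triangles on the \<open>m\<close> edge \<open>vz\<close>,
    the direction of \<open>g\<close> along \<open>vp\<close> fixes that of \<open>g'\<close> along
    \<open>zy\<close>. Hence both sides \<open>vp\<close> and \<open>zy\<close> of the quadrilateral
    \<open>v p z y\<close> lie on chosen squares.\<close>
  have next_quad: "pl g' z y"
    if pl: "pl g v p" and mz: "m v z" and t: "tri t1 v p" "tri t1 v z" "t0 \<noteq> t1" "tri t0 v z" "tri t0 v y" "y \<noteq> z"
      and g': "squ g' z y" for g g' v p z y t1 t0
  proof -
    have e: "ed g v p" "ed t1 v p" "ed t1 v z" "ed t0 v z" "ed t0 v y" "ed g' z y" "g \<noteq> t1" "g' \<noteq> t0"
      using pl_sq(1)[OF pl] t g' unfolding tri_def squ_def by auto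
    have "p \<noteq> z" using pl_sq(1)[OF pl] mz unfolding m_def by blast
    have zy: "tri t0 z y" using tri_closed[OF t(4,5)] t(6) by simp
    have ezy: "ed t0 z y" "ed t0 z v" using zy e(4) ed_sym unfolding tri_def by blast+
    have "y \<noteq> v" using EV[OF triE[OF t(5)]] by blast
    have "\<not> dd t1 v p" using edge_orient[OF e(1,2,7)] pl_sq(2)[OF pl] by blast
    then have "dd t1 v z" using corner_orient[OF e(3,2)] \<open>p \<noteq> z\<close> by blast
    then have "\<not> dd t0 v z" using edge_orient[OF e(4,3)] t(3) by blast
    then have "dd t0 z v" using e(4) unfolding ed_dd by blast
    then have "\<not> dd t0 z y" using corner_orient[OF ezy] \<open>y \<noteq> v\<close> by blast
    then have dg: "dd g' z y" using edge_orient[OF e(6) ezy(1) e(8)] by blast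
    have "m z v" using mz m_sym by blast
    moreover have "tri t0 z v" using t(4) tri_sym by blast
    ultimately show ?thesis using g' dg zy unfolding pl_def by blast
  qed
  define Q where "Q a b c d \<longleftrightarrow> (\<exists>g. pl g a b) \<and> (\<exists>g. pl g c d) \<and> m a c \<and> {b, c} \<in> E \<and> {d, a} \<in> E" for a b c d
  have Q_sym: "Q c d a b" if "Q a b c d" for a b c d
    using that m_sym unfolding Q_def by blast
  have pl_unique: "g = g' \<and> b = b'" if "pl g a b" "pl g' a b'" for g g' a b b'
  proof -
    have "a \<in> V" using pl_sq(3)[OF that(1)] .
    from pl_local[OF this] obtain p h where "\<forall>f w. pl f a w \<longleftrightarrow> f = h \<and> w = p" by (elim exE conjE)
    then show ?thesis using that by simp
  qed
  have pl_asym: "\<not> pl g' b a" if pl: "pl g a b" for g g' a b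
  proof
    assume pl': "pl g' b a"
    have "a \<in> V" using pl_sq(3)[OF pl] .
    from pl_local[OF this] obtain p q z y x h s where L: "distinct [p, q, z, y, x]"
      "\<forall>f w. squ f a w \<longleftrightarrow> f = h \<and> (w = p \<or> w = q) \<or> f = s \<and> (w = y \<or> w = x)"
      "\<forall>f w. pl f a w \<longleftrightarrow> f = h \<and> w = p" by (elim exE conjE)
    have "g = h" "b = p" "squ g' a b" using L(3) pl pl_sq(1)[OF pl'] squ_sym by blast+
    then have "g' = g" using L(1,2) by auto
    then show False using pl_sq(2)[OF pl] pl_sq(2)[OF pl'] dd_asym by blast
  qed
  have m_unique: "c = c'" if "m a c" "m a c'" for a c c'
  proof -
    have "a \<in> V" using that(1) EV unfolding m_def by blast
    from pl_local[OF this] obtain z where "\<forall>w. m a w \<longleftrightarrow> w = z" by (elim exE conjE)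
    then show ?thesis using that by simp
  qed
  have Q_unique: "a = a' \<and> b = b' \<and> c = c' \<and> d = d'" if q: "Q a b c d" "Q a' b' c' d'" "{a, b} = {a', b'}"
    for a b c d a' b' c' d'
  proof -
    have "a = a' \<and> b = b' \<or> a = b' \<and> b = a'" using q(3) by (auto simp: doubleton_eq_iff)
    then have ab: "a = a'" "b = b'" using q(1,2) pl_asym unfolding Q_def by blast+
    then have "c = c'" using q(1,2) m_unique unfolding Q_def by blast
    then have "d = d'" using q(1,2) pl_unique unfolding Q_def by blast
    then show ?thesis using ab \<open>c = c'\<close> by simp
  qed
  define G where "G = {g. \<exists>a b. pl g a b}"
  have G_iff: "g \<in> G \<and> v \<in> set (cyc g) \<longleftrightarrow> (\<exists>w. pl g v w)" for g v
  proof
    assume g: "g \<in> G \<and> v \<in> set (cyc g)"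
    then obtain a b where ab: "pl g a b" unfolding G_def by blast
    have "squ g a b" "dd g a b" using pl_sq[OF ab] by simp_all
    then have s4: "sz g = 4" "dd g a b" "g \<in> F" unfolding squ_def using ed_E(5) by blast+
    obtain c d where cd: "\<forall>x y. dd g x y \<longleftrightarrow> (x, y) \<in> {(a, b), (b, c), (c, d), (d, a)}"
      using dfour_ex[OF s4(1,2)] by (elim exE conjE)
    have bc: "pl g b c" using propagate[OF ab] cd by simp
    have cd': "pl g c d" using propagate[OF bc] cd by simp
    have da: "pl g d a" using propagate[OF cd'] cd by simp
    obtain x where "ed g v x" using mem_ed[OF s4(3)] g by blast
    then have "v = a \<or> v = b \<or> v = c \<or> v = d" unfolding ed_dd using cd by auto
    then show "\<exists>w. pl g v w" using ab bc cd' da by blast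
  next
    assume "\<exists>w. pl g v w"
    then obtain w where w: "pl g v w" by blast
    then show "g \<in> G \<and> v \<in> set (cyc g)" using pl_sq(1)[OF w] ed_E(6) unfolding G_def squ_def by blast
  qed
  have GF: "G \<subseteq> F" unfolding G_def using pl_sq(1) ed_E(5) unfolding squ_def by blast
  show ?thesis
  proof (rule face_merge[of G Q])
    show "G \<subseteq> F" by (rule GF)
    show "\<forall>v\<in>V. \<exists>!f. f \<in> G \<and> v \<in> set (cyc f)"
    proof
      fix v assume v: "v \<in> V"
      from pl_local[OF v] obtain p h where "\<forall>f w. pl f v w \<longleftrightarrow> f = h \<and> w = p" by (elim exE conjE)
      then have "f \<in> G \<and> v \<in> set (cyc f) \<longleftrightarrow> f = h" for f unfolding G_iff by blast
      then show "\<exists>!f. f \<in> G \<and> v \<in> set (cyc f)" by simp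
    qed
    have plG: "\<exists>f\<in>G. ed f x y" if "\<exists>g. pl g x y" for x y
      using that pl_sq(1) unfolding squ_def G_def by blast
    show "(\<exists>f\<in>G. ed f a b) \<and> (\<exists>f\<in>G. ed f c d) \<and> {b, c} \<in> E \<and> {d, a} \<in> E" if Q: "Q a b c d" for a b c d
      using Q plG unfolding Q_def by blast
    show "{{a, b}, {c, d}} = {{a', b'}, {c', d'}}"
      if q: "Q a b c d" "Q a' b' c' d'" "{{a, b}, {c, d}} \<inter> {{a', b'}, {c', d'}} \<noteq> {}" for a b c d a' b' c' d'
    proof -
      consider "{a, b} = {a', b'}" | "{a, b} = {c', d'}" | "{c, d} = {a', b'}" | "{c, d} = {c', d'}"
        using q(3) by (auto simp only: insert_iff empty_iff Int_iff)
      then show ?thesis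
      proof cases
        case 1
        then show ?thesis using Q_unique[OF q(1,2)] by simp
      next
        case 2
        then show ?thesis using Q_unique[OF q(1) Q_sym[OF q(2)]] by auto
      next
        case 3
        then show ?thesis using Q_unique[OF Q_sym[OF q(1)] q(2)] by auto
      next
        case 4
        then show ?thesis using Q_unique[OF Q_sym[OF q(1)] Q_sym[OF q(2)]] by simp
      qed
    qed
    show "\<exists>a b c d. Q a b c d \<and> (a \<in> U \<longleftrightarrow> c \<notin> U)"
      if uw: "{u, w} \<in> E" "u \<in> U" "w \<notin> U" and cl: "\<forall>f\<in>G. \<forall>x y. ed f x y \<longrightarrow> (x \<in> U \<longleftrightarrow> y \<in> U)" for U u w
    proof (rule ccontr)
      assume no: "\<not> ?thesis"
      \<comment> \<open>If nothing crosses, \<open>v\<close> is on the same side as its neighbours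
        on the chosen square, the other end \<open>z\<close> of its \<open>m\<close> edge, and
        \<open>y\<close>. The only remaining edge goes to \<open>x\<close>; along it the other
        square leaves \<open>v\<close>.\<close>
      have step: "(v \<in> U \<longleftrightarrow> w \<in> U) \<or> (\<exists>s. squ s v w \<and> dd s v w \<and> s \<notin> G)" if vw: "{v, w} \<in> E" for v w
      proof -
        have v: "v \<in> V" using EV[OF vw] by simp
        from pl_local[OF v] obtain p q z y x g s t1 t0 t2 where L: "distinct [p, q, z, y, x]" "distinct [g, s, t1, t0, t2]"
          "\<forall>w. {v, w} \<in> E \<longleftrightarrow> w \<in> {p, q, z, y, x}"
          "\<forall>t w. tri t v w \<longleftrightarrow> t = t1 \<and> (w = p \<or> w = z) \<or> t = t0 \<and> (w = z \<or> w = y) \<or> t = t2 \<and> (w = x \<or> w = q)"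
          "\<forall>f w. squ f v w \<longleftrightarrow> f = g \<and> (w = p \<or> w = q) \<or> f = s \<and> (w = y \<or> w = x)"
          "\<forall>w. m v w \<longleftrightarrow> w = z" "dd s v x" "\<forall>f w. pl f v w \<longleftrightarrow> f = g \<and> w = p" by (elim exE conjE)
        have gG: "g \<in> G" unfolding G_def using L(8) by blast
        have sG: "s \<notin> G"
        proof
          assume "s \<in> G"
          moreover have "v \<in> set (cyc s)" using L(5) ed_E(6) unfolding squ_def by blast
          ultimately have "\<exists>w. pl s v w" using G_iff by blast
          then show False using L(2,8) by auto
        qed
        have "squ g v p" "squ g v q" using L(5) by simp_all
        then have p: "v \<in> U \<longleftrightarrow> p \<in> U" and q: "v \<in> U \<longleftrightarrow> q \<in> U" using cl gG unfolding squ_def by blast+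
        have t: "tri t1 v p" "tri t1 v z" "tri t0 v z" "tri t0 v y" using L(4) by simp_all
        have pz: "p \<noteq> z" "y \<noteq> z" "t0 \<noteq> t1" using L(1,2) by auto
        have mz: "m v z" and plp: "pl g v p" using L(6,8) by simp_all
        have zy: "tri t0 z y" using tri_closed[OF t(3,4)] pz by simp
        have zV: "z \<in> V" using EV[OF triE[OF zy]] by simp
        have "\<exists>g'. squ g' z y"
        proof (rule ccontr)
          assume "\<not> ?thesis"
          then have "m z y" using triE[OF zy] unfolding m_def by blast
          moreover have "m z v" using mz m_sym by blast
          ultimately show False using m_unique EV[OF triE[OF t(4)]] by blast
        qed
        then obtain g' where g': "squ g' z y" by blast
        have plz: "pl g' z y" using next_quad[OF plp mz t(1,2) pz(3) t(3,4) pz(2) g'] .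
        have "{p, z} \<in> E" using triE[OF tri_closed[OF t(1,2) pz(1)]] .
        moreover have "{y, v} \<in> E" using triE[OF t(4)] E_sym by blast
        ultimately have "Q v p z y" unfolding Q_def using plp plz mz by blast
        then have z: "v \<in> U \<longleftrightarrow> z \<in> U" using no by blast
        have "z \<in> U \<longleftrightarrow> y \<in> U" using cl plG[of z y] plz by blast
        then have y: "v \<in> U \<longleftrightarrow> y \<in> U" using z by blast
        have x: "squ s v x \<and> dd s v x \<and> s \<notin> G" using L(5,7) sG by simp
        have "w = p \<or> w = q \<or> w = z \<or> w = y \<or> w = x" using L(3) vw by auto
        then show ?thesis using p q z y x by blast
      qed
      obtain s where s: "squ s u w" "dd s u w" "s \<notin> G" using step[OF uw(1)] uw by blast
      have "{w, u} \<in> E" using uw(1) E_sym by blast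
      then obtain s' where s': "squ s' w u" "dd s' w u" "s' \<notin> G" using step[of w u] uw by blast
      \<comment> \<open>Seen from its two ends, the crossing edge is run through in both directions
        by squares outside \<open>G\<close>. They differ, but an edge lies on at most one
        square.\<close>
      have "s \<noteq> s'" using s(2) s'(2) dd_asym by blast
      have uV: "u \<in> V" using EV[OF uw(1)] by simp
      from pl_local[OF uV] obtain p q z y x g r where L: "distinct [p, q, z, y, x]"
        "\<forall>f w. squ f u w \<longleftrightarrow> f = g \<and> (w = p \<or> w = q) \<or> f = r \<and> (w = y \<or> w = x)" by (elim exE conjE)
      have "squ s' u w" using s'(1) squ_sym by blast
      then show False using s(1) \<open>s \<noteq> s'\<close> L by auto
    qed
  qed
qed

end

section \<open>Quotients of the trihexagonal tiling\<close>

lemma insert_vertex: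
  assumes "graph_cycle V E c" "{a, b} \<in> cycle_edges c" "v \<in> V" "v \<notin> set c" "{a, v} \<in> E" "{v, b} \<in> E"
  obtains c' where "graph_cycle V E c'" "set c' = insert v (set c)"
proof -
  have d: "distinct c" using assms(1) by (simp add: graph_cycle_def)
  obtain c' where c': "cycle_edges c' = cycle_edges c" "set c' = set c" "length c' = length c"
    "distinct c'" "c' \<noteq> []" "hd c' = b" "last c' = a"
    using rotate_to_edge[OF assms(2) d] by blast
  have "cycle_edges (c' @ [v]) = uedge ` steps c' \<union> {{a, v}, {v, b}}"
    using c'(5,6,7) by (simp add: cycle_edges_nonempty_conv steps_append image_Un) blast
  moreover have "uedge ` steps c' \<subseteq> E"
    using c'(1,5) assms(1) cycle_edges_nonempty_conv[of c'] by (auto simp: graph_cycle_def)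
  ultimately have "graph_cycle V E (c' @ [v])"
    using assms c' by (simp add: graph_cycle_def)
  then show thesis using that[of "c' @ [v]"] c'(2) by simp
qed

text \<open>\<open>p\<close>, \<open>q\<close>, \<open>w\<close> are the three classes of vertices
  of the trihexagonal tiling under translation, and \<open>L\<close> singles out the translations
  that become trivial. The edge rules are the sides of the hexagon at \<open>(a, b)\<close>, up to a
  shift of indices; its corners in order are \<open>p a b\<close>, \<open>q a b\<close>,
  \<open>w a b\<close>, \<open>p (a - 1) b\<close>, \<open>q a (b - 1)\<close>,
  \<open>w (a + 1) (b - 1)\<close>.\<close>

locale kagome_lattice =
  fixes p q w :: "int \<Rightarrow> int \<Rightarrow> 'v" and L :: "int \<Rightarrow> int \<Rightarrow> bool" and V :: "'v set" and E :: "'v set set"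
  assumes finV: "finite V"
    and L_add: "\<And>a b c d. L a b \<Longrightarrow> L c d \<Longrightarrow> L (a + c) (b + d)"
    and L_neg: "\<And>a b. L a b \<Longrightarrow> L (- a) (- b)"
    and inj: "\<And>a b c d. p a b = p c d \<longleftrightarrow> L (a - c) (b - d)" "\<And>a b c d. q a b = q c d \<longleftrightarrow> L (a - c) (b - d)"
      "\<And>a b c d. w a b = w c d \<longleftrightarrow> L (a - c) (b - d)"
    and ne: "\<And>a b c d. p a b \<noteq> q c d" "\<And>a b c d. p a b \<noteq> w c d" "\<And>a b c d. q a b \<noteq> w c d"
    and V: "V = {p a b | a b. True} \<union> {q a b | a b. True} \<union> {w a b | a b. True}"
    and E: "\<And>a b. {p a b, q a b} \<in> E" "\<And>a b. {q a b, w a b} \<in> E" "\<And>a b. {p a b, w (a + 1) b} \<in> E"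
      "\<And>a b. {p a b, q (a + 1) (b - 1)} \<in> E" "\<And>a b. {p a b, w (a + 1) (b - 1)} \<in> E"
      "\<And>a b. {q a b, w (a + 1) b} \<in> E"
    and L10: "\<not> L 1 0"
begin

lemma E': "{q a b, p a b} \<in> E" "{w a b, q a b} \<in> E" "{w (a + 1) b, p a b} \<in> E"
  "{q (a + 1) (b - 1), p a b} \<in> E" "{w (a + 1) (b - 1), p a b} \<in> E" "{w (a + 1) b, q a b} \<in> E"
  using E by (simp_all add: insert_commute)

section \<open>A fundamental cell of the lattice\<close>

lemma L_zero: "L 0 0"
  using inj(1)[of 0 0 0 0] by simp

lemma L_mult: "L a b \<Longrightarrow> L (n * a) (n * b)"
proof -
  assume *: "L a b"
  have nat: "L (int m * a) (int m * b)" for m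
  proof (induction m)
    case (Suc m)
    then show ?case using L_add[OF * Suc] by (simp add: algebra_simps)
  qed (simp add: L_zero)
  show "L (n * a) (n * b)"
  proof (cases "n \<ge> 0")
    case True
    then show ?thesis using nat[of "nat n"] by simp
  next
    case False
    then show ?thesis using L_neg[OF nat[of "nat (- n)"]] by simp
  qed
qed

text \<open>The lattice is brought to triangular form, with basis \<open>(r, 0)\<close> and
  \<open>(k, s)\<close> for a suitable \<open>k\<close>: \<open>r\<close> is the length of a row and
  \<open>s\<close> the number of rows.\<close>

definition r :: nat where "r = (LEAST n. n > 0 \<and> L (int n) 0)"
definition s :: nat where "s = (LEAST n. n > 0 \<and> (\<exists>k. L k (int n)))"

text \<open>There are only finitely many vertices, so two multiples of the vector have the same
  \<open>p\<close>-vertex, and their difference lies in the lattice.\<close>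

lemma ex_period: "\<exists>n>0. L (int n * a) (int n * b)"
proof -
  have "\<not> inj (\<lambda>n::nat. p (int n * a) (int n * b))"
  proof
    assume i: "inj (\<lambda>n::nat. p (int n * a) (int n * b))"
    have "range (\<lambda>n::nat. p (int n * a) (int n * b)) \<subseteq> V" using V by blast
    then have "finite (range (\<lambda>n::nat. p (int n * a) (int n * b)))" using finV finite_subset by blast
    then show False using i finite_imageD infinite_UNIV_nat by blast
  qed
  then obtain m n :: nat where mn: "m \<noteq> n" "p (int m * a) (int m * b) = p (int n * a) (int n * b)"
    unfolding inj_def by blast
  have *: "\<exists>n>0. L (int n * a) (int n * b)" if "m < n" "p (int m * a) (int m * b) = p (int n * a) (int n * b)" for m n
  proof -
    have "L (int n * a - int m * a) (int n * b - int m * b)" using that(2)[symmetric] inj(1) by blast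
    moreover have "int n * a - int m * a = int (n - m) * a" "int n * b - int m * b = int (n - m) * b"
      using that(1) by (simp_all add: of_nat_diff algebra_simps)
    ultimately show ?thesis using that(1) by (intro exI[of _ "n - m"]) simp
  qed
  show ?thesis using *[of m n] *[of n m] mn by (metis linorder_neqE_nat)
qed

lemma r: "r > 0" "L (int r) 0" "\<And>n. 0 < n \<Longrightarrow> n < r \<Longrightarrow> \<not> L (int n) 0" "r \<ge> 2"
proof -
  have "\<exists>n. n > 0 \<and> L (int n) 0" using ex_period[of 1 0] by simp
  then have *: "r > 0 \<and> L (int r) 0" unfolding r_def by (rule LeastI_ex)
  then show "r > 0" "L (int r) 0" by simp_all
  show "\<not> L (int n) 0" if "0 < n" "n < r" for n
    using that not_less_Least[of n "\<lambda>n. n > 0 \<and> L (int n) 0"] unfolding r_def by blast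
  have "r \<noteq> 1" using * L10 by auto
  then show "r \<ge> 2" using * by linarith
qed

lemma s: "s > 0" "\<exists>k. L k (int s)" "\<And>n k. 0 < n \<Longrightarrow> n < s \<Longrightarrow> \<not> L k (int n)"
proof -
  have "\<exists>n. n > 0 \<and> (\<exists>k. L k (int n))" using ex_period[of 0 1] by auto
  then have *: "s > 0 \<and> (\<exists>k. L k (int s))" unfolding s_def by (rule LeastI_ex)
  then show "s > 0" "\<exists>k. L k (int s)" by simp_all
  show "\<not> L k (int n)" if "0 < n" "n < s" for n k
    using that not_less_Least[of n "\<lambda>n. n > 0 \<and> (\<exists>k. L k (int n))"] unfolding s_def by blast
qed

lemma L_cell:
  assumes "i < r" "i' < r" "b < s" "b' < s" "L (- int i - (- int i')) (int b - int b')"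
  shows "i = i' \<and> b = b'"
proof -
  have b: "b = b'"
  proof (rule ccontr)
    assume "b \<noteq> b'"
    then consider "b' < b" | "b < b'" by linarith
    then show False
    proof cases
      case 1
      then have "L (- int i - (- int i')) (int (b - b'))" using assms(5) by (simp add: of_nat_diff)
      then show False using s(3)[of "b - b'"] 1 assms(3) by fastforce
    next
      case 2
      then have "L (- (- int i - (- int i'))) (int (b' - b))" using L_neg[OF assms(5)] by (simp add: of_nat_diff)
      then show False using s(3)[of "b' - b"] 2 assms(4) by fastforce
    qed
  qed
  have "i = i'"
  proof (rule ccontr)
    assume "i \<noteq> i'"
    then consider "i' < i" | "i < i'" by linarith
    then show False
    proof cases
      case 1
      then have "L (int (i - i')) 0" using L_neg[OF assms(5)] b by (simp add: of_nat_diff)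
      moreover have "0 < i - i'" "i - i' < r" using 1 assms(1) by linarith+
      ultimately show False using r(3) by blast
    next
      case 2
      then have "L (int (i' - i)) 0" using assms(5) b by (simp add: of_nat_diff)
      moreover have "0 < i' - i" "i' - i < r" using 2 assms(2) by linarith+
      ultimately show False using r(3) by blast
    qed
  qed
  then show ?thesis using b by simp
qed

text \<open>Multiples of \<open>(k, s)\<close> reduce the second coordinate modulo \<open>s\<close>;
  afterwards multiples of \<open>(r, 0)\<close> reduce the first one modulo \<open>r\<close> without
  disturbing the second.\<close>

lemma cell_ex: "\<exists>i<r. \<exists>b'<s. L (a - (- int i)) (b - int b')"
proof -
  obtain k where k: "L k (int s)" using s(2) by blast
  define m where "m = b div int s"
  define a' where "a' = a - m * k"
  define i where "i = nat ((- a') mod int r)"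
  define b' where "b' = nat (b mod int s)"
  have i: "int i = (- a') mod int r" "i < r" using r(1) by (simp_all add: i_def nat_less_iff)
  have b': "int b' = b mod int s" "b' < s" using s(1) by (simp_all add: b'_def nat_less_iff)
  have "L (m * k) (m * int s)" using L_mult[OF k] .
  moreover have "L ((- ((- a') div int r)) * int r) ((- ((- a') div int r)) * 0)" using L_mult[OF r(2)] .
  ultimately have "L (m * k + (- ((- a') div int r)) * int r) (m * int s + 0)" using L_add by fastforce
  moreover have "m * k + (- ((- a') div int r)) * int r = a - (- int i)"
  proof -
    have "- a' = ((- a') div int r) * int r + int i" using i(1) by (simp add: mult.commute)
    then show ?thesis unfolding a'_def by linarith
  qed
  moreover have "m * int s + 0 = b - int b'"
    using b'(1) unfolding m_def by (simp add: minus_mod_eq_div_mult)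
  ultimately show ?thesis using i(2) b'(2) by auto
qed

text \<open>The tags 0, 1, 2 stand for \<open>p\<close>, \<open>q\<close>, \<open>w\<close>. The
  column is negated because a row is walked towards smaller first coordinates: \<open>w a b\<close>
  is adjacent to \<open>p (a - 1) b\<close> and \<open>q (a - 1) b\<close>.\<close>

definition vv :: "nat \<times> nat \<times> nat \<Rightarrow> 'v" where
  "vv = (\<lambda>(t, i, b). (if t = 0 then p else if t = 1 then q else w) (- int i) (int b))"

lemma vv_simps [simp]: "vv (0, i, b) = p (- int i) (int b)" "vv (Suc 0, i, b) = q (- int i) (int b)"
  "vv (2, i, b) = w (- int i) (int b)"
  by (simp_all add: vv_def)

definition cell :: "(nat \<times> nat \<times> nat) set" where "cell = {..<3} \<times> {..<r} \<times> {..<s}"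

lemma vv_inj: "inj_on vv cell"
proof (rule inj_onI)
  fix x y assume xy: "x \<in> cell" "y \<in> cell" "vv x = vv y"
  obtain t i b t' i' b' where [simp]: "x = (t, i, b)" "y = (t', i', b')" by (metis surj_pair)
  have c: "i < r" "i' < r" "b < s" "b' < s" and t: "t < 3" "t' < 3" using xy by (auto simp: cell_def)
  have tc: "t = 0 \<or> t = 1 \<or> t = 2" "t' = 0 \<or> t' = 1 \<or> t' = 2" using t by linarith+
  have *: "t = t' \<and> L (- int i - (- int i')) (int b - int b')"
    using xy(3) tc ne ne[symmetric] by (elim disjE) (simp_all add: vv_def inj)
  then show "x = y" using L_cell[OF c] by simp
qed

lemma vv_image: "vv ` cell = V"
proof
  have "vv (t, i, b) \<in> V" for t i b
    using V by (cases "t = 0"; cases "t = 1") (simp_all add: vv_def, blast+)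
  then show "vv ` cell \<subseteq> V" by auto
  show "V \<subseteq> vv ` cell"
  proof
    fix x assume "x \<in> V"
    then obtain a b where x: "x = p a b \<or> x = q a b \<or> x = w a b" using V by blast
    obtain i b' where i: "i < r" "b' < s" "L (a - (- int i)) (b - int b')" using cell_ex by blast
    have c: "(0, i, b') \<in> cell" "(1, i, b') \<in> cell" "(2, i, b') \<in> cell" using i by (auto simp: cell_def)
    have "x = vv (0, i, b') \<or> x = vv (1, i, b') \<or> x = vv (2, i, b')"
      using x i(3) by (auto simp: inj)
    then show "x \<in> vv ` cell" using c by blast
  qed
qed

text \<open>A path through the rows \<open>0, \<dots>, j\<close> from \<open>q(0, j)\<close> to \<open>w(1, j)\<close>: two of the vertices \<open>p\<close>
  of row \<open>j\<close> serve to enter and to leave the path for the rows below, and the others are visited on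
  the way along the row. Only \<open>p(0, 0)\<close> is omitted.\<close>

fun rows :: "nat \<Rightarrow> (nat \<times> nat \<times> nat) list" where
  "rows 0 = [(1, 0, 0), (2, 0, 0), (0, 1, 0), (1, 1, 0), (2, 1, 0)] @
     concat (map (\<lambda>i. [(0, i, 0), (1, i, 0), (2, i, 0)]) [2..<r])"
| "rows (Suc j) = [(1, 0, Suc j), (0, 0, Suc j)] @ rev (rows j) @
     [(0, 1, Suc j), (2, 0, Suc j), (1, 1, Suc j), (2, 1, Suc j)] @
     concat (map (\<lambda>i. [(0, i, Suc j), (1, i, Suc j), (2, i, Suc j)]) [2..<r])"

lemma set_blocks: "set (concat (map (\<lambda>i. [(0 :: nat, i, j), (1, i, j), (2, i, j)]) [2..<r])) = {..<3} \<times> {2..<r} \<times> {j :: nat}"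
proof -
  have "{..<3} = {0, 1, 2 :: nat}" by auto
  then show ?thesis by (auto; fastforce)
qed

lemma distinct_blocks: "distinct (concat (map (\<lambda>i. [(0 :: nat, i, j :: nat), (1, i, j), (2, i, j)]) [2..<n]))"
proof (induction n)
  case (Suc n)
  then show ?case by (cases "2 \<le> n") auto
qed simp

lemma set_rows: "set (rows j) = ({..<3} \<times> {..<r} \<times> {..j}) - {(0, 0, 0)}"
proof (induction j)
  case 0
  have "{..<r} = {0, 1} \<union> {2..<r}" using r(4) by auto
  moreover have "{..<3} = {0, 1, 2 :: nat}" by auto
  ultimately show ?case unfolding rows.simps set_append set_blocks by auto
next
  case (Suc j)
  have r2: "{..<r} = {0, 1} \<union> {2..<r}" using r(4) by auto
  have t3: "{..<3} = {0, 1, 2 :: nat}" by auto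
  define A where "A = {..<3 :: nat} \<times> {..<r} \<times> {..j}"
  define B where "B = {..<3 :: nat} \<times> {2..<r} \<times> {Suc j}"
  define C where "C = {(1 :: nat, 0 :: nat, Suc j), (0, 0, Suc j), (0, 1, Suc j), (2, 0, Suc j), (1, 1, Suc j), (2, 1, Suc j)}"
  have "{..<3} \<times> {..<r} \<times> {..Suc j} = A \<union> {..<3} \<times> {..<r} \<times> {Suc j}" unfolding A_def by auto
  also have "{..<3} \<times> {..<r} \<times> {Suc j} = C \<union> B" unfolding B_def C_def r2 t3 by auto
  finally have 1: "{..<3} \<times> {..<r} \<times> {..Suc j} = A \<union> (C \<union> B)" .
  have 2: "(0, 0, 0) \<notin> C \<union> B" unfolding B_def C_def by auto
  have "set (rows (Suc j)) = (A - {(0, 0, 0)}) \<union> (C \<union> B)"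
    unfolding rows.simps set_append set_blocks set_rev Suc A_def[symmetric] B_def[symmetric] C_def
    by (simp add: Un_commute Un_left_commute insert_commute)
  then show ?case unfolding 1 using 2 by blast
qed

lemma distinct_rows: "distinct (rows j)"
proof (induction j)
  case 0
  show ?case unfolding rows.simps distinct_append set_blocks using distinct_blocks by auto
next
  case (Suc j)
  have a: "x \<notin> set (rows j)" if "snd (snd x) = Suc j" for x using that unfolding set_rows by auto
  have 1: "set (rows j) \<inter> ({..<3} \<times> {2..<r} \<times> {Suc j}) = {}" using a by fastforce
  have 2: "distinct ([(0 :: nat, 1, Suc j), (2, 0, Suc j), (1, 1, Suc j), (2, 1, Suc j)] @
     concat (map (\<lambda>i. [(0, i, Suc j), (1, i, Suc j), (2, i, Suc j)]) [2..<r]))"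
    unfolding distinct_append set_blocks using distinct_blocks by auto
  have 3: "distinct (rev (rows j) @ [(0, 1, Suc j), (2, 0, Suc j), (1, 1, Suc j), (2, 1, Suc j)] @
     concat (map (\<lambda>i. [(0, i, Suc j), (1, i, Suc j), (2, i, Suc j)]) [2..<r]))"
    unfolding distinct_append[of "rev (rows j)"] set_append set_blocks set_rev distinct_rev
    using Suc 2 1 a by auto
  show ?case unfolding rows.simps distinct_append[of "[(1, 0, Suc j), (0, 0, Suc j)]"]
    set_append set_blocks set_rev using 3 a by auto
qed

section \<open>Adjacency along the rows and insertion of the omitted vertex\<close>

definition walk :: "(nat \<times> nat \<times> nat) list \<Rightarrow> bool" where "walk xs \<longleftrightarrow> (\<forall>(x, y) \<in> steps xs. {vv x, vv y} \<in> E)"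

lemma walk_append: "xs \<noteq> [] \<Longrightarrow> ys \<noteq> [] \<Longrightarrow> walk (xs @ ys) \<longleftrightarrow> walk xs \<and> walk ys \<and> {vv (last xs), vv (hd ys)} \<in> E"
  by (auto simp: walk_def steps_append)

lemma walk_rev: "walk (rev xs) \<longleftrightarrow> walk xs"
proof -
  have "walk (rev xs)" if "walk xs" for xs
    unfolding walk_def steps_rev
  proof clarify
    fix a b c a' b' c' assume "((a', b', c'), (a, b, c)) \<in> steps xs"
    then have "{vv (a', b', c'), vv (a, b, c)} \<in> E" using that unfolding walk_def by blast
    then show "{vv (a, b, c), vv (a', b', c')} \<in> E" by (simp only: insert_commute)
  qed
  from this[of xs] this[of "rev xs"] show ?thesis by auto
qed

lemma row_steps: "{w (- int i) b, p (- int (Suc i)) b} \<in> E" "{w (- int i) b, q (- int (Suc i)) b} \<in> E"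
  "{p (- int (Suc i)) b, w (- int i) b} \<in> E"
  using E'(3)[of "- int (Suc i)" b] E'(6)[of "- int (Suc i)" b] E(3)[of "- int (Suc i)" b] by simp_all

lemma walk_blocks:
  assumes "xs \<noteq> []" "walk xs" "last xs = (2, 1, j)" "2 \<le> n"
  shows "walk (xs @ concat (map (\<lambda>i. [(0, i, j), (1, i, j), (2, i, j)]) [2..<n])) \<and>
    last (xs @ concat (map (\<lambda>i. [(0, i, j), (1, i, j), (2, i, j)]) [2..<n])) = (2, n - 1, j)"
  using assms(4)
proof (induction n rule: dec_induct)
  case base
  then show ?case using assms by simp
next
  case (step n)
  let ?ys = "xs @ concat (map (\<lambda>i. [(0, i, j), (1, i, j), (2, i, j)]) [2..<n])"
  have eq: "xs @ concat (map (\<lambda>i. [(0, i, j), (1, i, j), (2, i, j)]) [2..<Suc n]) = ?ys @ [(0, n, j), (1, n, j), (2, n, j)]"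
    using step(1) by simp
  have n: "n = Suc (n - 1)" using step(1) by simp
  have "{vv (2, n - 1, j), vv (0, n, j)} \<in> E" using row_steps(1)[of "n - 1" "int j"] n by simp
  moreover have "walk [(0, n, j), (1, n, j), (2, n, j)]" using E by (simp add: walk_def)
  ultimately show ?case unfolding eq using step.IH assms(1) by (subst walk_append) simp_all
qed

lemma rows_walk: "rows j \<noteq> [] \<and> walk (rows j) \<and> hd (rows j) = (1, 0, j) \<and> last (rows j) = (2, r - 1, j)"
proof (induction j)
  case 0
  let ?xs = "[(1, 0, 0), (2, 0, 0), (0, 1, 0), (1, 1, 0), (2, 1, 0)] :: (nat \<times> nat \<times> nat) list"
  have "walk ?xs" using E[of 0 0] E[of "-1" 0] row_steps[of 0 0] by (simp add: walk_def)
  then show ?case using walk_blocks[of ?xs 0 r] r(4) by simp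
next
  case (Suc j)
  let ?xs = "[(1, 0, Suc j), (0, 0, Suc j)] :: (nat \<times> nat \<times> nat) list"
  let ?ys = "[(0, 1, Suc j), (2, 0, Suc j), (1, 1, Suc j), (2, 1, Suc j)] :: (nat \<times> nat \<times> nat) list"
  have x: "walk ?xs" using E' by (simp add: walk_def)
  have y: "walk ?ys" using E[of "-1" "int (Suc j)"] row_steps[of 0 "int (Suc j)"] by (simp add: walk_def)
  \<comment> \<open>By the period \<open>(r, 0)\<close>, row \<open>j\<close> ends at
    \<open>w 1 j\<close>. It is adjacent to \<open>p 0 (j + 1)\<close>, from which the lower rows
    are entered; their start \<open>q 0 j\<close> is adjacent to \<open>p (-1) (j + 1)\<close>, to
    which the path returns.\<close>
  have "w (- int (r - 1)) (int j) = w 1 (int j)"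
    unfolding inj using L_neg[OF r(2)] r(1) by (simp add: of_nat_diff)
  then have 1: "{vv (0, 0, Suc j), vv (2, r - 1, j)} \<in> E" using E(5)[of 0 "int (Suc j)"] by simp
  have 2: "{vv (1, 0, j), vv (0, 1, Suc j)} \<in> E" using E'(4)[of "-1" "int (Suc j)"] by simp
  have n: "rev (rows j) \<noteq> []" "hd (rev (rows j)) = (2, r - 1, j)" "last (rev (rows j)) = (1, 0, j)"
    "walk (rev (rows j))" using Suc by (simp_all add: hd_rev last_rev walk_rev)
  have "walk (rev (rows j) @ ?ys)" using n y 2 by (subst walk_append) simp_all
  then have "walk (?xs @ rev (rows j) @ ?ys)" using x n 1 by (subst walk_append) simp_all
  then show ?case using walk_blocks[of "?xs @ rev (rows j) @ ?ys" "Suc j" r] r(4) by simp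
qed

lemma steps_map: "steps (map f xs) = (\<lambda>(x, y). (f x, f y)) ` steps xs"
  by (induction xs rule: steps.induct) auto

lemma rows_cycle: "graph_cycle V E (map vv (rows (s - 1)))"
  "set (map vv (rows (s - 1))) = V - {p 0 0}"
  "uedge ` steps (map vv (rows (s - 1))) \<subseteq> cycle_edges (map vv (rows (s - 1)))"
proof -
  let ?c = "map vv (rows (s - 1))"
  have sub: "set (rows (s - 1)) = cell - {(0, 0, 0)}"
    using s(1) unfolding set_rows cell_def by auto
  have z: "(0, 0, 0) \<in> cell" "vv (0, 0, 0) = p 0 0" using r(1) s(1) by (auto simp: cell_def)
  have "vv ` (cell - {(0, 0, 0)}) = vv ` cell - vv ` {(0, 0, 0)}"
    using z(1) by (intro inj_on_image_set_diff[OF vv_inj]) auto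
  then show st: "set ?c = V - {p 0 0}" using sub z(2) vv_image by simp
  have d: "distinct ?c" using distinct_rows sub vv_inj by (simp add: distinct_map inj_on_diff)
  have ne: "rows (s - 1) \<noteq> []" "hd (rows (s - 1)) = (1, 0, s - 1)" "last (rows (s - 1)) = (2, r - 1, s - 1)"
    "walk (rows (s - 1))" using rows_walk by simp_all
  have st: "uedge ` steps ?c \<subseteq> E" using ne(4) unfolding walk_def steps_map by auto
  have ce: "cycle_edges ?c = insert {last ?c, hd ?c} (uedge ` steps ?c)"
    using ne(1) by (intro cycle_edges_nonempty_conv) simp
  then show "uedge ` steps ?c \<subseteq> cycle_edges ?c" by blast
  have "w (- int (r - 1)) (int (s - 1)) = w 1 (int (s - 1))"
    unfolding inj using L_neg[OF r(2)] r(1) by (simp add: of_nat_diff)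
  then have "{last ?c, hd ?c} \<in> E"
    using ne E'(6)[of 0 "int (s - 1)"] by (simp add: last_map hd_map)
  then have "cycle_edges ?c \<subseteq> E" using ce st by simp
  moreover have "3 \<le> length ?c"
  proof -
    have "{(1, 0, 0), (2, 0, 0), (1, 1, 0)} \<subseteq> cell - {(0, 0, 0)}" using r(4) s(1) by (auto simp: cell_def)
    then have "card {(1 :: nat, 0 :: nat, 0 :: nat), (2, 0, 0), (1, 1, 0)} \<le> card (set (rows (s - 1)))"
      unfolding sub[symmetric] by (intro card_mono) simp_all
    then show ?thesis using distinct_card[OF distinct_rows] by simp
  qed
  ultimately show "graph_cycle V E ?c" using d \<open>set ?c = V - {p 0 0}\<close> by (auto simp: graph_cycle_def)
qed

text \<open>Locates edges into which the omitted vertex can be inserted. Column 0 is excluded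
  because there the path turns from \<open>q\<close> to the lower rows instead of going on to
  \<open>w\<close>.\<close>

lemma last_row_edge:
  assumes "1 \<le> i" "i < r"
  shows "((1, i, j), (2, i, j)) \<in> steps (rows j)"
proof -
  have sub: "(x, y) \<in> steps (xs @ ys)" if "(x, y) \<in> steps ys" for x y :: "nat \<times> nat \<times> nat" and xs ys
    using that by (cases "xs = []"; cases "ys = []") (auto simp: steps_append)
  have sub': "(x, y) \<in> steps (xs @ ys)" if "(x, y) \<in> steps xs" for x y :: "nat \<times> nat \<times> nat" and xs ys
    using that by (cases "xs = []"; cases "ys = []") (auto simp: steps_append)
  have bl: "((1, i, j), (2, i, j)) \<in> steps (concat (map (\<lambda>i. [(0 :: nat, i, j), (1, i, j), (2, i, j)]) [2..<n]))"
    if "2 \<le> i" "i < n" for n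
    using that(2)
  proof (induction n)
    case (Suc n)
    have eq: "concat (map (\<lambda>i. [(0 :: nat, i, j), (1, i, j), (2, i, j)]) [2..<Suc n]) =
      concat (map (\<lambda>i. [(0, i, j), (1, i, j), (2, i, j)]) [2..<n]) @ [(0, n, j), (1, n, j), (2, n, j)]"
      using Suc.prems that(1) by simp
    show ?case
    proof (cases "i = n")
      case True
      then show ?thesis unfolding eq by (intro sub) simp
    next
      case False
      then show ?thesis unfolding eq using Suc by (intro sub') simp
    qed
  qed simp
  show ?thesis
  proof (cases "i = 1")
    case True
    show ?thesis
    proof (cases j)
      case 0
      then show ?thesis unfolding True 0 rows.simps by (intro sub') simp
    next
      case (Suc k)
      have "((1, i, j), (2, i, j)) \<in> steps [(0, 1, Suc k), (2, 0, Suc k), (1, 1, Suc k), (2, 1, Suc k)]"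
        using True Suc by simp
      then show ?thesis unfolding Suc rows.simps using sub sub' by blast
    qed
  next
    case False
    then have "((1, i, j), (2, i, j)) \<in> steps (concat (map (\<lambda>i. [(0 :: nat, i, j), (1, i, j), (2, i, j)]) [2..<r]))"
      using assms by (intro bl) simp_all
    then show ?thesis by (cases j) (simp_all only: rows.simps, (blast intro: sub)+)
  qed
qed

text \<open>The omitted \<open>p 0 0\<close> forms a triangle with \<open>q 1 (-1)\<close> and
  \<open>w 1 (-1)\<close>, which the lattice places in the top row. The side joining these two lies
  on the cycle unless they fall into column 0, and this is what the hypothesis on
  \<open>L 1 (- s)\<close> rules out. With a single row the closing edge from \<open>w 1 0\<close>
  to \<open>q 0 0\<close> is used instead.\<close>

lemma hamiltonian_rows:
  assumes "s = 1 \<or> \<not> L 1 (- int s)"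
  shows "hamiltonian V E"
proof -
  let ?c = "map vv (rows (s - 1))"
  have pV: "p 0 0 \<in> V" "p 0 0 \<notin> set ?c" using V rows_cycle(2) by auto
  have "\<exists>x y. {x, y} \<in> cycle_edges ?c \<and> {x, p 0 0} \<in> E \<and> {p 0 0, y} \<in> E"
  proof (cases "s = 1")
    case True
    have ne: "rows 0 \<noteq> []" "hd (rows 0) = (1, 0, 0)" "last (rows 0) = (2, r - 1, 0)" using rows_walk[of 0] by simp_all
    have "w (- int (r - 1)) 0 = w 1 0"
      unfolding inj using L_neg[OF r(2)] r(1) by (simp add: of_nat_diff)
    moreover have "s - 1 = 0" using True by simp
    moreover have "last ?c = vv (last (rows 0))" "hd ?c = vv (hd (rows 0))"
      unfolding \<open>s - 1 = 0\<close> by (rule last_map[OF ne(1)], rule hd_map[OF ne(1)])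
    ultimately have lh: "last ?c = w 1 0" "hd ?c = q 0 0"
      unfolding ne by simp_all
    have "?c \<noteq> []" using ne(1) \<open>s - 1 = 0\<close> by (simp only: list.map_disc_iff not_False_eq_True)
    then have "cycle_edges ?c = insert {last ?c, hd ?c} (uedge ` steps ?c)"
      by (rule cycle_edges_nonempty_conv)
    then have "{w 1 0, q 0 0} \<in> cycle_edges ?c" using lh by simp
    moreover have "{w 1 0, p 0 0} \<in> E" "{p 0 0, q 0 0} \<in> E" using E'(3)[of 0 0] E(1) by simp_all
    ultimately show ?thesis by blast
  next
    case False
    then have nL: "\<not> L 1 (- int s)" using assms by simp
    obtain i b' where i: "i < r" "b' < s" "L (1 - (- int i)) (- 1 - int b')" using cell_ex[of 1 "-1"] by blast
    have b': "b' = s - 1"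
    proof (rule ccontr)
      assume "b' \<noteq> s - 1"
      then have "0 < Suc b'" "Suc b' < s" using i(2) by simp_all
      moreover have "L (- (1 - (- int i))) (int (Suc b'))" using L_neg[OF i(3)] by (simp add: add.commute)
      ultimately show False using s(3) by blast
    qed
    have i0: "i \<noteq> 0"
    proof
      assume "i = 0"
      then have "L 1 (- int s)" using i(3) b' s(1) by (simp add: of_nat_diff)
      then show False using nL by simp
    qed
    have eq: "q 1 (- 1) = vv (1, i, s - 1)" "w 1 (- 1) = vv (2, i, s - 1)" using i(3) b' by (simp_all add: inj)
    have "((1, i, s - 1), (2, i, s - 1)) \<in> steps (rows (s - 1))" using last_row_edge i0 i(1) by simp
    then have "(q 1 (- 1), w 1 (- 1)) \<in> steps ?c" unfolding steps_map eq by force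
    then have "{q 1 (- 1), w 1 (- 1)} \<in> cycle_edges ?c" using rows_cycle(3) by force
    moreover have "{q 1 (- 1), p 0 0} \<in> E" "{p 0 0, w 1 (- 1)} \<in> E" using E'(4)[of 0 0] E(5)[of 0 0] by simp_all
    ultimately show ?thesis by blast
  qed
  then obtain x y where xy: "{x, y} \<in> cycle_edges ?c" "{x, p 0 0} \<in> E" "{p 0 0, y} \<in> E" by blast
  obtain c' where "graph_cycle V E c'" "set c' = insert (p 0 0) (set ?c)"
    using insert_vertex[OF rows_cycle(1) xy(1) pV xy(2,3)] by blast
  moreover have "insert (p 0 0) (set ?c) = V" using rows_cycle(2) pV(1) by auto
  ultimately show ?thesis unfolding hamiltonian_def by auto
qed

end

section \<open>Integer powers of bijections and the rotation group of the tiling\<close>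

definition zpow :: "('d \<Rightarrow> 'd) \<Rightarrow> int \<Rightarrow> 'd \<Rightarrow> 'd" where
  "zpow f n = (if 0 \<le> n then f ^^ nat n else inv f ^^ nat (- n))"

lemma zpow_0 [simp]: "zpow f 0 x = x"
  by (simp add: zpow_def)

lemma zpow_1 [simp]: "zpow f 1 x = f x"
  by (simp add: zpow_def)

lemma zpow_intertwine:
  assumes "bij f" "bij g" "\<And>x. h (f x) = g (h x)"
  shows "h (zpow f n x) = zpow g n (h x)"
proof -
  have i: "h (inv f x) = inv g (h x)" for x
    using assms(3)[of "inv f x"] assms(1,2) by (metis bij_inv_eq_iff)
  have nat: "h ((f ^^ m) x) = (g ^^ m) (h x)" "h ((inv f ^^ m) x) = (inv g ^^ m) (h x)" for m
    by (induction m) (simp_all add: assms(3) i)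
  show ?thesis by (simp add: zpow_def nat)
qed

lemma zpow_Suc: "bij f \<Longrightarrow> zpow f (n + 1) x = f (zpow f n x)"
proof -
  assume f: "bij f"
  show ?thesis
  proof (cases "0 \<le> n")
    case True
    then have "nat (n + 1) = Suc (nat n)" by simp
    then show ?thesis using True by (simp add: zpow_def)
  next
    case False
    then have n: "nat (- n) = Suc (nat (- (n + 1)))" by simp
    have "f (inv f y) = y" for y using f by (metis bij_inv_eq_iff)
    then show ?thesis using False by (auto simp: zpow_def n)
  qed
qed

lemma zpow_add: "bij f \<Longrightarrow> zpow f (m + n) x = zpow f m (zpow f n x)"
proof -
  assume f: "bij f"
  show ?thesis
  proof (induction m rule: int_induct[where k = 0])
    case (step1 i)
    have "zpow f (i + 1 + n) x = f (zpow f (i + n) x)" using zpow_Suc[OF f, of "i + n" x] by (simp add: algebra_simps)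
    then show ?case using step1 zpow_Suc[OF f] by simp
  next
    case (step2 i)
    have "f (zpow f (i - 1 + n) x) = zpow f (i + n) x" using zpow_Suc[OF f, of "i - 1 + n" x] by (simp add: algebra_simps)
    moreover have "f (zpow f (i - 1) y) = zpow f i y" for y using zpow_Suc[OF f, of "i - 1" y] by simp
    ultimately show ?case using step2 f by (metis bij_pointE)
  qed simp
qed

lemma bij_zpow: "bij f \<Longrightarrow> bij (zpow f n)"
proof -
  assume f: "bij f"
  have "zpow f n \<circ> zpow f (- n) = id" "zpow f (- n) \<circ> zpow f n = id"
    using zpow_add[OF f, of n "- n"] zpow_add[OF f, of "- n" n] by (auto simp: fun_eq_iff)
  then show ?thesis by (rule o_bij[rotated])
qed

text \<open>The rotation group of the tiling by triangles and hexagons: \<open>R\<close> turns a dart about its hexagon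
  and \<open>A\<close> about its initial vertex, by a half-turn. Here \<open>X\<close> and \<open>Y\<close> are translations.\<close>

locale rotations =
  fixes R A :: "'d \<Rightarrow> 'd" and \<Omega> :: "'d set" and vt :: "'d \<Rightarrow> 'v"
  assumes R6: "\<And>x. R (R (R (R (R (R x))))) = x" and AA: "\<And>x. A (A x) = x"
    and RA3: "\<And>x. R (A (R (A (R (A x))))) = x"
    and in_R: "\<And>x. x \<in> \<Omega> \<Longrightarrow> R x \<in> \<Omega>" and in_A: "\<And>x. x \<in> \<Omega> \<Longrightarrow> A x \<in> \<Omega>"
    and vt_eq: "\<And>x y. x \<in> \<Omega> \<Longrightarrow> y \<in> \<Omega> \<Longrightarrow> vt x = vt y \<longleftrightarrow> y = x \<or> y = A x"
    and A_free: "\<And>x. x \<in> \<Omega> \<Longrightarrow> A x \<noteq> x"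
    and vt1: "\<And>x. x \<in> \<Omega> \<Longrightarrow> vt (R x) \<noteq> vt x" and vt2: "\<And>x. x \<in> \<Omega> \<Longrightarrow> vt (R (R x)) \<noteq> vt x"
    and vt3: "\<And>x. x \<in> \<Omega> \<Longrightarrow> vt (R (R (R x))) \<noteq> vt x"
    and fin: "finite \<Omega>" and ne: "\<Omega> \<noteq> {}"
    and trans: "\<And>S. S \<subseteq> \<Omega> \<Longrightarrow> S \<noteq> {} \<Longrightarrow> (\<And>x. x \<in> S \<Longrightarrow> R x \<in> S \<and> A x \<in> S) \<Longrightarrow> S = \<Omega>"
begin

lemma bij_R: "bij R"
proof (rule o_bij)
  show "(R \<circ> R \<circ> R \<circ> R \<circ> R) \<circ> R = id" "R \<circ> (R \<circ> R \<circ> R \<circ> R \<circ> R) = id" by (auto simp: R6)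
qed

lemma bij_A: "bij A"
  by (rule o_bij[of A]) (auto simp: AA)

definition X where "X x = R (R (R (A x)))"
definition Y where "Y x = R (R (A (R x)))"

text \<open>\<open>RA3\<close> says that \<open>R A\<close> has order three; solved for
  \<open>A R A\<close> it reads \<open>A R A = R^-1 A R^-1\<close>, with \<open>R^-1\<close> written
  as the fifth power of \<open>R\<close>. It serves as a rewriting rule for words in
  \<open>R\<close> and \<open>A\<close>.\<close>

lemma braid: "A (R (A x)) = R (R (R (R (R (A (R (R (R (R (R x))))))))))"
proof -
  have "R (A (R (A x))) = A (R (R (R (R (R x)))))"
    using RA3[of "A (R (R (R (R (R x)))))"] by (simp add: AA R6)
  then have "R (R (R (R (R (R (A (R (A x)))))))) = R (R (R (R (R (A (R (R (R (R (R x))))))))))" by simp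
  then show ?thesis by (simp add: R6)
qed

text \<open>\<open>Y\<close> is the conjugate \<open>R^-1 X R\<close>. Writing \<open>R R\<close> as
  \<open>R A A R\<close> and applying \<open>braid\<close> twice turns \<open>A R R A\<close> into
  \<open>R^-1 A R^-2 A R^-1\<close>, which contains all that is needed to interchange the two
  translations.\<close>

lemma XY: "X (Y x) = Y (X x)"
proof -
  have "A (R (R (A x))) = R (R (R (R (R (A (R (R (R (R (A (R (R (R (R (R x)))))))))))))))" for x
  proof -
    have "A (R (R (A x))) = A (R (A (A (R (A x)))))" by (simp add: AA)
    also have "\<dots> = R (R (R (R (R (A (R (R (R (R (R (A (R (A x)))))))))))))" by (simp only: braid[of "A (R (A x))"])
    also have "\<dots> = R (R (R (R (R (A (R (R (R (R (R (R (R (R (R (R (A (R (R (R (R (R x)))))))))))))))))))))"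
      by (simp only: braid[of x])
    also have "\<dots> = R (R (R (R (R (A (R (R (R (R (A (R (R (R (R (R x)))))))))))))))" by (simp only: R6)
    finally show ?thesis .
  qed
  then show ?thesis unfolding X_def Y_def by (simp add: R6)
qed

lemma bij_X: "bij X" and bij_Y: "bij Y"
proof -
  have "X = R \<circ> R \<circ> R \<circ> A" "Y = R \<circ> R \<circ> A \<circ> R" by (auto simp: X_def Y_def)
  then show "bij X" "bij Y" using bij_R bij_A by (simp_all add: bij_comp)
qed

definition T where "T a b x = zpow X a (zpow Y b x)"

lemma X_zpow_Y: "zpow X a (zpow Y b x) = zpow Y b (zpow X a x)"
proof (rule zpow_intertwine[OF bij_Y bij_Y])
  fix x
  show "zpow X a (Y x) = Y (zpow X a x)"
    by (rule zpow_intertwine[OF bij_X bij_X, symmetric]) (simp add: XY)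
qed

lemma T_add: "T a b (T c d x) = T (a + c) (b + d) x"
proof -
  have "T a b (T c d x) = zpow X a (zpow X c (zpow Y b (zpow Y d x)))"
    unfolding T_def X_zpow_Y[of c b, symmetric] by (simp add: X_zpow_Y)
  then show ?thesis unfolding T_def zpow_add[OF bij_X] zpow_add[OF bij_Y] .
qed

lemma T_0 [simp]: "T 0 0 x = x"
  by (simp add: T_def)

lemma T_X: "T 1 0 x = X x" and T_Y: "T 0 1 x = Y x"
  by (simp_all add: T_def)

lemma bij_T: "bij (T a b)"
proof -
  have "T a b = zpow X a \<circ> zpow Y b" by (auto simp: T_def)
  then show ?thesis using bij_comp[OF bij_zpow[OF bij_Y] bij_zpow[OF bij_X]] by simp
qed

text \<open>Conjugation by \<open>R\<close> takes the exponents \<open>(c, d)\<close> to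
  \<open>(c + d, - c)\<close>. This is the rotation of order six of the hexagonal lattice; the next
  two lemmas are its square and its cube.\<close>

lemma R_T: "R (T c d x) = T (c + d) (- c) (R x)"
proof -
  have ry: "R (Y x) = X (R x)" for x by (simp add: X_def Y_def)
  have "Y (R (X x)) = X (R x)" for x
  proof -
    have "A (R (R (R (R (R (A x)))))) = R (A (R x))" for x
      using braid[of "R (A (R x))"] RA3[of "R x"] braid[of x] by (metis AA R6)
    then show ?thesis unfolding X_def Y_def by (simp add: R6)
  qed
  then have rx: "R (X x) = T 1 (- 1) (R x)" for x
    using T_add[of 0 "-1" 0 1 "R (X x)"] T_add[of 0 "-1" 1 0 "R x"] by (simp add: T_X T_Y)
  have z: "zpow (T 1 (- 1)) n x = T n (- n) x" for n x
  proof (induction n arbitrary: x rule: int_induct[where k = 0])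
    case (step1 i)
    then show ?case using zpow_Suc[OF bij_T, of 1 "-1" i x] by (simp add: T_add algebra_simps)
  next
    case (step2 i)
    have "T 1 (- 1) (zpow (T 1 (- 1)) (i - 1) x) = T i (- i) x" using zpow_Suc[OF bij_T, of 1 "-1" "i - 1" x] step2 by simp
    then have "T (- 1) 1 (T 1 (- 1) (zpow (T 1 (- 1)) (i - 1) x)) = T (- 1) 1 (T i (- i) x)" by simp
    then show ?case by (simp add: T_add algebra_simps)
  qed simp
  have 1: "R (T c d x) = zpow (T 1 (- 1)) c (R (zpow Y d x))"
    unfolding T_def[of c d] by (rule zpow_intertwine[OF bij_X bij_T]) (rule rx)
  have 2: "R (zpow Y d x) = zpow X d (R x)" by (rule zpow_intertwine[OF bij_Y bij_X]) (rule ry)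
  have 3: "zpow X d (R x) = T d 0 (R x)" by (simp add: T_def)
  show ?thesis unfolding 1 2 3 z T_add by simp
qed

lemma RR_T: "R (R (T c d x)) = T d (- c - d) (R (R x))"
  unfolding R_T by simp

lemma RRR_T: "R (R (R (T c d x))) = T (- c) (- d) (R (R (R x)))"
  unfolding R_T by simp

text \<open>Up to a translation, the half-turn about a vertex is the half-turn about the hexagon.
  The next two lemmas rewrite \<open>A\<close> in the same way at the other two corners used as
  coordinates.\<close>

lemma A_X: "A x = R (R (R (T 1 0 x)))"
  by (simp add: T_X X_def R6)

lemma AR: "A (R x) = R (R (R (R (T 0 1 x))))"
  using R_T[of 0 1 x] A_X[of "R x"] by simp

lemma ARR: "A (R (R x)) = R (R (R (R (R (T (- 1) 1 x)))))"
  using RR_T[of "- 1" 1 x] A_X[of "R (R x)"] by simp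

declare in_R [simp]

text \<open>Negative powers stay in \<Omega> because \<Omega> is finite: an injective map of it into
  itself is onto.\<close>

lemma in_T [simp]: "x \<in> \<Omega> \<Longrightarrow> T a b x \<in> \<Omega>"
proof -
  have X: "X y \<in> \<Omega>" "Y y \<in> \<Omega>" if "y \<in> \<Omega>" for y using that in_R in_A by (simp_all add: X_def Y_def)
  have R5: "inv R y = R (R (R (R (R y))))" for y using bij_R R6 by (metis bij_inv_eq_iff)
  have sub: "f ` \<Omega> = \<Omega>" if "bij f" "f ` \<Omega> \<subseteq> \<Omega>" for f
    using that fin by (metis bij_is_inj card_image card_subset_eq inj_on_subset subset_UNIV)
  have z: "zpow f n y \<in> \<Omega>" if "bij f" "\<And>y. y \<in> \<Omega> \<Longrightarrow> f y \<in> \<Omega>" "y \<in> \<Omega>" for f n y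
  proof -
    have "f ` \<Omega> = \<Omega>" using sub[OF that(1)] that(2) by blast
    then have i: "inv f y \<in> \<Omega>" if "y \<in> \<Omega>" for y using that \<open>bij f\<close> by (metis bij_is_inj image_iff inv_f_f)
    have "(f ^^ m) y \<in> \<Omega>" "(inv f ^^ m) y \<in> \<Omega>" for m
      using that(2,3) i by (induction m) simp_all
    then show ?thesis by (simp add: zpow_def)
  qed
  assume "x \<in> \<Omega>"
  then show "T a b x \<in> \<Omega>" unfolding T_def using z[OF bij_X X(1)] z[OF bij_Y X(2)] by blast
qed

text \<open>Moving the dart by \<open>(c, d)\<close> changes \<open>(a, b)\<close> by
  \<open>(- 2 c, - 2 d)\<close>, so only four classes modulo 2 have to be excluded. They correspond
  to half-turns about the hexagon and about the three kinds of vertices, and contradict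
  \<open>vt3\<close> and \<open>A_free\<close>.\<close>

lemma no_rotation3:
  assumes "x \<in> \<Omega>" "T a b x = R (R (R x))"
  shows False
proof -
  have sh: "R (R (R (T c d x))) = T (a - 2 * c) (b - 2 * d) (T c d x)" for c d
    unfolding RRR_T assms(2)[symmetric] T_add by (simp add: algebra_simps)
  have no: "T e f y \<noteq> R (R (R y))" if y: "y \<in> \<Omega>" and ef: "(e, f) \<in> {(0, 0), (1, 0), (0, 1), (-1, 1)}" for e f y
  proof
    assume eq: "T e f y = R (R (R y))"
    consider "e = 0" "f = 0" | "e = 1" "f = 0" | "e = 0" "f = 1" | "e = -1" "f = 1" using ef by auto
    then show False
    proof cases
      case 1
      then show False using eq vt3[OF y] by simp
    next
      case 2
      then have "A y = R (R (R (R (R (R y)))))" using eq A_X[of y] by simp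
      then show False using R6 A_free[OF y] by simp
    next
      case 3
      then have "A (R y) = R (R (R (R (R (R (R y))))))" using eq AR[of y] by simp
      then show False using R6 A_free[of "R y"] y by simp
    next
      case 4
      then have "A (R (R y)) = R (R (R (R (R (R (R (R y)))))))" using eq ARR[of y] by simp
      then show False using R6 A_free[of "R (R y)"] y by simp
    qed
  qed
  have a: "a - 2 * (a div 2) = 0 \<or> a - 2 * (a div 2) = 1" "b - 2 * (b div 2) = 0 \<or> b - 2 * (b div 2) = 1" by presburger+
  show False
  proof (cases "a - 2 * (a div 2) = 1 \<and> b - 2 * (b div 2) = 1")
    case True
    \<comment> \<open>The class of \<open>(1, 1)\<close> is represented by \<open>(-1, 1)\<close>,
      the form that \<open>ARR\<close> handles.\<close>
    then have e: "a - 2 * (a div 2 + 1) = -1" "b - 2 * (b div 2) = 1" by simp_all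
    have q: "R (R (R (T (a div 2 + 1) (b div 2) x))) = T (- 1) 1 (T (a div 2 + 1) (b div 2) x)"
      using sh[of "a div 2 + 1" "b div 2"] unfolding e .
    have m: "(-1 :: int, 1 :: int) \<in> {(0, 0), (1, 0), (0, 1), (-1, 1)}" by simp
    show False using no[OF in_T[OF assms(1), of "a div 2 + 1" "b div 2"] m] q[symmetric] by (rule notE)
  next
    case False
    then have "(a - 2 * (a div 2), b - 2 * (b div 2)) \<in> {(0, 0), (1, 0), (0, 1), (-1, 1)}" using a by auto
    then show False using no[OF in_T[OF assms(1)]] sh[of "a div 2" "b div 2", symmetric] by blast
  qed
qed

text \<open>Moving the dart changes \<open>a - b\<close> by multiples of 3. The three classes
  correspond to rotations of order three about a hexagon and about the two kinds of triangles; they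
  would identify vertices that \<open>vt1\<close> and \<open>vt2\<close> keep apart.\<close>

lemma no_rotation2:
  assumes "x \<in> \<Omega>" "T a b x = R (R x)"
  shows False
proof -
  have sh: "R (R (T c d x)) = T (a + d - c) (b - c - 2 * d) (T c d x)" for c d
    unfolding RR_T assms(2)[symmetric] T_add by (simp add: algebra_simps)
  define m where "m = (a - b) div 3"
  have m: "a - b - 3 * m = 0 \<or> a - b - 3 * m = 1 \<or> a - b - 3 * m = 2" unfolding m_def by presburger
  then consider "a - b - 3 * m = 0" | "a - b - 3 * m = 1" | "a - b - 3 * (m + 1) = -1" by fastforce
  then show False
  proof cases
    case 1
    have "R (R (T (b + 2 * m) (- m) x)) = T (b + 2 * m) (- m) x"
      unfolding sh using 1 by (simp add: algebra_simps)
    then show False using vt2[of "T (b + 2 * m) (- m) x"] assms(1) by simp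
  next
    case 2
    define y where "y = T (b + 2 * m) (- m) x"
    have y: "y \<in> \<Omega>" unfolding y_def using assms(1) by simp
    have e: "a + - m - (b + 2 * m) = 1" "b - (b + 2 * m) - 2 * - m = 0" using 2 by simp_all
    have "R (R y) = T 1 0 y" using sh[of "b + 2 * m" "- m"] unfolding e y_def .
    then have "A y = R (R (R (R (R y))))" using A_X[of y] by simp
    then have "R (A y) = y" using R6 by simp
    then have "vt (R (A y)) = vt (A y)" using vt_eq[of y "A y"] y in_A by simp
    then show False using vt1 y in_A by blast
  next
    case 3
    define y where "y = T (b + 2 * (m + 1)) (- (m + 1)) x"
    have y: "y \<in> \<Omega>" unfolding y_def using assms(1) by simp
    have e: "a + - (m + 1) - (b + 2 * (m + 1)) = -1" "b - (b + 2 * (m + 1)) - 2 * - (m + 1) = 0" using 3 by simp_all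
    have "R (R y) = T (-1) 0 y" using sh[of "b + 2 * (m + 1)" "- (m + 1)"] unfolding e y_def .
    then have "T 1 0 (R (R y)) = y" by (simp add: T_add)
    then have "A (R (R y)) = R (R (R y))" using A_X[of "R (R y)"] by simp
    then have "vt (R (R (R y))) = vt (R (R y))" using vt_eq[of "R (R y)" "A (R (R y))"] y in_A by simp
    then show False using vt1[of "R (R y)"] y by simp
  qed
qed

text \<open>Applied twice, the equation becomes a case of \<open>no_rotation2\<close>. The fourth
  and fifth powers below are handled as inverses of the second and first.\<close>

lemma no_rotation1:
  assumes "x \<in> \<Omega>" "T a b x = R x"
  shows False
proof -
  have "R (R x) = T (a + b) (- a) (R x)" using R_T[of a b x] unfolding assms(2) .
  also have "\<dots> = T (a + b + a) (- a + b) x" unfolding assms(2)[symmetric] T_add ..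
  finally show False using no_rotation2[OF assms(1)] by metis
qed

lemma no_rotation4:
  assumes "x \<in> \<Omega>" "T a b x = R (R (R (R x)))"
  shows False
proof -
  have "R (R (T a b x)) = x" using assms(2) R6 by simp
  also have "x = T (- a) (- b) (T a b x)" by (simp add: T_add)
  finally show False using no_rotation2[of "T a b x" "- a" "- b"] assms(1) by simp
qed

lemma no_rotation5:
  assumes "x \<in> \<Omega>" "T a b x = R (R (R (R (R x))))"
  shows False
proof -
  have "R (T a b x) = x" using assms(2) R6 by simp
  also have "x = T (- a) (- b) (T a b x)" by (simp add: T_add)
  finally show False using no_rotation1[of "T a b x" "- a" "- b"] assms(1) by simp
qed

section \<open>Coordinates relative to a base dart\<close>

context
  fixes o0 assumes o0: "o0 \<in> \<Omega>"
begin

abbreviation pos :: "int \<Rightarrow> int \<Rightarrow> 'd" where "pos a b \<equiv> T a b o0"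

lemma pos_eq: "pos a b = T (a - c) (b - d) (pos c d)"
  by (simp add: T_add)

lemma pos_no: "pos a b \<noteq> R (pos c d)" "pos a b \<noteq> R (R (pos c d))" "pos a b \<noteq> R (R (R (pos c d)))"
  "pos a b \<noteq> R (R (R (R (pos c d))))" "pos a b \<noteq> R (R (R (R (R (pos c d)))))"
proof -
  have e: "T (a - c) (b - d) (pos c d) = pos a b" using pos_eq[of a b c d] by (rule sym)
  note po = in_T[OF o0, of c d]
  show "pos a b \<noteq> R (pos c d)" using no_rotation1[OF po, of "a - c" "b - d"] unfolding e by blast
  show "pos a b \<noteq> R (R (pos c d))" using no_rotation2[OF po, of "a - c" "b - d"] unfolding e by blast
  show "pos a b \<noteq> R (R (R (pos c d)))" using no_rotation3[OF po, of "a - c" "b - d"] unfolding e by blast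
  show "pos a b \<noteq> R (R (R (R (pos c d))))" using no_rotation4[OF po, of "a - c" "b - d"] unfolding e by blast
  show "pos a b \<noteq> R (R (R (R (R (pos c d)))))" using no_rotation5[OF po, of "a - c" "b - d"] unfolding e by blast
qed

lemma A_pos: "A (pos a b) = R (R (R (pos (a + 1) b)))"
  using A_X[of "pos a b"] T_add[of 1 0 a b o0] by (simp add: add.commute)

lemma AR_pos: "A (R (pos a b)) = R (R (R (R (pos a (b + 1)))))"
  using AR[of "pos a b"] T_add[of 0 1 a b o0] by (simp add: add.commute)

lemma ARR_pos: "A (R (R (pos a b))) = R (R (R (R (R (pos (a - 1) (b + 1))))))"
  using ARR[of "pos a b"] T_add[of "- 1" 1 a b o0] by (simp add: add.commute)

lemma R_cancel: "R x = R y \<longleftrightarrow> x = y"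
  using bij_R by (simp add: bij_is_inj inj_eq)

lemma pos_lattice: "pos a b = pos c d \<longleftrightarrow> pos (a - c) (b - d) = o0"
proof
  assume "pos a b = pos c d"
  then have "T (- c) (- d) (pos a b) = T (- c) (- d) (pos c d)" by simp
  then show "pos (a - c) (b - d) = o0" by (simp add: T_add)
next
  assume "pos (a - c) (b - d) = o0"
  then have "T c d (pos (a - c) (b - d)) = T c d o0" by simp
  then show "pos a b = pos c d" by (simp add: T_add)
qed

text \<open>The rotated translates of the base dart are closed under \<open>R\<close>, under
  translations and hence under \<open>A\<close>; by transitivity they are all darts. The last three
  rotations are rewritten as half-turned darts of neighbouring hexagons, so that only the vertex
  classes \<open>pp\<close>, \<open>qq\<close>, \<open>ww\<close> occur.\<close>

lemma cover: "x \<in> \<Omega> \<Longrightarrow> \<exists>a b. x \<in> {pos a b, R (pos a b), R (R (pos a b)), A (pos a b), A (R (pos a b)), A (R (R (pos a b)))}"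
proof -
  define S where "S = {y. \<exists>a b. y \<in> {pos a b, R (pos a b), R (R (pos a b)), R (R (R (pos a b))),
    R (R (R (R (pos a b)))), R (R (R (R (R (pos a b)))))}}"
  have "S \<subseteq> \<Omega>" unfolding S_def using o0 by auto
  moreover have "S \<noteq> {}" unfolding S_def by blast
  moreover have RS: "R y \<in> S" if "y \<in> S" for y using that R6 unfolding S_def by fastforce
  moreover have TS: "T c d y \<in> S" if y: "y \<in> S" for c d y
  proof -
    have "\<exists>c' d'. T c d (R z) = R (T c' d' z)" for c d z
      using R_T[of "- d" "c + d" z] by (intro exI[of _ "- d"] exI[of _ "c + d"]) simp
    then have k: "\<exists>c' d'. T c d (R z) = R (T c' d' z)" for c d z by blast
    have base: "pos a b \<in> S" for a b unfolding S_def by blast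
    obtain a b where ab: "y \<in> {pos a b, R (pos a b), R (R (pos a b)), R (R (R (pos a b))),
      R (R (R (R (pos a b)))), R (R (R (R (R (pos a b)))))}" using y unfolding S_def by blast
    have 0: "T c d (pos a b) \<in> S" for c d using base by (simp add: T_add)
    have 1: "T c d (R (pos a b)) \<in> S" for c d using k 0 RS by metis
    have 2: "T c d (R (R (pos a b))) \<in> S" for c d using k 1 RS by metis
    have 3: "T c d (R (R (R (pos a b)))) \<in> S" for c d using k 2 RS by metis
    have 4: "T c d (R (R (R (R (pos a b))))) \<in> S" for c d using k 3 RS by metis
    have 5: "T c d (R (R (R (R (R (pos a b)))))) \<in> S" for c d using k 4 RS by metis
    show ?thesis using ab 0 1 2 3 4 5 by blast
  qed
  moreover have "A y \<in> S" if "y \<in> S" for y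
  proof -
    have "T 1 0 y \<in> S" using TS \<open>y \<in> S\<close> by simp
    then have "R (R (R (T 1 0 y))) \<in> S" by (intro RS)
    then show ?thesis using A_X[of y] by simp
  qed
  ultimately have "S = \<Omega>" by (intro trans) blast+
  moreover assume "x \<in> \<Omega>"
  ultimately obtain a b where ab: "x \<in> {pos a b, R (pos a b), R (R (pos a b)), R (R (R (pos a b))),
      R (R (R (R (pos a b)))), R (R (R (R (R (pos a b)))))}" unfolding S_def by blast
  have "R (R (R (pos a b))) = A (pos (a - 1) b)" using A_pos[of "a - 1" b] by simp
  moreover have "R (R (R (R (pos a b)))) = A (R (pos a (b - 1)))" using AR_pos[of a "b - 1"] by simp
  moreover have "R (R (R (R (R (pos a b))))) = A (R (R (pos (a + 1) (b - 1))))" using ARR_pos[of "a + 1" "b - 1"] by simp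
  ultimately show ?thesis using ab by (metis insert_iff empty_iff)
qed

definition pp where "pp a b = vt (pos a b)"
definition qq where "qq a b = vt (R (pos a b))"
definition ww where "ww a b = vt (R (R (pos a b)))"

lemma vt3_pos: "vt (R (R (R (pos a b)))) = pp (a - 1) b"
  using vt_eq[of "pos (a - 1) b" "A (pos (a - 1) b)"] o0 in_A A_pos[of "a - 1" b] by (simp add: pp_def)

lemma vt4_pos: "vt (R (R (R (R (pos a b))))) = qq a (b - 1)"
  using vt_eq[of "R (pos a (b - 1))" "A (R (pos a (b - 1)))"] o0 in_A AR_pos[of a "b - 1"] by (simp add: qq_def)

lemma vt5_pos: "vt (R (R (R (R (R (pos a b)))))) = ww (a + 1) (b - 1)"
  using vt_eq[of "R (R (pos (a + 1) (b - 1)))" "A (R (R (pos (a + 1) (b - 1))))"] o0 in_A ARR_pos[of "a + 1" "b - 1"] by (simp add: ww_def)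

text \<open>Two darts at the same vertex are equal or differ by \<open>A\<close>, which is a
  rotation up to translation. The exclusion of rotations among the translates thus gives both
  injectivity modulo the lattice and disjointness of the three vertex classes.\<close>

lemma kagome_lattice:
  assumes "\<And>x. x \<in> \<Omega> \<Longrightarrow> {vt x, vt (R x)} \<in> E"
  shows "kagome_lattice pp qq ww (\<lambda>a b. pos a b = o0) (vt ` \<Omega>) E"
proof (rule kagome_lattice.intro)
  show "finite (vt ` \<Omega>)" using fin by simp
  show "pos (a + c) (b + d) = o0" if "pos a b = o0" "pos c d = o0" for a b c d
    using that T_add[of a b c d o0] by simp
  show "pos (- a) (- b) = o0" if "pos a b = o0" for a b
    using that T_add[of "- a" "- b" a b o0] by simp
  show "pp a b = pp c d \<longleftrightarrow> pos (a - c) (b - d) = o0" for a b c d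
  proof -
    have "pos c d \<noteq> A (pos a b)" unfolding A_pos using pos_no(3) by blast
    then show ?thesis unfolding pp_def pos_lattice[symmetric] using vt_eq[of "pos a b" "pos c d"] o0 by auto
  qed
  show "qq a b = qq c d \<longleftrightarrow> pos (a - c) (b - d) = o0" for a b c d
  proof -
    have "R (pos c d) \<noteq> A (R (pos a b))" unfolding AR_pos R_cancel using pos_no(3) by blast
    then show ?thesis unfolding qq_def pos_lattice[symmetric] using vt_eq[of "R (pos a b)" "R (pos c d)"] o0 R_cancel by auto
  qed
  show "ww a b = ww c d \<longleftrightarrow> pos (a - c) (b - d) = o0" for a b c d
  proof -
    have "R (R (pos c d)) \<noteq> A (R (R (pos a b)))" unfolding ARR_pos R_cancel using pos_no(3) by blast
    then show ?thesis unfolding ww_def pos_lattice[symmetric]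
      using vt_eq[of "R (R (pos a b))" "R (R (pos c d))"] o0 R_cancel by auto
  qed
  show "pp a b \<noteq> qq c d" for a b c d
  proof -
    have "R (pos c d) \<noteq> A (pos a b)" unfolding A_pos R_cancel using pos_no(2) by blast
    moreover have "R (pos c d) \<noteq> pos a b" using pos_no(1) by metis
    ultimately show ?thesis unfolding pp_def qq_def using vt_eq[of "pos a b" "R (pos c d)"] o0 by simp
  qed
  show "pp a b \<noteq> ww c d" for a b c d
  proof -
    have "R (R (pos c d)) \<noteq> A (pos a b)" unfolding A_pos R_cancel using pos_no(1) by blast
    moreover have "R (R (pos c d)) \<noteq> pos a b" using pos_no(2) by metis
    ultimately show ?thesis unfolding pp_def ww_def using vt_eq[of "pos a b" "R (R (pos c d))"] o0 by simp
  qed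
  show "qq a b \<noteq> ww c d" for a b c d
  proof -
    have "R (R (pos c d)) \<noteq> A (R (pos a b))" unfolding AR_pos R_cancel using pos_no(2) by blast
    moreover have "R (R (pos c d)) \<noteq> R (pos a b)" unfolding R_cancel using pos_no(1) by metis
    ultimately show ?thesis unfolding qq_def ww_def using vt_eq[of "R (pos a b)" "R (R (pos c d))"] o0 by simp
  qed
  show "vt ` \<Omega> = {pp a b | a b. True} \<union> {qq a b | a b. True} \<union> {ww a b | a b. True}"
  proof
    show "vt ` \<Omega> \<subseteq> {pp a b | a b. True} \<union> {qq a b | a b. True} \<union> {ww a b | a b. True}"
    proof
      fix v assume "v \<in> vt ` \<Omega>"
      then obtain x where x: "x \<in> \<Omega>" "v = vt x" by blast
      have vA: "vt (A y) = vt y" if "y \<in> \<Omega>" for y using vt_eq[of y "A y"] that in_A by simp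
      have po: "pos a b \<in> \<Omega>" "R (pos a b) \<in> \<Omega>" "R (R (pos a b)) \<in> \<Omega>" for a b using o0 by simp_all
      obtain a b where "x \<in> {pos a b, R (pos a b), R (R (pos a b)), A (pos a b), A (R (pos a b)), A (R (R (pos a b)))}"
        using cover[OF x(1)] by blast
      then have "v = pp a b \<or> v = qq a b \<or> v = ww a b"
        unfolding x(2) pp_def qq_def ww_def using vA[OF po(1)] vA[OF po(2)] vA[OF po(3)] by auto
      then show "v \<in> {pp a b | a b. True} \<union> {qq a b | a b. True} \<union> {ww a b | a b. True}" by blast
    qed
    show "{pp a b | a b. True} \<union> {qq a b | a b. True} \<union> {ww a b | a b. True} \<subseteq> vt ` \<Omega>"
      unfolding pp_def qq_def ww_def using o0 by auto
  qed
  note po = in_T[OF o0]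
  show "{pp a b, qq a b} \<in> E" for a b unfolding pp_def qq_def using assms po by blast
  show "{qq a b, ww a b} \<in> E" for a b unfolding qq_def ww_def using assms[of "R (pos a b)"] po in_R by simp
  show "{pp a b, ww (a + 1) b} \<in> E" for a b
    using assms[of "R (R (pos (a + 1) b))"] po in_R vt3_pos[of "a + 1" b] by (simp add: ww_def insert_commute)
  show "{pp a b, qq (a + 1) (b - 1)} \<in> E" for a b
    using assms[of "R (R (R (pos (a + 1) b)))"] po in_R vt3_pos[of "a + 1" b] vt4_pos[of "a + 1" b] by simp
  show "{pp a b, ww (a + 1) (b - 1)} \<in> E" for a b
    using assms[of "R (R (R (R (R (pos a b)))))"] po in_R vt5_pos[of a b] by (simp add: pp_def R6 insert_commute)
  show "{qq a b, ww (a + 1) b} \<in> E" for a b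
    using assms[of "R (R (R (R (pos a (b + 1)))))"] po in_R vt4_pos[of a "b + 1"] vt5_pos[of a "b + 1"] by simp
  show "pos 1 0 \<noteq> o0"
  proof
    assume "pos 1 0 = o0"
    then have "vt (R (R (R o0))) = vt o0" using A_X[of o0] vt_eq[of o0 "A o0"] o0 in_A by simp
    then show False using vt3[OF o0] by simp
  qed
qed

end

text \<open>The exceptional case of \<open>hamiltonian_rows\<close> disappears after turning the
  coordinates: from the dart \<open>R o0\<close>, the period \<open>(-1, s)\<close> reads
  \<open>(s - 1, 1)\<close>, so that there is only one row.\<close>

lemma hamiltonian_rotations:
  assumes "\<And>x. x \<in> \<Omega> \<Longrightarrow> {vt x, vt (R x)} \<in> E"
  shows "hamiltonian (vt ` \<Omega>) E"
proof -
  have single: "hamiltonian (vt ` \<Omega>) E" if o0: "o0 \<in> \<Omega>" "T k 1 o0 = o0" for o0 k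
  proof -
    interpret kagome_lattice "pp o0" "qq o0" "ww o0" "\<lambda>a b. T a b o0 = o0" "vt ` \<Omega>" E
      by (rule kagome_lattice[OF o0(1) assms])
    have "s = 1" unfolding s_def by (rule Least_equality) (use o0(2) in auto)
    then show ?thesis by (intro hamiltonian_rows) simp
  qed
  obtain o0 where o0: "o0 \<in> \<Omega>" using ne by blast
  interpret kagome_lattice "pp o0" "qq o0" "ww o0" "\<lambda>a b. T a b o0 = o0" "vt ` \<Omega>" E
    by (rule kagome_lattice[OF o0 assms])
  show ?thesis
  proof (cases "T 1 (- int s) o0 = o0")
    case True
    then have "T (- 1) (int s) o0 = o0" using L_neg[of 1 "- int s"] by simp
    then have "T (int s - 1) 1 (R o0) = R o0" using R_T[of "- 1" "int s" o0] by simp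
    then show ?thesis using single[of "R o0"] o0 by simp
  next
    case False
    then show ?thesis by (intro hamiltonian_rows) simp
  qed
qed

end

section \<open>Directed hexagon edges in the type \<open>{6, 3, 6, 3}\<close>\<close>

context polygonal_map
begin

lemma dsix_ex:
  assumes "sz g = 6" "dd g a b"
  shows "\<exists>c d e f. distinct [a, b, c, d, e, f] \<and> dd g b c \<and> dd g c d \<and> dd g d e \<and> dd g e f \<and> dd g f a"
proof -
  obtain c' where c': "darts c' = darts (cyc g)" "length c' = sz g"
    "distinct c'" "c' \<noteq> []" "hd c' = b" "last c' = a" "g \<in> F" using dart_rotation[OF assms(2)] by blast
  have "length c' = Suc (Suc (Suc (Suc (Suc (Suc 0)))))" using assms(1) c'(2) by simp
  then obtain x c d e f z where "c' = [x, c, d, e, f, z]" by (auto simp: length_Suc_conv)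
  then have c: "c' = [b, c, d, e, f, a]" using c' by simp
  have dg: "darts (cyc g) = {(a, b), (b, c), (c, d), (d, e), (e, f), (f, a)}"
    using c'(1)[symmetric] c by (auto simp: darts_def)
  have dist: "distinct [a, b, c, d, e, f]" using c'(3) unfolding c by simp metis
  have "dd g b c \<and> dd g c d \<and> dd g d e \<and> dd g e f \<and> dd g f a" using dg c'(7) unfolding dd_def by simp
  then show ?thesis using dist by blast
qed

text \<open>By coherence, outgoing and incoming hexagon edges alternate around a vertex, so every
  triangle has one of each at each corner. Therefore \<open>R A\<close> moves a dart from corner to
  corner of a triangle and returns after three applications, which is the relation
  \<open>RA3\<close>.\<close>

lemma hamiltonian_6363:
  assumes as: "as = [6, 3, 6, 3]"
  shows "hamiltonian V E"
proof -
  have EV: "u \<in> V \<and> v \<in> V \<and> u \<noteq> v" if "{u, v} \<in> E" for u v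
    using edgeE[OF that] by (auto simp: doubleton_eq_iff)
  define hd6 where "hd6 g u v \<longleftrightarrow> sz g = 6 \<and> dd g u v" for g u v
  define tri where "tri t u v \<longleftrightarrow> sz t = 3 \<and> ed t u v" for t u v
  have tri_sym: "tri t u v \<longleftrightarrow> tri t v u" for t u v unfolding tri_def using ed_comm by blast
  have hd6_E: "{u, v} \<in> E" "u \<in> V" "v \<in> V" "u \<noteq> v" if "hd6 g u v" for g u v
    using that ed_E(1) EV unfolding hd6_def ed_dd by blast+
  have triE: "{u, v} \<in> E" if "tri t u v" for t u v using that ed_E(1) unfolding tri_def by blast
  have local: "\<exists>a b c d h h' t t'. distinct [a, b, c, d] \<and> h \<noteq> h' \<and> t \<noteq> t' \<and> (\<forall>x. {v, x} \<in> E \<longleftrightarrow> x \<in> {a, b, c, d}) \<and>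
      (\<forall>g x. hd6 g v x \<longleftrightarrow> g = h \<and> x = a \<or> g = h' \<and> x = c) \<and>
      (\<forall>g x. hd6 g x v \<longleftrightarrow> g = h \<and> x = b \<or> g = h' \<and> x = d) \<and>
      (\<forall>f x. tri f v x \<longleftrightarrow> f = t \<and> (x = b \<or> x = c) \<or> f = t' \<and> (x = d \<or> x = a))"
    if v: "v \<in> V" for v
  proof -
    obtain n0 n1 n2 n3 f0 f1 f2 f3 where s: "distinct [n0, n1, n2, n3]" "distinct [f0, f1, f2, f3]"
      "sz f0 = 6 \<and> sz f1 = 3 \<and> sz f2 = 6 \<and> sz f3 = 3" "\<forall>x. {v, x} \<in> E \<longleftrightarrow> x \<in> {n0, n1, n2, n3}"
      "\<forall>f x. ed f v x \<longleftrightarrow> f = f0 \<and> x \<in> {n0, n1} \<or> f = f1 \<and> x \<in> {n1, n2} \<or> f = f2 \<and> x \<in> {n2, n3}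
        \<or> f = f3 \<and> x \<in> {n3, n0}"
      using star4[OF v as] by (elim exE conjE) blast
    have 3: "\<forall>f x. tri f v x \<longleftrightarrow> f = f1 \<and> (x = n1 \<or> x = n2) \<or> f = f3 \<and> (x = n3 \<or> x = n0)"
      using s(3,5) unfolding tri_def by auto
    have 6: "sz g = 6 \<and> ed g v x \<longleftrightarrow> g = f0 \<and> (x = n0 \<or> x = n1) \<or> g = f2 \<and> (x = n2 \<or> x = n3)" for g x
      using s(3,5) by auto
    have e: "ed f0 v n0" "ed f0 v n1" "ed f1 v n1" "ed f1 v n2" "ed f2 v n2" "ed f2 v n3"
      using s(5) by auto
    have ne: "n0 \<noteq> n1" "n1 \<noteq> n2" "n2 \<noteq> n3" "f0 \<noteq> f1" "f1 \<noteq> f2" using s(1,2) by auto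
    have o0: "dd f0 v n0 \<longleftrightarrow> \<not> dd f0 v n1" using corner_orient[OF e(1,2)] ne by blast
    have "dd f0 v n1 \<longleftrightarrow> \<not> dd f1 v n1" using edge_orient[OF e(2,3)] ne by blast
    moreover have "dd f1 v n1 \<longleftrightarrow> \<not> dd f1 v n2" using corner_orient[OF e(3,4)] ne by blast
    moreover have "dd f1 v n2 \<longleftrightarrow> \<not> dd f2 v n2" using edge_orient[OF e(4,5)] ne by blast
    ultimately have o2: "dd f0 v n0 \<longleftrightarrow> dd f2 v n2" using o0 by blast
    have o3: "dd f2 v n2 \<longleftrightarrow> \<not> dd f2 v n3" using corner_orient[OF e(5,6)] ne by blast
    have out: "hd6 g v x \<longleftrightarrow> (g = f0 \<and> (x = n0 \<or> x = n1) \<or> g = f2 \<and> (x = n2 \<or> x = n3)) \<and> dd g v x" for g x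
      using 6[of g x] unfolding hd6_def ed_dd by blast
    have inn: "hd6 g x v \<longleftrightarrow> (g = f0 \<and> (x = n0 \<or> x = n1) \<or> g = f2 \<and> (x = n2 \<or> x = n3)) \<and> \<not> dd g v x" for g x
      using 6[of g x] dd_asym[of g v x] unfolding hd6_def ed_dd by blast
    show ?thesis
    proof (cases "dd f0 v n0")
      case True
      show ?thesis
        by (rule exI[of _ n0], rule exI[of _ n1], rule exI[of _ n2], rule exI[of _ n3],
          rule exI[of _ f0], rule exI[of _ f2], rule exI[of _ f1], rule exI[of _ f3])
          (use s(1,2,4) 3 out inn True o0 o2 o3 in auto)
    next
      case False
      show ?thesis
        by (rule exI[of _ n1], rule exI[of _ n0], rule exI[of _ n3], rule exI[of _ n2],
          rule exI[of _ f0], rule exI[of _ f2], rule exI[of _ f3], rule exI[of _ f1])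
          (use s(1,2,4) 3 out inn False o0 o2 o3 in auto)
    qed
  qed
  \<comment> \<open>A hexagon and a triangle never share two edges at a vertex. Below this separates
    the successor on a hexagon from the third corner of a triangle.\<close>
  have no_share: False if g: "hd6 g v x \<or> hd6 g x v" "hd6 g v y \<or> hd6 g y v" "tri t v x" "tri t v y" "x \<noteq> y" for g t v x y
  proof -
    have "v \<in> V" using g(1) hd6_E by blast
    from local[OF this] obtain a b c d h h' t1 t2 where L: "distinct [a, b, c, d]" "h \<noteq> h'" "t1 \<noteq> t2"
      "\<forall>g x. hd6 g v x \<longleftrightarrow> g = h \<and> x = a \<or> g = h' \<and> x = c"
      "\<forall>g x. hd6 g x v \<longleftrightarrow> g = h \<and> x = b \<or> g = h' \<and> x = d"
      "\<forall>f x. tri f v x \<longleftrightarrow> f = t1 \<and> (x = b \<or> x = c) \<or> f = t2 \<and> (x = d \<or> x = a)" by (elim exE conjE)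
    have *: "hd6 g v x \<or> hd6 g x v \<longleftrightarrow> g = h \<and> (x = a \<or> x = b) \<or> g = h' \<and> (x = c \<or> x = d)" for g x
      unfolding L(4)[rule_format] L(5)[rule_format] by argo
    have "g = h \<and> (x = a \<or> x = b) \<or> g = h' \<and> (x = c \<or> x = d)" using g(1) unfolding * .
    moreover have "g = h \<and> (y = a \<or> y = b) \<or> g = h' \<and> (y = c \<or> y = d)" using g(2) unfolding * .
    moreover have "t = t1 \<and> (x = b \<or> x = c) \<or> t = t2 \<and> (x = d \<or> x = a)" using g(3) L(6) by blast
    moreover have "t = t1 \<and> (y = b \<or> y = c) \<or> t = t2 \<and> (y = d \<or> y = a)" using g(4) L(6) by blast
    ultimately show False using g(5) L(1,2,3) by auto
  qed
  have other_hex: "\<exists>g. hd6 g v x \<or> hd6 g x v" if t: "{v, x} \<in> E" for v x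
  proof -
    have "v \<in> V" using t EV by blast
    from local[OF this] obtain a b c d h h' where L: "\<forall>x. {v, x} \<in> E \<longleftrightarrow> x \<in> {a, b, c, d}"
      "\<forall>g x. hd6 g v x \<longleftrightarrow> g = h \<and> x = a \<or> g = h' \<and> x = c"
      "\<forall>g x. hd6 g x v \<longleftrightarrow> g = h \<and> x = b \<or> g = h' \<and> x = d" by (elim exE conjE)
    have "x = a \<or> x = b \<or> x = c \<or> x = d" using t L(1) by simp
    then show ?thesis using L(2,3) by blast
  qed
  define \<Omega> where "\<Omega> = {(u, v). \<exists>g. hd6 g u v}"
  \<comment> \<open>Outside \<Omega> both maps are the identity, so that the equations of the locale
    hold for all pairs of vertices.\<close>
  define R where "R x = (if x \<in> \<Omega> then (snd x, THE w. \<exists>g. hd6 g (fst x) (snd x) \<and> hd6 g (snd x) w) else x)" for x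
  define A where "A x = (if x \<in> \<Omega> then (fst x, THE c. c \<noteq> snd x \<and> (fst x, c) \<in> \<Omega>) else x)" for x
  have R_eq: "R (u, v) = (v, w)" if g: "hd6 g u v" "hd6 g v w" for g u v w
  proof -
    have "(THE w. \<exists>g. hd6 g u v \<and> hd6 g v w) = w"
    proof (rule the_equality)
      show "\<exists>g. hd6 g u v \<and> hd6 g v w" using g by blast
      show "w' = w" if "\<exists>g. hd6 g u v \<and> hd6 g v w'" for w'
        using that g dd_face dd_out unfolding hd6_def by blast
    qed
    moreover have "(u, v) \<in> \<Omega>" using g unfolding \<Omega>_def by blast
    ultimately show ?thesis unfolding R_def by simp
  qed
  have A_eq: "A (v, a) = (v, c)" if g: "hd6 g v a" "hd6 g' v c" "a \<noteq> c" for g g' v a c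
  proof -
    have "v \<in> V" using g(1) hd6_E by blast
    from local[OF this] obtain a' c' h h' where L: "\<forall>g x. hd6 g v x \<longleftrightarrow> g = h \<and> x = a' \<or> g = h' \<and> x = c'" by (elim exE conjE)
    have "(THE c. c \<noteq> a \<and> (v, c) \<in> \<Omega>) = c"
    proof (rule the_equality)
      show "c \<noteq> a \<and> (v, c) \<in> \<Omega>" using g unfolding \<Omega>_def by blast
      show "c'' = c" if c'': "c'' \<noteq> a \<and> (v, c'') \<in> \<Omega>" for c''
      proof -
        have *: "x = a' \<or> x = c'" if "hd6 g v x" for g x using that unfolding L[rule_format] by blast
        obtain g'' where "hd6 g'' v c''" using c'' unfolding \<Omega>_def by blast
        from *[OF this] *[OF g(1)] *[OF g(2)] show ?thesis using g(3) c'' by auto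
      qed
    qed
    moreover have "(v, a) \<in> \<Omega>" using g unfolding \<Omega>_def by blast
    ultimately show ?thesis unfolding A_def by simp
  qed
  have hexagon: "\<exists>u x2 x3 x4. distinct [v, a, u, x2, x3, x4] \<and> hd6 g a u \<and> hd6 g u x2 \<and> hd6 g x2 x3 \<and> hd6 g x3 x4 \<and> hd6 g x4 v"
    if g: "hd6 g v a" for g v a
    using dsix_ex[of g v a] g unfolding hd6_def by simp
  have outs: "\<exists>b c d h h' t. distinct [a, b, c, d] \<and> hd6 h v a \<and> hd6 h b v \<and> hd6 h' v c \<and> hd6 h' d v \<and> tri t v b \<and> tri t v c \<and>
      (\<forall>x. {v, x} \<in> E \<longleftrightarrow> x \<in> {a, b, c, d}) \<and> (\<forall>g x. hd6 g v x \<longrightarrow> x = a \<or> x = c)"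
    if g: "hd6 g v a" for g v a
  proof -
    have "v \<in> V" using g hd6_E by blast
    from local[OF this] obtain a' b c d h h' t t' where L: "distinct [a', b, c, d]"
      "\<forall>x. {v, x} \<in> E \<longleftrightarrow> x \<in> {a', b, c, d}"
      "\<forall>g x. hd6 g v x \<longleftrightarrow> g = h \<and> x = a' \<or> g = h' \<and> x = c"
      "\<forall>g x. hd6 g x v \<longleftrightarrow> g = h \<and> x = b \<or> g = h' \<and> x = d"
      "\<forall>f x. tri f v x \<longleftrightarrow> f = t \<and> (x = b \<or> x = c) \<or> f = t' \<and> (x = d \<or> x = a')" by (elim exE conjE)
    have "a = a' \<or> a = c" using g unfolding L(3)[rule_format] by (elim disjE conjE) simp_all
    then show ?thesis
    proof
      assume a: "a = a'"
      show ?thesis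
        by (rule exI[of _ b], rule exI[of _ c], rule exI[of _ d], rule exI[of _ h], rule exI[of _ h'], rule exI[of _ t])
          (use L a in simp)
    next
      assume a: "a = c"
      have "distinct [c, d, a', b]" using L(1) by auto
      moreover have "{a', b, c, d} = {c, d, a', b}" by auto
      ultimately show ?thesis
        by (intro exI[of _ d] exI[of _ a'] exI[of _ b]) (rule exI[of _ h'], rule exI[of _ h], rule exI[of _ t'],
          use L a in simp)
    qed
  qed
  have \<Omega>E: "\<exists>g. hd6 g (fst x) (snd x)" if "x \<in> \<Omega>" for x using that unfolding \<Omega>_def by auto
  interpret rotations R A \<Omega> fst
  proof (rule rotations.intro)
    have R6': "R (R (R (R (R (R x))))) = x \<and> fst (R x) \<noteq> fst x \<and> fst (R (R x)) \<noteq> fst x \<and> fst (R (R (R x))) \<noteq> fst x \<and> R x \<in> \<Omega>"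
      if x: "x \<in> \<Omega>" for x
    proof -
      obtain g where g: "hd6 g (fst x) (snd x)" using \<Omega>E[OF x] by blast
      define v a where "v = fst x" and "a = snd x"
      have xe: "x = (v, a)" by (simp add: v_def a_def)
      have g: "hd6 g v a" using g by (simp add: v_def a_def)
      obtain u x2 x3 x4 where h: "distinct [v, a, u, x2, x3, x4]" "hd6 g a u" "hd6 g u x2" "hd6 g x2 x3" "hd6 g x3 x4" "hd6 g x4 v"
        using hexagon[OF g] by (elim exE conjE)
      have r: "R (v, a) = (a, u)" "R (a, u) = (u, x2)" "R (u, x2) = (x2, x3)" "R (x2, x3) = (x3, x4)"
        "R (x3, x4) = (x4, v)" "R (x4, v) = (v, a)"
        using R_eq g h(2-6) by blast+
      have "(a, u) \<in> \<Omega>" using h(2) unfolding \<Omega>_def by blast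
      then show ?thesis unfolding xe r fst_conv using h(1) by auto
    qed
    have A': "A (A x) = x \<and> A x \<in> \<Omega> \<and> A x \<noteq> x \<and> fst (A x) = fst x \<and> (\<forall>y\<in>\<Omega>. fst x = fst y \<longrightarrow> y = x \<or> y = A x) \<and>
        R (A (R (A (R (A x))))) = x" if x: "x \<in> \<Omega>" for x
    proof -
      obtain g where g: "hd6 g (fst x) (snd x)" using \<Omega>E[OF x] by blast
      define v a where "v = fst x" and "a = snd x"
      have xe: "x = (v, a)" by (simp add: v_def a_def)
      have g: "hd6 g v a" using g by (simp add: v_def a_def)
      obtain b c d h h' t where o: "distinct [a, b, c, d]" "hd6 h v a" "hd6 h b v" "hd6 h' v c" "tri t v b" "tri t v c"
        "\<forall>g x. hd6 g v x \<longrightarrow> x = a \<or> x = c" using outs[OF g] by (elim exE conjE)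
      have ne: "a \<noteq> c" "b \<noteq> c" using o(1) by auto
      have a1: "A (v, a) = (v, c)" "A (v, c) = (v, a)" using A_eq[OF o(2,4)] A_eq[OF o(4,2)] ne by simp_all
      have cO: "(v, c) \<in> \<Omega>" using o(4) unfolding \<Omega>_def by blast
      obtain c2 where c2: "hd6 h' c c2" using hexagon[OF o(4)] by blast
      have r1: "R (v, c) = (c, c2)" using R_eq[OF o(4) c2] .
      have tcb: "tri t c b" using triangle_closed[of t v c b] o(5,6) ne(2) unfolding tri_def by simp
      have t': "ed t v b" "ed t v c" "sz t = 3" "ed t c b" "ed t c v" "ed h' v c" "h' \<noteq> t"
        using o(4,5,6) tcb ed_sym unfolding tri_def hd6_def ed_dd by auto
      \<comment> \<open>Directions are carried around the triangle \<open>v c b\<close> to see that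
        the hexagon beyond \<open>cb\<close> runs from \<open>c\<close> to \<open>b\<close>.\<close>
      have "\<not> dd t v c" using edge_orient[OF t'(6,2,7)] o(4) unfolding hd6_def by blast
      then have dtcv: "dd t c v" using t'(2) unfolding ed_dd by blast
      have "v \<noteq> b" using hd6_E(4)[OF o(3)] by blast
      then have ntcb: "\<not> dd t c b" using corner_orient[OF t'(5,4)] dtcv by blast
      have "{c, b} \<in> E" using triE[OF tcb] .
      then obtain k where k: "hd6 k c b \<or> hd6 k b c" using other_hex by blast
      then have k': "ed k c b" "k \<noteq> t" using t'(3) unfolding hd6_def ed_dd by auto
      have "dd k c b" using edge_orient[OF k'(1) t'(4) k'(2)] ntcb by blast
      then have kcb: "hd6 k c b" using k unfolding hd6_def by blast
      have "b \<noteq> c2"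
      proof
        assume b: "b = c2"
        have "tri t c v" using o(6) tri_sym by blast
        then show False using no_share[of h' c v b t] o(4) c2 b tcb \<open>v \<noteq> b\<close> by blast
      qed
      then have a2: "A (c, c2) = (c, b)" using A_eq[OF c2 kcb] by blast
      obtain b2 where b2: "hd6 k b b2" using hexagon[OF kcb] by blast
      have r2: "R (c, b) = (b, b2)" using R_eq[OF kcb b2] .
      have "b2 \<noteq> v"
      proof
        assume b: "b2 = v"
        have "k = h" using dd_face[of k b v h] b2 o(3) b unfolding hd6_def by blast
        moreover have "tri t b v" "tri t b c" using o(5) tcb tri_sym by blast+
        moreover have "c \<noteq> v" using hd6_E(4)[OF o(4)] by blast
        ultimately show False using no_share[of h b v c t] o(3) kcb by blast
      qed
      then have a3: "A (b, b2) = (b, v)" using A_eq[OF b2 o(3)] by blast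
      have r3: "R (b, v) = (v, a)" using R_eq[OF o(3,2)] .
      have al: "\<forall>y\<in>\<Omega>. v = fst y \<longrightarrow> y = (v, a) \<or> y = (v, c)"
      proof (intro ballI impI)
        fix y assume y: "y \<in> \<Omega>" "v = fst y"
        then have "snd y = a \<or> snd y = c" using \<Omega>E[OF y(1)] o(7) by auto
        then show "y = (v, a) \<or> y = (v, c)" using y(2) by (auto simp: prod_eq_iff)
      qed
      show ?thesis unfolding xe a1 r1 a2 r2 a3 r3 fst_conv using cO ne(1) al by simp
    qed
    show R6: "R (R (R (R (R (R x))))) = x" for x
    proof (cases "x \<in> \<Omega>")
      case False
      then have "R x = x" by (simp add: R_def)
      then show ?thesis by simp
    qed (use R6' in blast)
    show "A (A x) = x" for x
    proof (cases "x \<in> \<Omega>")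
      case False
      then have "A x = x" by (simp add: A_def)
      then show ?thesis by simp
    qed (use A' in blast)
    show "R (A (R (A (R (A x))))) = x" for x
    proof (cases "x \<in> \<Omega>")
      case False
      then have "A x = x" "R x = x" by (simp_all add: A_def R_def)
      then show ?thesis by simp
    qed (use A' in blast)
    show "R x \<in> \<Omega>" if "x \<in> \<Omega>" for x using R6'[OF that] by blast
    show "A x \<in> \<Omega>" if "x \<in> \<Omega>" for x using A'[OF that] by blast
    show "fst x = fst y \<longleftrightarrow> y = x \<or> y = A x" if "x \<in> \<Omega>" "y \<in> \<Omega>" for x y using A'[OF that(1)] that(2) by auto
    show "A x \<noteq> x" if "x \<in> \<Omega>" for x using A'[OF that] by blast
    show "fst (R x) \<noteq> fst x" if "x \<in> \<Omega>" for x using R6'[OF that] by blast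
    show "fst (R (R x)) \<noteq> fst x" if "x \<in> \<Omega>" for x using R6'[OF that] by blast
    show "fst (R (R (R x))) \<noteq> fst x" if "x \<in> \<Omega>" for x using R6'[OF that] by blast
    have "\<Omega> \<subseteq> V \<times> V" using hd6_E unfolding \<Omega>_def by blast
    then show "finite \<Omega>" using finV finite_subset by blast
    have out_ex: "\<exists>g a. hd6 g v a" if "v \<in> V" for v
    proof -
      from local[OF that] obtain a h c h' where "\<forall>g x. hd6 g v x \<longleftrightarrow> g = h \<and> x = a \<or> g = h' \<and> x = c" by (elim exE conjE)
      then show ?thesis by blast
    qed
    show "\<Omega> \<noteq> {}" using Vne out_ex unfolding \<Omega>_def by blast
    show "S = \<Omega>" if S: "S \<subseteq> \<Omega>" "S \<noteq> {}" "\<And>x. x \<in> S \<Longrightarrow> R x \<in> S \<and> A x \<in> S" for S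
    proof -
      define U where "U = fst ` S"
      have U1: "U \<subseteq> V" unfolding U_def using S(1) hd6_E(2) unfolding \<Omega>_def by auto
      have U2: "U \<noteq> {}" unfolding U_def using S(2) by blast
      have all: "y \<in> S" if y: "y \<in> \<Omega>" "fst y \<in> U" for y
      proof -
        obtain x where x: "x \<in> S" "fst x = fst y" using y(2) unfolding U_def by auto
        then have "y = x \<or> y = A x" using A'[of x] S(1) y(1) by blast
        then show ?thesis using x(1) S(3) by blast
      qed
      \<comment> \<open>Along a hexagon edge, \<open>R\<close> or its inverse, the fifth power,
        leads to a dart at the other end; so \<open>U\<close> is closed under adjacency.\<close>
      have "w \<in> U" if uw: "u \<in> U" "{u, w} \<in> E" for u w
      proof -
        obtain g a where ga: "hd6 g u a" using out_ex uw(1) U1 by blast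
        obtain g' where "hd6 g' u w \<or> hd6 g' w u" using other_hex[OF uw(2)] by blast
        then show ?thesis
        proof
          assume h: "hd6 g' u w"
          then have "(u, w) \<in> \<Omega>" unfolding \<Omega>_def by blast
          then have "(u, w) \<in> S" using all uw(1) by simp
          then have "R (u, w) \<in> S" using S(3) by blast
          moreover obtain z where "hd6 g' w z" using hexagon[OF h] by blast
          then have "R (u, w) = (w, z)" using R_eq[OF h] by blast
          ultimately show ?thesis unfolding U_def by force
        next
          assume h: "hd6 g' w u"
          then have wu: "(w, u) \<in> \<Omega>" unfolding \<Omega>_def by blast
          obtain z where z: "hd6 g' u z" using hexagon[OF h] by blast
          have r: "R (w, u) = (u, z)" using R_eq[OF h z] .
          have "(u, z) \<in> \<Omega>" using z unfolding \<Omega>_def by blast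
          then have "(u, z) \<in> S" using all uw(1) by simp
          then have "R (R (R (R (R (u, z))))) \<in> S" using S(3) by blast
          then have "(w, u) \<in> S" using R6[of "(w, u)"] unfolding r by simp
          then show ?thesis unfolding U_def by force
        qed
      qed
      then have "U = V" using conn[OF U1 U2] by blast
      then have "fst y \<in> U" if "y \<in> \<Omega>" for y using \<Omega>E[OF that] hd6_E(2) by blast
      then show ?thesis using all S(1) by blast
    qed
  qed
  have "fst ` \<Omega> = V"
  proof
    show "fst ` \<Omega> \<subseteq> V" unfolding \<Omega>_def using hd6_E(2) by auto
    show "V \<subseteq> fst ` \<Omega>"
    proof
      fix v assume "v \<in> V"
      from local[OF this] obtain a h c h' where "\<forall>g x. hd6 g v x \<longleftrightarrow> g = h \<and> x = a \<or> g = h' \<and> x = c" by (elim exE conjE)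
      then have "(v, a) \<in> \<Omega>" unfolding \<Omega>_def by blast
      then show "v \<in> fst ` \<Omega>" by force
    qed
  qed
  moreover have "{fst x, fst (R x)} \<in> E" if x: "x \<in> \<Omega>" for x
  proof -
    have "fst (R x) = snd x" using x by (simp add: R_def)
    then show ?thesis using \<Omega>E[OF x] hd6_E(1) by auto
  qed
  ultimately show ?thesis using hamiltonian_rotations[of E] by simp
qed

theorem hamiltonian_semi_equivelar:
  assumes "as \<in> {[3, 3, 3, 4, 4], [3, 3, 4, 3, 4], [6, 3, 6, 3], [6, 4, 3, 4], [3, 3, 3, 3, 6], [4, 8, 8], [4, 6, 12]}"
  shows "hamiltonian V E"
  using assms hamiltonian_33344 hamiltonian_33434 hamiltonian_6363 hamiltonian_6434 hamiltonian_33336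
    hamiltonian_4bc[of 8 8] hamiltonian_4bc[of 6 12] by auto

end

section \<open>Lifting cells of the torus to the plane\<close>

definition torus_cover :: "complex \<Rightarrow> complex \<times> complex" where
  "torus_cover z = (cis (Re z), cis (Im z))"

definition period :: "complex \<Rightarrow> bool" where
  "period w \<longleftrightarrow> (\<exists>m::int. \<exists>n::int. w = Complex (2 * pi * m) (2 * pi * n))"

lemma torus_cover_in_torus: "torus_cover z \<in> torus"
  by (simp add: torus_cover_def torus_def)

lemma continuous_on_torus_cover: "continuous_on S torus_cover"
  unfolding torus_cover_def by (intro continuous_intros)

lemma cis_eq_iff: "cis a = cis b \<longleftrightarrow> (\<exists>n :: int. a - b = 2 * pi * n)"
proof -
  have "cis a = cis b \<longleftrightarrow> cis (a - b) = 1"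
    by (simp add: cis_divide[symmetric])
  also have "\<dots> \<longleftrightarrow> cos (a - b) = 1"
    by (auto simp: complex_eq_iff cos_one_sin_zero)
  also have "\<dots> \<longleftrightarrow> (\<exists>n :: int. a - b = 2 * pi * n)"
    by (auto simp: cos_one_2pi_int mult.commute mult.left_commute)
  finally show ?thesis .
qed

lemma torus_cover_eq_iff: "torus_cover z = torus_cover w \<longleftrightarrow> period (z - w)"
  unfolding torus_cover_def prod.inject cis_eq_iff period_def by (auto simp: complex_eq_iff)

lemma period_diff:
  assumes "period z" "period w"
  shows "period (z - w)"
proof -
  obtain m n m' n' :: int where "z = Complex (2 * pi * m) (2 * pi * n)" "w = Complex (2 * pi * m') (2 * pi * n')"
    using assms unfolding period_def by blast
  then have "z - w = Complex (2 * pi * (m - m')) (2 * pi * (n - n'))"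
    by (simp add: complex_eq_iff right_diff_distrib)
  then show ?thesis unfolding period_def by blast
qed

text \<open>The sharp bound is \<open>2 * pi\<close>; the value 1 is enough to make the periods
  discrete.\<close>

lemma period_norm:
  assumes "period w" "w \<noteq> 0"
  shows "1 \<le> norm w"
proof -
  obtain m n :: int where w: "Re w = 2 * pi * m" "Im w = 2 * pi * n" using assms(1) by (auto simp: period_def)
  have "m \<noteq> 0 \<or> n \<noteq> 0" using w assms(2) by (auto simp: complex_eq_iff)
  have *: "1 \<le> \<bar>2 * pi * real_of_int k\<bar>" if "k \<noteq> 0" for k
  proof -
    have "1 \<le> \<bar>real_of_int k\<bar>" using that by linarith
    moreover have "1 \<le> \<bar>2 * pi\<bar>" using pi_ge_two by simp
    ultimately show ?thesis unfolding abs_mult[of "2 * pi"] by (metis mult_1 mult_mono abs_ge_zero zero_le_one order_trans)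
  qed
  have "1 \<le> \<bar>Re w\<bar> \<or> 1 \<le> \<bar>Im w\<bar>" using *[of m] *[of n] w \<open>m \<noteq> 0 \<or> n \<noteq> 0\<close> by auto
  then show ?thesis using abs_Re_le_cmod[of w] abs_Im_le_cmod[of w] by linarith
qed

section \<open>Lifts to the universal cover\<close>

definition lift_on :: "(complex \<times> complex) set \<Rightarrow> (complex \<times> complex \<Rightarrow> complex) \<Rightarrow> bool" where
  "lift_on S g \<longleftrightarrow> continuous_on S g \<and> (\<forall>x\<in>S. torus_cover (g x) = x)"

lemma lift_on_subset: "lift_on S g \<Longrightarrow> T \<subseteq> S \<Longrightarrow> lift_on T g"
  unfolding lift_on_def using continuous_on_subset by blast

lemma lift_on_inj: "lift_on S g \<Longrightarrow> inj_on g S"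
  unfolding lift_on_def inj_on_def by metis

text \<open>Both coordinates of a point of the torus have norm 1, so the imaginary parts of
  continuous logarithms, which exist on a contractible set, are continuous angles.\<close>

lemma lift_exists:
  assumes "S \<subseteq> torus" "contractible S"
  obtains g where "lift_on S g"
proof -
  have n: "norm (fst x) = 1" "norm (snd x) = 1" if "x \<in> S" for x
    using assms(1) that by (auto simp: torus_def)
  obtain a where a: "continuous_on S a" "\<And>x. x \<in> S \<Longrightarrow> fst x = exp (a x)"
    using continuous_logarithm_on_contractible[of S fst] assms(2) n continuous_on_fst[OF continuous_on_id]
    by (metis norm_zero zero_neq_one)
  obtain b where b: "continuous_on S b" "\<And>x. x \<in> S \<Longrightarrow> snd x = exp (b x)"
    using continuous_logarithm_on_contractible[of S snd] assms(2) n continuous_on_snd[OF continuous_on_id]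
    by (metis norm_zero zero_neq_one)
  have "continuous_on S (\<lambda>x. Complex (Im (a x)) (Im (b x)))"
    unfolding Complex_eq by (intro continuous_intros a b)
  moreover have *: "exp z = cis (Im z)" if "norm (exp z) = 1" for z
    proof -
    have "Re z = 0" using that by (simp add: norm_exp_eq_Re)
    then show ?thesis by (simp add: exp_eq_polar)
  qed
  have "torus_cover (Complex (Im (a x)) (Im (b x))) = x" if "x \<in> S" for x
    using *[of "a x"] *[of "b x"] n[OF that] a(2)[OF that] b(2)[OF that]
    by (simp add: torus_cover_def prod_eq_iff)
  ultimately show thesis using that unfolding lift_on_def by blast
qed

text \<open>Near a point of \<open>g\<close> followed by \<open>torus_cover\<close> and back, the
  difference to the identity is continuous, has periods as values and vanishes at the centre.
  Periods being discrete, it vanishes nearby, and a whole ball lies in the image.\<close>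

lemma lift_open:
  assumes g: "lift_on S g" and U: "openin (top_of_set torus) U" "U \<subseteq> S"
  shows "open (g ` U)"
  unfolding open_contains_ball
proof
  fix z0 assume "z0 \<in> g ` U"
  then obtain x0 where x0: "x0 \<in> U" "z0 = g x0" by blast
  obtain T where T: "open T" "U = torus \<inter> T" using U(1) by (auto simp: openin_open)
  define P where "P = torus_cover -` T"
  have P: "open P" unfolding P_def
    using open_vimage[OF T(1) continuous_on_torus_cover] .
  have PU: "torus_cover z \<in> U" if "z \<in> P" for z using that torus_cover_in_torus T(2) unfolding P_def by blast
  have pg: "torus_cover (g x) = x" if "x \<in> U" for x using g that U(2) unfolding lift_on_def by blast
  have z0: "z0 \<in> P" using x0 pg T(2) unfolding P_def by auto
  have "continuous_on U g" using g U(2) continuous_on_subset unfolding lift_on_def by blast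
  then have "continuous_on P (\<lambda>z. g (torus_cover z))"
    by (rule continuous_on_compose2[OF _ continuous_on_torus_cover]) (use PU in blast)
  then have "continuous_on P (\<lambda>z. g (torus_cover z) - z)" by (intro continuous_intros)
  then have "isCont (\<lambda>z. g (torus_cover z) - z) z0"
    using P z0 by (simp add: continuous_on_eq_continuous_at)
  then obtain d where d: "d > 0" "\<And>z. dist z z0 < d \<Longrightarrow> dist (g (torus_cover z) - z) (g (torus_cover z0) - z0) < 1"
    unfolding continuous_at_eps_delta by (meson zero_less_one)
  obtain e where e: "e > 0" "ball z0 e \<subseteq> P" using P z0 open_contains_ball by blast
  have "z \<in> g ` U" if z: "dist z z0 < d" "z \<in> ball z0 e" for z
  proof -
    have "g (torus_cover z0) = z0" using pg x0 by simp
    then have 1: "norm (g (torus_cover z) - z) < 1" using d(2)[OF z(1)] by (simp add: dist_norm)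
    have u: "torus_cover z \<in> U" using PU z(2) e(2) by blast
    have "period (g (torus_cover z) - z)" using pg[OF u] by (simp add: torus_cover_eq_iff[symmetric])
    then have "g (torus_cover z) - z = 0" using period_norm 1 by (metis not_le)
    then show ?thesis using u by (metis image_eqI right_minus_eq)
  qed
  then have "ball z0 (min d e) \<subseteq> g ` U" by (auto simp: dist_commute)
  then show "\<exists>e>0. ball z0 e \<subseteq> g ` U" using d(1) e(1) by (intro exI[of _ "min d e"]) auto
qed

lemma lift_difference_constant:
  assumes "lift_on S g" "lift_on S h" "connected S" "S \<noteq> {}"
  obtains w where "period w" "\<And>x. x \<in> S \<Longrightarrow> g x = h x + w"
proof -
  have p: "period (g x - h x)" if "x \<in> S" for x
    using assms(1,2) that by (auto simp: lift_on_def torus_cover_eq_iff[symmetric])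
  have "(\<lambda>x. g x - h x) constant_on S"
  proof (rule continuous_discrete_range_constant[OF assms(3)])
    show "continuous_on S (\<lambda>x. g x - h x)"
      using assms(1,2) by (intro continuous_intros) (auto simp: lift_on_def)
    show "\<exists>e>0. \<forall>y. y \<in> S \<and> g y - h y \<noteq> g x - h x \<longrightarrow> e \<le> norm (g y - h y - (g x - h x))" if "x \<in> S" for x
      using period_norm[OF period_diff[OF p p[OF that]]] by (intro exI[of _ 1]) auto
  qed
  then obtain w where w: "\<And>x. x \<in> S \<Longrightarrow> g x - h x = w" by (auto simp: constant_on_def)
  obtain x where "x \<in> S" using assms(4) by blast
  then show thesis using that[of w] w p by (metis add.commute diff_add_cancel)
qed

lemma lift_on_shift:
  assumes "lift_on S g" "period w"
  shows "lift_on S (\<lambda>x. g x + w)"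
proof -
  have "torus_cover (z + w) = torus_cover z" for z by (simp add: torus_cover_eq_iff assms(2))
  then show ?thesis using assms(1) unfolding lift_on_def by (auto intro!: continuous_intros)
qed

lemma torus_space: "compact torus" "connected torus" "locally connected torus" "torus \<noteq> {}"
proof -
  show "compact torus" unfolding torus_def by (intro compact_Times) auto
  show "connected torus" unfolding torus_def by (intro connected_Times connected_sphere) auto
  show "torus \<noteq> {}" using torus_cover_in_torus by blast
  have "locally connected (sphere (0::complex) 1)" by (rule locally_connected_sphere)
  then show "locally connected torus" unfolding torus_def
    by (intro locally_Times[of connected _ connected]) (auto intro: connected_Times)
qed

text \<open>The difference of the values at antipodal points changes sign along a half circle, so it
  vanishes somewhere.\<close>

lemma circle_not_injective:
  fixes q :: "complex \<Rightarrow> real"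
  assumes "continuous_on (sphere 0 1) q"
  shows "\<not> inj_on q (sphere 0 1)"
proof
  assume inj: "inj_on q (sphere 0 1)"
  define r where "r t = q (cis t) - q (- cis t)" for t
  have c: "continuous_on {0..pi} r" unfolding r_def
    by (intro continuous_intros continuous_on_compose2[OF assms]) auto
  have pm: "r pi = - r 0" by (simp add: r_def cis_pi)
  have "\<exists>t. r t = 0"
  proof (cases "r 0 \<le> 0")
    case True
    then show ?thesis using IVT'[of r 0 0 pi] c pm by auto
  next
    case False
    then show ?thesis using IVT2'[of r pi 0 0] c pm by auto
  qed
  then obtain t where "q (cis t) = q (- cis t)" by (auto simp: r_def)
  then have "cis t = - cis t" using inj by (auto simp: inj_on_def)
  then show False using cis_neq_zero[of t] by simp
qed

text \<open>The complement of the curve is the disjoint union of the open sets \<open>A\<close> and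
  \<open>- K\<close>, so a connected set that misses the curve and meets \<open>A\<close> stays in
  \<open>A\<close>. For the unbounded outside of the Jordan curve this is impossible, and the inside
  is therefore contained in \<open>A\<close>.\<close>

lemma inside_of_boundary:
  fixes K :: "complex set"
  assumes "compact K" "open A" "connected A" "A \<noteq> {}" "A \<subseteq> K" "simple_path \<gamma>" "pathfinish \<gamma> = pathstart \<gamma>"
    "path_image \<gamma> = K - A"
  shows "A = inside (path_image \<gamma>)" "- K = outside (path_image \<gamma>)"
proof -
  let ?J = "path_image \<gamma>"
  have J: "connected (inside ?J)" "\<not> bounded (outside ?J)" "connected (outside ?J)" "inside ?J \<noteq> {}" "bounded (inside ?J)"
    using Jordan_inside_outside[OF assms(6,7)] by auto
  have un: "inside ?J \<union> outside ?J = - ?J" by (rule inside_Un_outside)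
  have bA: "bounded A" using assms(1,5) bounded_subset compact_imp_bounded by blast
  have sub: "C \<subseteq> A" if C: "connected C" "C \<inter> ?J = {}" "C \<inter> A \<noteq> {}" for C
  proof -
    have "A \<inter> C = {} \<or> - K \<inter> C = {}"
      by (rule connectedD[OF C(1) assms(2)]) (use assms(1,5,8) C(2) in \<open>auto intro: compact_imp_closed\<close>)
    then show ?thesis using C assms(8) by blast
  qed
  have "A \<inter> outside ?J = {}"
  proof (rule ccontr)
    assume "A \<inter> outside ?J \<noteq> {}"
    then have "outside ?J \<subseteq> A" using sub[OF J(3)] outside_no_overlap[of ?J] by blast
    then show False using bA J(2) bounded_subset by blast
  qed
  then have 1: "A \<subseteq> inside ?J" using un assms(8) by blast
  then have "inside ?J \<subseteq> A" using sub[OF J(1)] inside_no_overlap[of ?J] assms(4) by blast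
  then show "A = inside ?J" using 1 by blast
  then have "- K = - ?J - inside ?J" using assms(5,8) by auto
  moreover have "\<dots> = outside ?J" proof -
    have *: "X \<union> Y = Z \<Longrightarrow> X \<inter> Y = {} \<Longrightarrow> Z - X = Y" for X Y Z :: "complex set" by blast
    show ?thesis by (rule *[OF un inside_Int_outside])
  qed
  ultimately show "- K = outside ?J" by simp
qed

section \<open>Maps on the torus\<close>

locale torus_map =
  fixes M :: "('v, complex \<times> complex) drawing" and as :: "nat list"
  assumes map: "map_on torus M" and type: "has_type torus M as" and degree: "3 \<le> length as"
begin

abbreviation "V \<equiv> verts M"
abbreviation "E \<equiv> edges M"
abbreviation "P \<equiv> point M"
abbreviation "F \<equiv> faces torus M"
abbreviation "D \<equiv> closed_face torus"
abbreviation "K \<equiv> skeleton M"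

lemma finV: "finite V" and E_sub: "e \<in> E \<Longrightarrow> e \<subseteq> V \<and> card e = 2"
  using map by (auto simp: map_on_def simple_graph_def)

lemma finE: "finite E"
  using finV E_sub finite_subset[of E "Pow V"] by blast

lemma edgeE: "e \<in> E \<Longrightarrow> \<exists>u v. e = {u, v} \<and> u \<noteq> v \<and> u \<in> V \<and> v \<in> V"
  using E_sub[of e] by (auto simp: card_2_iff)

lemma emb: "inj_on P V" "P ` V \<subseteq> torus"
  "e \<in> E \<Longrightarrow> arc (curve M e)" "e \<in> E \<Longrightarrow> edge_arc M e \<subseteq> torus"
  "e \<in> E \<Longrightarrow> {pathstart (curve M e), pathfinish (curve M e)} = P ` e"
  "e \<in> E \<Longrightarrow> edge_arc M e \<inter> P ` V = P ` e"
  "e \<in> E \<Longrightarrow> e' \<in> E \<Longrightarrow> e \<noteq> e' \<Longrightarrow> edge_arc M e \<inter> edge_arc M e' = P ` (e \<inter> e')"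
  using map by (auto simp: map_on_def embedded_in_def)

lemma disc: "f \<in> F \<Longrightarrow> D f homeomorphic cball (0::complex) 1"
  using map by (auto simp: map_on_def)

lemma vertex_on_arc: "e \<in> E \<Longrightarrow> v \<in> V \<Longrightarrow> P v \<in> edge_arc M e \<longleftrightarrow> v \<in> e"
proof -
  assume e: "e \<in> E" and v: "v \<in> V"
  have "P v \<in> edge_arc M e \<longleftrightarrow> P v \<in> P ` e" using emb(6)[OF e] v by blast
  also have "\<dots> \<longleftrightarrow> v \<in> e" by (rule inj_on_image_mem_iff[OF emb(1)]) (use e v E_sub in blast)+
  finally show ?thesis .
qed

text \<open>A witness point of the edge: it lies on no other edge and is no vertex, so it tests
  whether an edge belongs to a closed face.\<close>

definition mid :: "'v set \<Rightarrow> complex \<times> complex" where "mid e = curve M e (1/2)"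

lemma mid:
  assumes "e \<in> E"
  shows "mid e \<in> edge_arc M e" "mid e \<notin> P ` V" "e' \<in> E \<Longrightarrow> mid e \<in> edge_arc M e' \<Longrightarrow> e' = e"
proof -
  show 1: "mid e \<in> edge_arc M e" unfolding mid_def edge_arc_def path_image_def by simp
  have i: "inj_on (curve M e) {0..1}" using emb(3)[OF assms] by (simp add: arc_def)
  have "mid e \<noteq> pathstart (curve M e)" "mid e \<noteq> pathfinish (curve M e)"
    unfolding mid_def pathstart_def pathfinish_def using inj_onD[OF i, of "1/2" 0] inj_onD[OF i, of "1/2" 1] by auto
  then show 2: "mid e \<notin> P ` V" using emb(5,6)[OF assms] 1 by blast
  show "e' = e" if "e' \<in> E" "mid e \<in> edge_arc M e'"
    using emb(7)[OF assms that(1)] that(2) 1 2 E_sub[OF assms] by blast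
qed

lemma arc_closed: "e \<in> E \<Longrightarrow> closed (edge_arc M e)"
  using closed_path_image[OF arc_imp_path[OF emb(3)]] unfolding edge_arc_def by blast

section \<open>Faces and their closures\<close>

lemma skeleton: "closed K" "K \<subseteq> torus"
proof -
  show "closed K" unfolding skeleton_def
    by (intro closed_Un closed_UN finE ballI arc_closed finite_imp_closed finite_imageI finV)
  show "K \<subseteq> torus" unfolding skeleton_def using emb(2,4) by blast
qed

lemma face_open: "f \<in> F \<Longrightarrow> openin (top_of_set torus) f"
proof -
  assume f: "f \<in> F"
  have o: "openin (top_of_set torus) (torus - K)" using skeleton(1) by (auto simp: openin_open)
  then have "locally connected (torus - K)" using torus_space(3) locally_open_subset by blast
  then have "openin (top_of_set (torus - K)) f" using f openin_components_locally_connected unfolding faces_def by blast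
  then show ?thesis using o openin_trans by blast
qed

lemma face: "f \<in> F \<Longrightarrow> connected f" "f \<in> F \<Longrightarrow> f \<noteq> {}" "f \<in> F \<Longrightarrow> f \<subseteq> torus - K"
  "x \<in> torus - K \<Longrightarrow> \<exists>f\<in>F. x \<in> f" "f \<in> F \<Longrightarrow> g \<in> F \<Longrightarrow> f \<inter> g \<noteq> {} \<Longrightarrow> f = g"
proof -
  show "\<exists>f\<in>F. x \<in> f" if "x \<in> torus - K" using that Union_components[of "torus - K"] unfolding faces_def by blast
qed (use in_components_connected in_components_nonempty in_components_subset components_nonoverlap in \<open>unfold faces_def, blast+\<close>)

text \<open>For the last claim: a point off the skeleton lies in some face, which is open in the
  torus. If the point is in the closure of \<open>f\<close>, that face meets \<open>f\<close> and is
  equal to it.\<close>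

lemma closed_face: "f \<subseteq> D f \<longleftrightarrow> f \<subseteq> torus" "compact (D f)" "D f \<subseteq> torus"
  "f \<in> F \<Longrightarrow> x \<in> D f \<Longrightarrow> x \<notin> K \<Longrightarrow> x \<in> f"
proof -
  show "f \<subseteq> D f \<longleftrightarrow> f \<subseteq> torus" "D f \<subseteq> torus" unfolding closed_face_def using closure_subset by auto
  show "compact (D f)" unfolding closed_face_def using torus_space(1) by (simp add: compact_Int_closed)
  assume f: "f \<in> F" and x: "x \<in> D f" "x \<notin> K"
  obtain g where g: "g \<in> F" "x \<in> g" using face(4) x unfolding closed_face_def by blast
  obtain T where T: "open T" "g = torus \<inter> T" using face_open[OF g(1)] by (auto simp: openin_open)
  have "x \<in> closure f" using x(1) by (simp add: closed_face_def)
  then have "T \<inter> f \<noteq> {}" using T g(2) open_Int_closure_eq_empty[OF T(1), of f] by blast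
  then have "g \<inter> f \<noteq> {}" using T(2) face(3)[OF f] by blast
  then show "x \<in> f" using face(5)[OF g(1) f] g(2) by blast
qed

lemma face_sub: "f \<in> F \<Longrightarrow> f \<subseteq> D f" "f \<in> F \<Longrightarrow> f \<inter> K = {}"
  using closed_face(1) face(3) by blast+

lemma face_lift:
  assumes "f \<in> F"
  obtains g where "lift_on (D f) g"
proof (rule lift_exists[of "D f"])
  show "D f \<subseteq> torus" by (rule closed_face(3))
  show "contractible (D f)" using disc[OF assms] homeomorphic_contractible_eq convex_imp_contractible[OF convex_cball] by blast
qed

lemma lift_face:
  assumes "f \<in> F" "lift_on (D f) g"
  shows "open (g ` f)" "connected (g ` f)" "g ` f \<noteq> {}" "g ` f \<subseteq> g ` D f" "compact (g ` D f)" "g ` D f - g ` f = g ` (D f - f)"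
proof -
  have c: "continuous_on (D f) g" using assms(2) by (simp add: lift_on_def)
  show "open (g ` f)" by (rule lift_open[OF assms(2) face_open[OF assms(1)] face_sub(1)[OF assms(1)]])
  show "connected (g ` f)" by (rule connected_continuous_image[OF continuous_on_subset[OF c face_sub(1)] face(1)]) (use assms in auto)
  show "g ` f \<noteq> {}" "g ` f \<subseteq> g ` D f" using face(2) face_sub(1) assms(1) by blast+
  show "compact (g ` D f)" by (rule compact_continuous_image[OF c closed_face(2)])
  show "g ` D f - g ` f = g ` (D f - f)" using inj_on_image_set_diff[OF lift_on_inj[OF assms(2)], of "D f" f] face_sub(1)[OF assms(1)] by auto
qed

text \<open>The circle bounding the closed cell maps into the skeleton by invariance of domain; without
  vertices it would map into a single edge, but a circle does not embed into an arc.\<close>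

lemma face_has_vertex:
  assumes f: "f \<in> F"
  shows "\<exists>v\<in>V. P v \<in> D f"
proof (rule ccontr)
  assume nv: "\<not> ?thesis"
  obtain g where g: "lift_on (D f) g" using face_lift[OF f] .
  note lf = lift_face[OF f g]
  obtain h k where hk: "homeomorphism (cball (0::complex) 1) (D f) h k"
    using disc[OF f] homeomorphic_sym unfolding homeomorphic_def by blast
  have hs: "h ` cball 0 1 = D f" "continuous_on (cball 0 1) h" "continuous_on (D f) k" "k ` D f = cball 0 1"
    "\<And>x. x \<in> D f \<Longrightarrow> h (k x) = x" "\<And>x. x \<in> cball 0 1 \<Longrightarrow> k (h x) = x"
    using hk by (auto simp: homeomorphism_def)
  have pg: "torus_cover (g x) = x" if "x \<in> D f" for x using g that by (auto simp: lift_on_def)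
  \<comment> \<open>Lifted to the plane, \<open>f\<close> becomes an open set that embeds into the
    closed disc; by invariance of domain its image is open, hence contained in the open disc. So the
    bounding circle corresponds to points outside \<open>f\<close>.\<close>
  have "k ` f \<subseteq> ball 0 1"
  proof -
    have im: "(\<lambda>z. k (torus_cover z)) ` (g ` f) = k ` f"
      unfolding image_image by (rule image_cong) (use pg face_sub(1)[OF f] in auto)
    have "open ((\<lambda>z. k (torus_cover z)) ` (g ` f))"
    proof (rule invariance_of_domain[OF _ lf(1)])
      show "continuous_on (g ` f) (\<lambda>z. k (torus_cover z))"
        by (rule continuous_on_compose2[OF hs(3) continuous_on_torus_cover]) (use pg face_sub(1)[OF f] in auto)
      have "z = w" if zw: "z \<in> g ` f" "w \<in> g ` f" "k (torus_cover z) = k (torus_cover w)" for z w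
      proof -
        obtain x y where "x \<in> f" "y \<in> f" "z = g x" "w = g y" using zw(1,2) by blast
        then show ?thesis using zw(3) pg hs(5) face_sub(1)[OF f] by (metis subsetD)
      qed
      then show "inj_on (\<lambda>z. k (torus_cover z)) (g ` f)" unfolding inj_on_def by blast
    qed
    then have "open (k ` f)" unfolding im .
    moreover have "k ` f \<subseteq> cball 0 1" using hs(4) face_sub(1)[OF f] by blast
    ultimately show ?thesis using interior_maximal[of "k ` f" "cball 0 1"] by simp
  qed
  then have sf: "h x \<in> D f - f" if "x \<in> sphere 0 1" for x
    proof -
    have "x \<in> cball 0 1" "x \<notin> ball 0 1" using that by auto
    then show ?thesis using hs(1) hs(6)[of x] \<open>k ` f \<subseteq> ball 0 1\<close> by (metis DiffI image_eqI subsetD)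
  qed
  have hD: "h ` sphere 0 1 \<subseteq> D f - f" using sf by (rule image_subsetI)
  then have hV: "h ` sphere 0 1 \<inter> P ` V = {}"
  proof -
    have "P ` V \<inter> D f = {}" using nv by blast
    moreover have *: "X \<subseteq> Y - Z \<Longrightarrow> W \<inter> Y = {} \<Longrightarrow> X \<inter> W = {}" for W X Y Z :: "(complex \<times> complex) set" by blast
    ultimately show ?thesis using *[OF hD] by simp
  qed
  have "D f - f \<subseteq> K" using closed_face(4)[OF f] by blast
  then have "h ` sphere 0 1 \<subseteq> K" by (rule subset_trans[OF hD])
  then have sK: "h ` sphere 0 1 \<subseteq> (\<Union>e\<in>E. edge_arc M e)"
    unfolding skeleton_def using hV by blast
  have cs: "continuous_on (sphere 0 1) h" using hs(2) continuous_on_subset sphere_cball by blast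
  have con: "connected (h ` sphere 0 1)" by (rule connected_continuous_image[OF cs connected_sphere]) simp
  have "h 1 \<in> h ` sphere 0 1" by simp
  then obtain e where e: "e \<in> E" "h 1 \<in> edge_arc M e" using sK by blast
  let ?B = "\<Union>e'\<in>E - {e}. edge_arc M e'"
  \<comment> \<open>Distinct edges meet only in vertices, which the circle avoids; being connected,
    it stays in one edge.\<close>
  have "edge_arc M e \<inter> h ` sphere 0 1 = {} \<or> ?B \<inter> h ` sphere 0 1 = {}"
  proof (rule connected_closedD[OF con _ _ arc_closed[OF e(1)]])
    show "closed ?B" by (intro closed_UN finite_Diff finE ballI arc_closed) auto
    show "h ` sphere 0 1 \<subseteq> edge_arc M e \<union> ?B" using sK by blast
    have "edge_arc M e \<inter> ?B \<subseteq> P ` V" using emb(7)[OF e(1)] E_sub by blast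
    then show "edge_arc M e \<inter> ?B \<inter> h ` sphere 0 1 = {}" using hV by blast
  qed
  then have "?B \<inter> h ` sphere 0 1 = {}" using e(2) \<open>h 1 \<in> h ` sphere 0 1\<close> by blast
  then have sub: "h ` sphere 0 1 \<subseteq> edge_arc M e" using sK by blast
  obtain q where q: "homeomorphism {0..1} (edge_arc M e) (curve M e) q"
    using homeomorphism_arc[OF emb(3)[OF e(1)]] unfolding edge_arc_def by blast
  have "continuous_on (sphere 0 1) (\<lambda>x. q (h x))"
    by (rule continuous_on_compose2[OF _ cs sub]) (use q in \<open>simp add: homeomorphism_def\<close>)
  moreover have "inj_on (\<lambda>x. q (h x)) (sphere 0 1)"
  proof (rule inj_onI)
    fix x y :: complex assume xy: "x \<in> sphere 0 1" "y \<in> sphere 0 1" "q (h x) = q (h y)"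
    then have "h x = h y" using q sub unfolding homeomorphism_def by (metis image_subset_iff)
    then show "x = y" using hs(6)[of x] hs(6)[of y] xy(1,2) by (metis sphere_cball subsetD)
  qed
  ultimately show False using circle_not_injective by blast
qed

lemma V_nonempty: "V \<noteq> {}"
proof
  assume V: "V = {}"
  then have "E = {}" using E_sub by fastforce
  then have "K = {}" using V by (simp add: skeleton_def)
  then obtain f where "f \<in> F" using face(4) torus_space(4) by blast
  then show False using face_has_vertex V by blast
qed

section \<open>Boundary cycles of faces\<close>

definition gon :: "(complex \<times> complex) set \<Rightarrow> 'v list \<Rightarrow> bool" where
  "gon f c \<longleftrightarrow> f \<in> F \<and> graph_cycle V E c \<and> D f - f = (\<Union>e\<in>cycle_edges c. edge_arc M e)"

text \<open>\<open>has_type\<close> speaks only of faces at vertices; by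
  \<open>face_has_vertex\<close> every face occurs around some vertex and is therefore a
  polygon.\<close>

lemma gon_exists:
  assumes "f \<in> F"
  shows "\<exists>c. gon f c"
proof -
  obtain v where v: "v \<in> V" "P v \<in> D f" using face_has_vertex[OF assms] by blast
  obtain fs where fs: "face_cycle torus M v fs" "list_all2 (is_gon torus M) as fs"
    using type v(1) unfolding has_type_def by blast
  have "f \<in> set fs" using fs(1) assms v(2) unfolding face_cycle_def by blast
  then obtain i where "i < length fs" "fs ! i = f" by (auto simp: in_set_conv_nth)
  then have "is_gon torus M (as ! i) f" using fs(2) by (auto simp: list_all2_conv_all_nth)
  then show ?thesis using assms unfolding is_gon_def gon_def by blast
qed

text \<open>The midpoint of an edge contained in \<open>D f\<close> is on the skeleton, hence on the
  boundary, and no boundary edge other than this one can contain it.\<close>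

lemma gon_edge:
  assumes "gon f c" "e \<in> E"
  shows "edge_arc M e \<subseteq> D f \<longleftrightarrow> e \<in> cycle_edges c"
proof
  have f: "f \<in> F" and b: "D f - f = (\<Union>e\<in>cycle_edges c. edge_arc M e)" and c: "cycle_edges c \<subseteq> E"
    using assms(1) unfolding gon_def graph_cycle_def by blast+
  show "edge_arc M e \<subseteq> D f" if "e \<in> cycle_edges c" using b that by blast
  assume "edge_arc M e \<subseteq> D f"
  moreover have "mid e \<notin> f" using mid(1)[OF assms(2)] face_sub(2)[OF f] assms(2) unfolding skeleton_def by blast
  ultimately have "mid e \<in> (\<Union>e\<in>cycle_edges c. edge_arc M e)" using mid(1)[OF assms(2)] b by blast
  then show "e \<in> cycle_edges c" using mid(3)[OF assms(2)] c by blast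
qed

lemma cycle_vertices: "\<Union>(cycle_edges c) = set c"
proof
  show "\<Union>(cycle_edges c) \<subseteq> set c" using darts_subset[of c] by (auto simp: cycle_edges_darts uedge_def)
  show "set c \<subseteq> \<Union>(cycle_edges c)" using darts_total(1)[of _ c] by (force simp: cycle_edges_darts uedge_def)
qed

lemma gon_vertex:
  assumes "gon f c" "v \<in> V"
  shows "P v \<in> D f \<longleftrightarrow> v \<in> set c"
proof -
  have f: "f \<in> F" and b: "D f - f = (\<Union>e\<in>cycle_edges c. edge_arc M e)" and c: "cycle_edges c \<subseteq> E"
    using assms(1) unfolding gon_def graph_cycle_def by blast+
  have "P v \<notin> f" using face_sub(2)[OF f] assms(2) unfolding skeleton_def by blast
  then have "P v \<in> D f \<longleftrightarrow> (\<exists>e\<in>cycle_edges c. P v \<in> edge_arc M e)" using b by blast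
  also have "\<dots> \<longleftrightarrow> (\<exists>e\<in>cycle_edges c. v \<in> e)" using vertex_on_arc[OF _ assms(2)] c by blast
  also have "\<dots> \<longleftrightarrow> v \<in> \<Union>(cycle_edges c)" by blast
  finally show ?thesis unfolding cycle_vertices .
qed

lemma card_cycle_edges:
  assumes "distinct c" "3 \<le> length c"
  shows "card (cycle_edges c) = length c"
proof -
  have "inj_on uedge (darts c)"
    unfolding inj_on_def using darts_asym(1)[OF assms] by (auto simp: uedge_def doubleton_eq_iff)
  then have "card (cycle_edges c) = card (darts c)" unfolding cycle_edges_darts by (rule card_image)
  also have "darts c = (\<lambda>i. (c ! i, c ! (Suc i mod length c))) ` {..<length c}" unfolding darts_conv_nth by blast
  also have "card \<dots> = length c"
    by (subst card_image) (use assms(1) in \<open>auto simp: inj_on_def nth_eq_iff_index_eq\<close>)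
  finally show ?thesis .
qed

text \<open>The edges of a boundary cycle are those contained in the closed face. So the cycle given
  by the type and the positive cycle have equal lengths.\<close>

lemma gon_unique:
  assumes "gon f c" "gon f c'"
  shows "cycle_edges c = cycle_edges c'" "length c = length c'"
proof -
  have *: "cycle_edges c \<subseteq> E" "cycle_edges c' \<subseteq> E" "distinct c" "distinct c'" "3 \<le> length c" "3 \<le> length c'"
    using assms unfolding gon_def graph_cycle_def by blast+
  show "cycle_edges c = cycle_edges c'" using gon_edge[OF assms(1)] gon_edge[OF assms(2)] * by blast
  then show "length c = length c'" using card_cycle_edges * by metis
qed

end

section \<open>Winding numbers of lifted boundary cycles\<close>

fun join_steps :: "('v \<times> 'v \<Rightarrow> real \<Rightarrow> 'a::topological_space) \<Rightarrow> 'v list \<Rightarrow> real \<Rightarrow> 'a" where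
  "join_steps p (x # y # zs) = (if zs = [] then p (x, y) else p (x, y) +++ join_steps p (y # zs))"
| "join_steps p xs = (\<lambda>_. undefined)"

lemma finite_steps: "finite (steps xs)"
  by (rule finite_subset[OF steps_subset]) simp

lemma step_not_hd:
  assumes "distinct c" "(x, y) \<in> steps c"
  shows "y \<noteq> hd c"
proof -
  obtain i where i: "y = c ! Suc i" "Suc i < length c" using assms(2) by (auto simp: steps_conv_nth)
  have "0 < length c" using i(2) by linarith
  then have "c ! Suc i \<noteq> c ! 0" using i(2) nth_eq_iff_index_eq[OF assms(1), of "Suc i" 0] by simp
  moreover have "hd c = c ! 0" using \<open>0 < length c\<close> by (cases c) auto
  ultimately show ?thesis using i(1) by simp
qed

context torus_map
begin

definition dart_curve :: "'v \<times> 'v \<Rightarrow> real \<Rightarrow> complex \<times> complex" where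
  "dart_curve d = (if pathstart (curve M (uedge d)) = P (fst d) then curve M (uedge d)
     else reversepath (curve M (uedge d)))"

lemma dart_curve:
  assumes "{u, v} \<in> E"
  shows "arc (dart_curve (u, v))" "path_image (dart_curve (u, v)) = edge_arc M {u, v}"
    "pathstart (dart_curve (u, v)) = P u" "pathfinish (dart_curve (u, v)) = P v"
    "dart_curve (v, u) = reversepath (dart_curve (u, v))"
proof -
  have uv: "u \<noteq> v" "u \<in> V" "v \<in> V" using E_sub[OF assms] by (auto simp: card_2_iff doubleton_eq_iff)
  have ne: "P u \<noteq> P v" using uv emb(1) by (simp add: inj_on_eq_iff)
  have "{pathstart (curve M {u, v}), pathfinish (curve M {u, v})} = {P u, P v}" using emb(5)[OF assms] by simp
  then have se: "pathstart (curve M {u, v}) = P u \<and> pathfinish (curve M {u, v}) = P v \<or>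
    pathstart (curve M {u, v}) = P v \<and> pathfinish (curve M {u, v}) = P u"
    by (simp add: doubleton_eq_iff)
  have vu: "{v, u} = {u, v}" by (rule insert_commute)
  show "arc (dart_curve (u, v))" using emb(3)[OF assms] by (simp add: dart_curve_def arc_reversepath)
  show "path_image (dart_curve (u, v)) = edge_arc M {u, v}" by (simp add: dart_curve_def edge_arc_def)
  show "pathstart (dart_curve (u, v)) = P u" "pathfinish (dart_curve (u, v)) = P v"
    using se ne by (auto simp: dart_curve_def)
  show "dart_curve (v, u) = reversepath (dart_curve (u, v))"
    using se ne by (auto simp: dart_curve_def vu)
qed

lemma join_steps:
  assumes "distinct xs" "2 \<le> length xs" "uedge ` steps xs \<subseteq> E"
  shows "arc (join_steps dart_curve xs) \<and> pathstart (join_steps dart_curve xs) = P (hd xs) \<and>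
    pathfinish (join_steps dart_curve xs) = P (last xs) \<and>
    path_image (join_steps dart_curve xs) = (\<Union>e\<in>uedge ` steps xs. edge_arc M e)"
  using assms
proof (induction xs rule: steps.induct)
  case (3 x y zs)
  have xy: "{x, y} \<in> E" using 3(4) by simp
  show ?case
  proof (cases "zs = []")
    case True
    then show ?thesis using dart_curve[OF xy] by simp
  next
    case False
    then have "2 \<le> length (y # zs)" by (cases zs) auto
    then have IH: "arc (join_steps dart_curve (y # zs))" "pathstart (join_steps dart_curve (y # zs)) = P y"
      "pathfinish (join_steps dart_curve (y # zs)) = P (last (y # zs))"
      "path_image (join_steps dart_curve (y # zs)) = (\<Union>e\<in>uedge ` steps (y # zs). edge_arc M e)"
      using 3 by auto
    have eq: "join_steps dart_curve (x # y # zs) = dart_curve (x, y) +++ join_steps dart_curve (y # zs)"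
      using False by simp
    have "edge_arc M {x, y} \<inter> edge_arc M e \<subseteq> {P y}" if e: "e \<in> uedge ` steps (y # zs)" for e
    proof -
      have x: "x \<notin> e" using e steps_subset[of "y # zs"] 3(2) by (auto simp: uedge_def)
      then have "{x, y} \<noteq> e" by blast
      moreover have "e \<in> E" using 3(4) e by auto
      ultimately have "edge_arc M {x, y} \<inter> edge_arc M e = P ` ({x, y} \<inter> e)" using emb(7)[OF xy] by blast
      then show ?thesis using x by auto
    qed
    then have "path_image (dart_curve (x, y)) \<inter> path_image (join_steps dart_curve (y # zs))
        \<subseteq> {pathstart (join_steps dart_curve (y # zs))}"
      unfolding IH(2,4) dart_curve(2)[OF xy] by blast
    then have "arc (dart_curve (x, y) +++ join_steps dart_curve (y # zs))"
      by (intro arc_join) (simp_all add: dart_curve[OF xy] IH(1,2))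
    moreover have "path_image (dart_curve (x, y) +++ join_steps dart_curve (y # zs)) =
        edge_arc M {x, y} \<union> (\<Union>e\<in>uedge ` steps (y # zs). edge_arc M e)"
      by (subst path_image_join) (simp_all only: dart_curve[OF xy] IH(2,4))
    ultimately show ?thesis unfolding eq by (simp add: dart_curve[OF xy] IH(3))
  qed
qed auto

text \<open>Winding numbers of open paths are complex numbers in general, but they still add up
  under concatenation as long as \<open>z\<close> avoids the paths. The set \<open>A\<close> carries
  this condition through the induction.\<close>

lemma winding_join_steps:
  assumes "distinct xs" "2 \<le> length xs" "uedge ` steps xs \<subseteq> E"
    and "(\<Union>e\<in>uedge ` steps xs. edge_arc M e) \<subseteq> A" "continuous_on A g" "z \<notin> g ` A"
  shows "winding_number (g \<circ> join_steps dart_curve xs) z = (\<Sum>d\<in>steps xs. winding_number (g \<circ> dart_curve d) z)"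
  using assms(1-4)
proof (induction xs rule: steps.induct)
  case (3 x y zs)
  have xy: "{x, y} \<in> E" using 3(4) by simp
  show ?case
  proof (cases "zs = []")
    case False
    have s: "distinct (y # zs)" "2 \<le> length (y # zs)" "uedge ` steps (y # zs) \<subseteq> E"
      "(\<Union>e\<in>uedge ` steps (y # zs). edge_arc M e) \<subseteq> A"
      using 3 False by (auto simp: Suc_le_eq)
    note j = join_steps[OF s(1-3)]
    have a: "edge_arc M {x, y} \<subseteq> A" using 3(5) by simp
    have "(x, y) \<notin> steps (y # zs)" using steps_subset[of "y # zs"] 3(2) by auto
    then have "(\<Sum>d\<in>steps (x # y # zs). winding_number (g \<circ> dart_curve d) z) =
      winding_number (g \<circ> dart_curve (x, y)) z + winding_number (g \<circ> join_steps dart_curve (y # zs)) z"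
      using 3(1)[OF s] finite_steps[of "y # zs"] by (simp add: o_def)
    also have "\<dots> = winding_number ((g \<circ> dart_curve (x, y)) +++ (g \<circ> join_steps dart_curve (y # zs))) z"
    proof (rule winding_number_join[symmetric])
      show "path (g \<circ> dart_curve (x, y))" "path (g \<circ> join_steps dart_curve (y # zs))"
        using dart_curve[OF xy] j a s(4) continuous_on_subset[OF assms(5)] arc_imp_path
        by (metis path_continuous_image)+
      show "z \<notin> path_image (g \<circ> dart_curve (x, y))" "z \<notin> path_image (g \<circ> join_steps dart_curve (y # zs))"
        unfolding path_image_compose using dart_curve[OF xy] j a s(4) assms(6) by blast+
      show "pathfinish (g \<circ> dart_curve (x, y)) = pathstart (g \<circ> join_steps dart_curve (y # zs))"
        using dart_curve[OF xy] j by (simp add: pathfinish_compose pathstart_compose)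
    qed
    also have "(g \<circ> dart_curve (x, y)) +++ (g \<circ> join_steps dart_curve (y # zs)) = g \<circ> join_steps dart_curve (x # y # zs)"
      using False by (simp add: path_compose_join)
    finally show ?thesis by (rule sym)
  qed simp
qed auto

text \<open>The winding number of the closed boundary, written as a sum over darts. It depends only
  on the set of darts, so a cycle may be rotated freely and a single dart can be split off as a
  summand.\<close>

definition wsum :: "(complex \<times> complex \<Rightarrow> complex) \<Rightarrow> 'v list \<Rightarrow> complex \<Rightarrow> complex" where
  "wsum g c z = (\<Sum>d\<in>darts c. winding_number (g \<circ> dart_curve d) z)"

lemma gonD:
  assumes "gon f c"
  shows "f \<in> F" "distinct c" "3 \<le> length c" "cycle_edges c \<subseteq> E" "D f - f = (\<Union>e\<in>cycle_edges c. edge_arc M e)" "set c \<subseteq> V"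
  using assms unfolding gon_def graph_cycle_def by blast+

lemma darts_split:
  assumes "c \<noteq> []" "distinct c"
  shows "darts c = insert (last c, hd c) (steps c)" "(last c, hd c) \<notin> steps c"
  using assms step_not_hd[OF assms(2)] by (auto simp: darts_def)

lemma winding_gon:
  assumes c: "distinct c" "3 \<le> length c" "cycle_edges c \<subseteq> E"
    and A: "(\<Union>e\<in>cycle_edges c. edge_arc M e) \<subseteq> A" "continuous_on A g" "z \<notin> g ` A"
  shows "wsum g c z = winding_number (g \<circ> join_steps dart_curve c) z + winding_number (g \<circ> dart_curve (last c, hd c)) z"
proof -
  have ne: "c \<noteq> []" using c(2) by auto
  note sp = darts_split[OF ne c(1)]
  have sub: "uedge ` steps c \<subseteq> cycle_edges c" unfolding cycle_edges_darts sp(1) by blast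
  have "winding_number (g \<circ> join_steps dart_curve c) z = (\<Sum>d\<in>steps c. winding_number (g \<circ> dart_curve d) z)"
    by (rule winding_join_steps[OF c(1) _ _ _ A(2,3)]) (use c sub A(1) in auto)
  then show ?thesis unfolding wsum_def sp(1) using sp(2) finite_steps[of c] by simp
qed

text \<open>The lifted boundary is a Jordan curve whose inside is the lifted open face and whose
  outside is the complement of the lifted closed face.\<close>

lemma winding_sum_of_lift:
  assumes c: "gon f c" and g: "lift_on (D f) g"
  shows "(\<forall>z\<in>g ` f. wsum g c z = 1) \<or> (\<forall>z\<in>g ` f. wsum g c z = - 1)" "\<forall>z. z \<notin> g ` D f \<longrightarrow> wsum g c z = 0"
proof -
  note c = gonD[OF c]
  have ne: "c \<noteq> []" using c(3) by auto
  note sp = darts_split[OF ne c(2)]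
  define a where "a = join_steps dart_curve c"
  define b where "b = dart_curve (last c, hd c)"
  have ce: "cycle_edges c = insert {last c, hd c} (uedge ` steps c)" unfolding cycle_edges_darts sp(1) by simp
  have lh: "{last c, hd c} \<in> E" using c(4) ce by blast
  have a: "arc a" "pathstart a = P (hd c)" "pathfinish a = P (last c)" "path_image a = (\<Union>e\<in>uedge ` steps c. edge_arc M e)"
    using join_steps[of c] c ce unfolding a_def by auto
  have b: "arc b" "pathstart b = P (last c)" "pathfinish b = P (hd c)" "path_image b = edge_arc M {last c, hd c}"
    using dart_curve[OF lh] unfolding b_def by auto
  have "edge_arc M e \<inter> edge_arc M {last c, hd c} \<subseteq> {P (last c), P (hd c)}" if e: "e \<in> uedge ` steps c" for e
  proof -
    have "(hd c, last c) \<notin> darts c" using darts_asym(1)[OF c(2,3), of "last c" "hd c"] sp(1) by blast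
    then have "{last c, hd c} \<noteq> e" using e sp by (auto simp: uedge_def doubleton_eq_iff)
    then have "edge_arc M {last c, hd c} \<inter> edge_arc M e = P ` ({last c, hd c} \<inter> e)" using emb(7)[OF lh] e c(4) ce by blast
    then show ?thesis by blast
  qed
  then have "path_image a \<inter> path_image b \<subseteq> {pathstart a, pathstart b}" unfolding a b by blast
  then have sim: "simple_path (a +++ b)" by (intro simple_path_join_loop) (simp_all add: a b)
  have im: "path_image (a +++ b) = D f - f" using a b c(5) ce by (subst path_image_join) auto
  have cg: "continuous_on (D f) g" using g by (simp add: lift_on_def)
  define \<gamma> where "\<gamma> = g \<circ> (a +++ b)"
  have \<gamma>: "simple_path \<gamma>" unfolding \<gamma>_def
    by (rule simple_path_continuous_image[OF sim])
      (use im continuous_on_subset[OF cg] inj_on_subset[OF lift_on_inj[OF g]] in auto)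
  have loop: "pathfinish \<gamma> = pathstart \<gamma>" unfolding \<gamma>_def by (simp add: pathfinish_compose pathstart_compose a b)
  have img: "path_image \<gamma> = g ` D f - g ` f" unfolding \<gamma>_def path_image_compose im using lift_face(6)[OF c(1) g] by simp
  note ins = inside_of_boundary[OF lift_face(5,1,2,3,4)[OF c(1) g] \<gamma> loop img]
  have W: "wsum g c z = winding_number \<gamma> z" if z: "z \<notin> path_image \<gamma>" for z
  proof -
    have zA: "z \<notin> g ` (D f - f)" using z img lift_face(6)[OF c(1) g] by simp
    have sub: "path_image a \<subseteq> D f - f" "path_image b \<subseteq> D f - f" using a b c(5) ce by auto
    have cA: "continuous_on (D f - f) g" using continuous_on_subset[OF cg] by blast
    have "winding_number \<gamma> z = winding_number ((g \<circ> a) +++ (g \<circ> b)) z" by (simp add: \<gamma>_def path_compose_join)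
    also have "\<dots> = winding_number (g \<circ> a) z + winding_number (g \<circ> b) z"
    proof (rule winding_number_join)
      show "path (g \<circ> a)" "path (g \<circ> b)" using sub a(1) b(1) continuous_on_subset[OF cA] arc_imp_path
        by (metis path_continuous_image)+
      show "z \<notin> path_image (g \<circ> a)" "z \<notin> path_image (g \<circ> b)"
        unfolding path_image_compose using sub zA by blast+
      show "pathfinish (g \<circ> a) = pathstart (g \<circ> b)" using a b by (simp add: pathfinish_compose pathstart_compose)
    qed
    also have "\<dots> = wsum g c z" unfolding a_def b_def
      by (rule winding_gon[symmetric, OF c(2-4) _ cA zA]) (simp add: c(5))
    finally show ?thesis by simp
  qed
  have in': "z \<notin> path_image \<gamma>" if "z \<in> g ` f" for z using that img by blast
  show "(\<forall>z\<in>g ` f. wsum g c z = 1) \<or> (\<forall>z\<in>g ` f. wsum g c z = - 1)"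
    using simple_closed_path_winding_number_inside[OF \<gamma>] W in' ins(1) by metis
  show "\<forall>z. z \<notin> g ` D f \<longrightarrow> wsum g c z = 0"
  proof (intro allI impI)
    fix z assume z: "z \<notin> g ` D f"
    then have "z \<in> outside (path_image \<gamma>)" using ins(2) by blast
    then show "wsum g c z = 0" using W[of z] z img winding_number_zero_in_outside[OF simple_path_imp_path[OF \<gamma>] loop] by auto
  qed
qed

text \<open>Counterclockwise with respect to some lift. Which one is of no importance: two lifts of
  the connected cell differ by a period, and the winding numbers are translated with the
  picture.\<close>

definition positive :: "(complex \<times> complex) set \<Rightarrow> 'v list \<Rightarrow> bool" where
  "positive f c \<longleftrightarrow> (\<exists>g. lift_on (D f) g \<and> (\<forall>z\<in>g ` f. wsum g c z = 1))"

lemma gon_rev: "gon f c \<Longrightarrow> gon f (rev c)"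
  by (simp add: gon_def graph_cycle_rev cycle_edges_rev)

lemma wsum_rev:
  assumes c: "gon f c" and g: "lift_on (D f) g" and z: "z \<in> g ` f"
  shows "wsum g (rev c) z = - wsum g c z"
proof -
  note c = gonD[OF c]
  have "darts (rev c) = prod.swap ` darts c" unfolding darts_rev by force
  then have "wsum g (rev c) z = (\<Sum>d\<in>darts c. winding_number (g \<circ> dart_curve (prod.swap d)) z)"
    unfolding wsum_def by (simp add: sum.reindex inj_on_def prod_eq_iff)
  also have "\<dots> = (\<Sum>d\<in>darts c. - winding_number (g \<circ> dart_curve d) z)"
  proof (rule sum.cong[OF refl])
    fix d assume d: "d \<in> darts c"
    obtain u v where uv: "d = (u, v)" by (cases d)
    have e: "{u, v} \<in> cycle_edges c" using d uv unfolding cycle_edges_darts by (metis imageI uedge_Pair)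
    then have E: "{u, v} \<in> E" using c(4) by blast
    have sub: "path_image (dart_curve (u, v)) \<subseteq> D f - f" unfolding dart_curve(2)[OF E] c(5) using e by blast
    have "continuous_on (D f) g" using g by (simp add: lift_on_def)
    then have p: "path (g \<circ> dart_curve (u, v))"
      using sub dart_curve(1)[OF E] by (intro path_continuous_image arc_imp_path) (auto intro: continuous_on_subset)
    have "z \<notin> path_image (g \<circ> dart_curve (u, v))"
      unfolding path_image_compose using sub z lift_face(6)[OF c(1) g] by blast
    then show "winding_number (g \<circ> dart_curve (prod.swap d)) z = - winding_number (g \<circ> dart_curve d) z"
      using winding_number_reversepath[OF p] unfolding uv by (simp add: dart_curve(5)[OF E] path_compose_reversepath)
  qed
  also have "\<dots> = - wsum g c z" unfolding wsum_def by (rule sum_negf)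
  finally show ?thesis .
qed

lemma positive_exists:
  assumes "f \<in> F"
  shows "\<exists>c. gon f c \<and> positive f c"
proof -
  obtain c where c: "gon f c" using gon_exists[OF assms] by blast
  obtain g where g: "lift_on (D f) g" using face_lift[OF assms] .
  have "positive f c \<or> positive f (rev c)"
    using winding_sum_of_lift(1)[OF c g] wsum_rev[OF c g] g unfolding positive_def by auto
  then show ?thesis using c gon_rev by blast
qed

lemma wsum_shift: "wsum (\<lambda>x. g x + w) c z = wsum g c (z - w)"
proof -
  have "winding_number ((\<lambda>x. g x + w) \<circ> p) z = winding_number (g \<circ> p) (z - w)" for p :: "real \<Rightarrow> complex \<times> complex"
    unfolding winding_number_offset[of "_ \<circ> p"] by (simp add: o_def algebra_simps)
  then show ?thesis by (simp add: wsum_def)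
qed

text \<open>Lift two cells with a common dart so that the lifts agree on the common edge. The remaining
  boundary arcs \<open>\<alpha>\<close> and \<open>\<beta>\<close> then form a loop whose winding number would be both \<open>1\<close> and \<open>- 1\<close>
  near the midpoint of that edge.\<close>

lemma positive_dart_unique:
  assumes c: "gon f c" "positive f c" "(u, v) \<in> darts c"
    and c': "gon f' c'" "positive f' c'" "(u, v) \<in> darts c'"
  shows "f = f'"
proof (rule ccontr)
  assume ff: "f \<noteq> f'"
  note cD = gonD[OF c(1)] and cD' = gonD[OF c'(1)]
  obtain g where g: "lift_on (D f) g" "\<forall>z\<in>g ` f. wsum g c z = 1" using c(2) unfolding positive_def by blast
  obtain h0 where h0: "lift_on (D f') h0" "\<forall>z\<in>h0 ` f'. wsum h0 c' z = 1" using c'(2) unfolding positive_def by blast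
  have e: "{u, v} \<in> cycle_edges c" "{u, v} \<in> cycle_edges c'"
    using c(3) c'(3) unfolding cycle_edges_darts by (metis imageI uedge_Pair)+
  then have E: "{u, v} \<in> E" using cD(4) by blast
  define e where "e = edge_arc M {u, v}"
  have eD: "e \<subseteq> D f - f" "e \<subseteq> D f' - f'" unfolding cD(5) cD'(5) e_def using e by blast+
  have "connected e" "e \<noteq> {}" unfolding e_def edge_arc_def
    using connected_arc_image[OF emb(3)[OF E]] by auto
  \<comment> \<open>On the common edge the two lifts differ by a constant period; \<open>h\<close>
    is the second lift moved by it.\<close>
  then obtain w where w: "period w" "\<And>x. x \<in> e \<Longrightarrow> g x = h0 x + w"
    using lift_difference_constant[of e g h0] lift_on_subset g(1) h0(1) eD by (metis Diff_subset subset_trans)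
  define h where "h x = h0 x + w" for x
  have h: "lift_on (D f') h" unfolding h_def by (rule lift_on_shift[OF h0(1) w(1)])
  have h1: "\<forall>z\<in>h ` f'. wsum h c' z = 1" using h0(2) unfolding h_def wsum_shift by auto
  have gh: "g x = h x" if "x \<in> e" for x using w(2)[OF that] by (simp add: h_def)
  obtain c1 where c1: "darts c1 = darts c" "set c1 = set c" "length c1 = length c" "distinct c1" "hd c1 = v" "last c1 = u"
    using rotate_to_dart[OF c(3)] cD(2) by metis
  obtain c2 where c2: "darts c2 = darts c'" "set c2 = set c'" "length c2 = length c'" "distinct c2" "hd c2 = v" "last c2 = u"
    using rotate_to_dart[OF c'(3)] cD'(2) by metis
  have ne: "c1 \<noteq> []" "c2 \<noteq> []" using c1(3) c2(3) cD(3) cD'(3) by auto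
  have ce: "cycle_edges c1 = cycle_edges c" "cycle_edges c2 = cycle_edges c'" by (simp_all add: cycle_edges_darts c1(1) c2(1))
  define a where "a = join_steps dart_curve c1"
  define b where "b = join_steps dart_curve c2"
  define d where "d = dart_curve (u, v)"
  \<comment> \<open>The boundary without the common edge: an arc from \<open>v\<close> back to
    \<open>u\<close> that avoids the midpoint of that edge. The claim is stated once for both
    faces.\<close>
  have tail: "arc (join_steps dart_curve xs)" "pathstart (join_steps dart_curve xs) = P v"
      "pathfinish (join_steps dart_curve xs) = P u" "path_image (join_steps dart_curve xs) \<subseteq> D k - k"
      "mid {u, v} \<notin> path_image (join_steps dart_curve xs)"
    if xs: "xs \<noteq> []" "distinct xs" "hd xs = v" "last xs = u" "3 \<le> length xs" "cycle_edges xs \<subseteq> E"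
      "D k - k = (\<Union>e\<in>cycle_edges xs. edge_arc M e)" for xs k
  proof -
    note sp = darts_split[OF xs(1,2)]
    have uv: "(u, v) \<in> darts xs" "(u, v) \<notin> steps xs" using sp xs(3,4) by auto
    have sub: "uedge ` steps xs \<subseteq> cycle_edges xs" unfolding cycle_edges_darts sp(1) by blast
    have j: "arc (join_steps dart_curve xs) \<and> pathstart (join_steps dart_curve xs) = P (hd xs) \<and>
      pathfinish (join_steps dart_curve xs) = P (last xs) \<and>
      path_image (join_steps dart_curve xs) = (\<Union>e\<in>uedge ` steps xs. edge_arc M e)"
      by (rule join_steps) (use xs sub in auto)
    then show "arc (join_steps dart_curve xs)" "pathstart (join_steps dart_curve xs) = P v"
      "pathfinish (join_steps dart_curve xs) = P u" "path_image (join_steps dart_curve xs) \<subseteq> D k - k"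
      unfolding xs(7) using sub xs(3,4) by auto
    have "(v, u) \<notin> darts xs" using darts_asym(1)[OF xs(2,5) uv(1)] .
    then have "{u, v} \<notin> uedge ` steps xs" using uv(2) sp(1) by (auto simp: uedge_def doubleton_eq_iff)
    moreover have "e = {u, v}" if "e \<in> uedge ` steps xs" "mid {u, v} \<in> edge_arc M e" for e
      using mid(3)[OF E _ that(2)] that(1) sub xs(6) by blast
    moreover have "path_image (join_steps dart_curve xs) = (\<Union>e\<in>uedge ` steps xs. edge_arc M e)" using j by (elim conjE)
    ultimately show "mid {u, v} \<notin> path_image (join_steps dart_curve xs)" by blast
  qed
  have a: "arc a" "pathstart a = P v" "pathfinish a = P u" "path_image a \<subseteq> D f - f" "mid {u, v} \<notin> path_image a"
    unfolding a_def by (rule tail[OF ne(1) c1(4-6)]; use cD c1(3) ce in simp)+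
  have b: "arc b" "pathstart b = P v" "pathfinish b = P u" "path_image b \<subseteq> D f' - f'" "mid {u, v} \<notin> path_image b"
    unfolding b_def by (rule tail[OF ne(2) c2(4-6)]; use cD' c2(3) ce in simp)+
  have cg: "continuous_on (D f) g" "continuous_on (D f') h" using g(1) h by (simp_all add: lift_on_def)
  have cg': "continuous_on (D f - f) g" "continuous_on (D f' - f') h"
    using cg continuous_on_subset by blast+
  have pg: "torus_cover (g x) = x" if "x \<in> D f" for x using g(1) that by (simp add: lift_on_def)
  have ph: "torus_cover (h x) = x" if "x \<in> D f'" for x using h that by (simp add: lift_on_def)
  have Wg: "wsum g c z = winding_number (g \<circ> a) z + winding_number (g \<circ> d) z" if z: "z \<notin> g ` (D f - f)" for z
  proof -
    have "wsum g c1 z = winding_number (g \<circ> a) z + winding_number (g \<circ> d) z"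
      using winding_gon[OF c1(4) _ _ _ cg'(1) z] cD c1 ce(1) unfolding a_def d_def by simp
    then show ?thesis by (simp add: wsum_def c1(1))
  qed
  have Wh: "wsum h c' z = winding_number (h \<circ> b) z + winding_number (h \<circ> d) z" if z: "z \<notin> h ` (D f' - f')" for z
  proof -
    have "wsum h c2 z = winding_number (h \<circ> b) z + winding_number (h \<circ> d) z"
      using winding_gon[OF c2(4) _ _ _ cg'(2) z] cD' c2 ce(2) unfolding b_def d_def by simp
    then show ?thesis by (simp add: wsum_def c2(1))
  qed
  have "d t \<in> e" if "0 \<le> t" "t \<le> 1" for t
    using dart_curve(2)[OF E] that unfolding d_def e_def path_image_def by auto
  \<comment> \<open>The lifts agree on the common edge, so its contribution is the same in both sums
    and cancels in the difference.\<close>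
  then have dd: "winding_number (g \<circ> d) z = winding_number (h \<circ> d) z" for z
    by (intro winding_number_cong) (simp add: gh)
  have disj: "f \<inter> D f' = {}" "f' \<inter> D f = {}"
    using closed_face(4)[OF cD'(1)] closed_face(4)[OF cD(1)] face_sub(2) face(5) cD(1) cD'(1) ff by blast+
  have out: "z \<notin> h ` D f'" if "z \<in> g ` f" for z
  proof
    assume "z \<in> h ` D f'"
    then obtain x where x: "x \<in> D f'" "z = h x" by blast
    obtain y where y: "y \<in> f" "z = g y" using \<open>z \<in> g ` f\<close> by blast
    have "x = y" using pg[of y] ph[OF x(1)] x(2) y face_sub(1)[OF cD(1)] by auto
    then show False using x(1) y(1) disj(1) by blast
  qed
  have out': "z \<notin> g ` D f" if "z \<in> h ` f'" for z
  proof
    assume "z \<in> g ` D f"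
    then obtain x where x: "x \<in> D f" "z = g x" by blast
    obtain y where y: "y \<in> f'" "z = h y" using \<open>z \<in> h ` f'\<close> by blast
    have "x = y" using ph[of y] pg[OF x(1)] x(2) y face_sub(1)[OF cD'(1)] by auto
    then show False using x(1) y(1) disj(2) by blast
  qed
  \<comment> \<open>Points of the lifted \<open>f\<close> lie off the lifted closed cell of
    \<open>f'\<close>, where the second sum vanishes. In the next claim the roles are exchanged, and
    the sign with them.\<close>
  have 1: "winding_number (g \<circ> a) z - winding_number (h \<circ> b) z = 1" if z: "z \<in> g ` f" for z
  proof -
    have n: "z \<notin> g ` (D f - f)" "z \<notin> h ` (D f' - f')" using z lift_face(6)[OF cD(1) g(1)] out[OF z] by blast+
    have "winding_number (g \<circ> a) z + winding_number (h \<circ> d) z = 1"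
      using Wg[OF n(1)] bspec[OF g(2) z] unfolding dd by simp
    moreover have "winding_number (h \<circ> b) z + winding_number (h \<circ> d) z = 0"
      using Wh[OF n(2)] winding_sum_of_lift(2)[OF c'(1) h, rule_format, OF out[OF z]] by simp
    ultimately show ?thesis by (metis add_diff_cancel_right diff_zero)
  qed
  have 2: "winding_number (g \<circ> a) z - winding_number (h \<circ> b) z = - 1" if z: "z \<in> h ` f'" for z
  proof -
    have n: "z \<notin> h ` (D f' - f')" "z \<notin> g ` (D f - f)" using z lift_face(6)[OF cD'(1) h] out'[OF z] by blast+
    have "winding_number (h \<circ> b) z + winding_number (h \<circ> d) z = 1"
      using Wh[OF n(1)] bspec[OF h1 z] by simp
    moreover have "winding_number (g \<circ> a) z + winding_number (h \<circ> d) z = 0"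
      using Wg[OF n(2)] winding_sum_of_lift(2)[OF c(1) g(1), rule_format, OF out'[OF z]] unfolding dd by simp
    ultimately show ?thesis by (metis add_diff_cancel_right diff_0)
  qed
  define \<gamma> where "\<gamma> = (g \<circ> a) +++ reversepath (h \<circ> b)"
  have pa: "path (g \<circ> a)" "path (h \<circ> b)"
    using path_continuous_image[OF arc_imp_path[OF a(1)] continuous_on_subset[OF cg'(1) a(4)]]
      path_continuous_image[OF arc_imp_path[OF b(1)] continuous_on_subset[OF cg'(2) b(4)]] .
  have ends: "P u \<in> e" "P v \<in> e" using emb(5)[OF E] dart_curve[OF E] unfolding e_def
    by (metis pathstart_in_path_image, metis pathfinish_in_path_image)
  have fin: "pathfinish (g \<circ> a) = pathstart (reversepath (h \<circ> b))" "pathfinish (reversepath (h \<circ> b)) = pathstart (g \<circ> a)"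
    using gh ends a b by (simp_all add: pathfinish_compose pathstart_compose)
  have \<gamma>: "path \<gamma>" "pathfinish \<gamma> = pathstart \<gamma>" "path_image \<gamma> = g ` path_image a \<union> h ` path_image b"
    unfolding \<gamma>_def using pa fin by (simp_all add: path_image_join path_image_compose)
  have W\<gamma>: "winding_number \<gamma> z = winding_number (g \<circ> a) z - winding_number (h \<circ> b) z" if z: "z \<notin> path_image \<gamma>" for z
  proof -
    have n: "z \<notin> path_image (g \<circ> a)" "z \<notin> path_image (h \<circ> b)" using z unfolding \<gamma>(3) path_image_compose by blast+
    have "winding_number \<gamma> z = winding_number (g \<circ> a) z + winding_number (reversepath (h \<circ> b)) z"
      unfolding \<gamma>_def by (rule winding_number_join) (use pa fin n in simp_all)
    then show ?thesis using winding_number_reversepath[OF pa(2) n(2)] by simp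
  qed
  define m where "m = mid {u, v}"
  have me: "m \<in> e" using mid(1)[OF E] by (simp add: m_def e_def)
  have mD: "m \<in> D f" "m \<in> D f'" using me eD by blast+
  have "g m \<notin> g ` path_image a"
    using lift_on_inj[OF g(1)] mD(1) a(4,5) unfolding m_def[symmetric] by (auto simp: inj_on_def)
  moreover have "g m \<notin> h ` path_image b" unfolding gh[OF me]
    using lift_on_inj[OF h] mD(2) b(4,5) unfolding m_def[symmetric] by (auto simp: inj_on_def)
  ultimately have "g m \<in> - path_image \<gamma>" unfolding \<gamma>(3) by blast
  moreover have "open (- path_image \<gamma>)" using closed_path_image[OF \<gamma>(1)] by blast
  ultimately obtain r where r: "r > 0" "ball (g m) r \<subseteq> - path_image \<gamma>" using open_contains_ball by blast
  have "ball (g m) r \<inter> path_image \<gamma> = {}" using r(2) by blast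
  then obtain k where k: "\<And>z. z \<in> ball (g m) r \<Longrightarrow> winding_number \<gamma> z = k"
    using winding_number_constant[OF \<gamma>(1,2) connected_ball] unfolding constant_on_def by metis
  \<comment> \<open>The midpoint is a limit of points of each face, so the ball around it contains
    points of either lift, whereas the winding number of \<gamma> is constant on it.\<close>
  have near: "\<exists>x\<in>k. q x \<in> ball (q m) r" if q: "continuous_on (D k) q" "m \<in> D k" "k \<subseteq> D k" for q :: "complex \<times> complex \<Rightarrow> complex" and k
  proof -
    obtain \<delta> where \<delta>: "\<delta> > 0" "\<And>x. x \<in> D k \<Longrightarrow> dist x m < \<delta> \<Longrightarrow> dist (q x) (q m) < r"
      using q(1,2) r(1) unfolding continuous_on_iff by blast
    have "m \<in> closure k" using q(2) by (simp add: closed_face_def)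
    then obtain x where x: "x \<in> k" "dist x m < \<delta>" using \<delta>(1) closure_approachable by blast
    then have "q x \<in> ball (q m) r" using \<delta>(2)[of x] q(3) by (simp add: subsetD dist_commute)
    then show ?thesis using x(1) by blast
  qed
  obtain x where x: "x \<in> f" "g x \<in> ball (g m) r" using near[OF cg(1) mD(1) face_sub(1)[OF cD(1)]] by blast
  obtain y where y: "y \<in> f'" "h y \<in> ball (g m) r" using near[OF cg(2) mD(2) face_sub(1)[OF cD'(1)]] unfolding gh[OF me] by blast
  have "k = 1" using k[OF x(2)] W\<gamma>[of "g x"] r(2) x 1[of "g x"] by auto
  moreover have "k = - 1" using k[OF y(2)] W\<gamma>[of "h y"] r(2) y 2[of "h y"] by auto
  ultimately show False by simp
qed

section \<open>Stars, covering by closed faces, and connectedness of the graph\<close>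

lemma vertex_star:
  assumes "v \<in> V"
  shows "\<exists>ns fs. distinct ns \<and> distinct fs \<and> length ns = length as \<and> set ns = {u. {v, u} \<in> E} \<and>
    set fs = {f \<in> F. P v \<in> D f} \<and> list_all2 (is_gon torus M) as fs \<and>
    (\<forall>i<length as. edge_arc M {v, ns ! i} \<subseteq> D (fs ! i) \<and> edge_arc M {v, ns ! (Suc i mod length as)} \<subseteq> D (fs ! i))"
proof -
  obtain fs where fs: "face_cycle torus M v fs" "list_all2 (is_gon torus M) as fs"
    using type assms unfolding has_type_def by blast
  have l: "length fs = length as" using fs(2) by (simp add: list_all2_lengthD)
  obtain es where es: "distinct es" "set es = {e \<in> E. v \<in> e}" "length es = length fs"
    "\<forall>i<length fs. edge_arc M (es ! i) \<subseteq> D (fs ! i) \<and> edge_arc M (es ! (Suc i mod length es)) \<subseteq> D (fs ! i)"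
    using fs(1) unfolding face_cycle_def by blast
  define other where "other e = (SOME u. e = {v, u})" for e
  have other: "e = {v, other e}" if "e \<in> E" "v \<in> e" for e
  proof -
    have "\<exists>u. e = {v, u}" using edgeE[OF that(1)] that(2) by (auto simp: insert_commute)
    then show ?thesis unfolding other_def by (rule someI_ex)
  qed
  have ese: "es ! i = {v, map other es ! i}" if "i < length es" for i
    using other[of "es ! i"] es(2) nth_mem[OF that] that by auto
  have "set (map other es) = {u. {v, u} \<in> E}"
  proof
    show "set (map other es) \<subseteq> {u. {v, u} \<in> E}" using other es(2) by auto
    show "{u. {v, u} \<in> E} \<subseteq> set (map other es)"
    proof
      fix u assume "u \<in> {u. {v, u} \<in> E}"
      then have u: "{v, u} \<in> E" by blast
      then have "{v, u} \<in> set es" "{v, u} = {v, other {v, u}}" using es(2) other[of "{v, u}"] by auto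
      moreover from this(2) have "other {v, u} = u" by (auto simp: doubleton_eq_iff)
      ultimately show "u \<in> set (map other es)" by force
    qed
  qed
  moreover have "distinct (map other es)"
    unfolding distinct_map
  proof (intro conjI inj_onI es(1))
    fix x y assume xy: "x \<in> set es" "y \<in> set es" "other x = other y"
    have "x = {v, other x}" "y = {v, other y}" using other xy(1,2) es(2) by blast+
    then show "x = y" using xy(3) by metis
  qed
  moreover have "\<forall>i<length as. edge_arc M {v, map other es ! i} \<subseteq> D (fs ! i) \<and>
      edge_arc M {v, map other es ! (Suc i mod length as)} \<subseteq> D (fs ! i)"
  proof (intro allI impI)
    fix i assume i: "i < length as"
    have "Suc i mod length as < length es" using i es(3) l by (metis gr_zeroI less_zeroE mod_less_divisor)
    then show "edge_arc M {v, map other es ! i} \<subseteq> D (fs ! i) \<and>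
      edge_arc M {v, map other es ! (Suc i mod length as)} \<subseteq> D (fs ! i)"
      using es(3,4) l i ese[of i] ese[of "Suc i mod length as"] by simp
  qed
  moreover have "distinct fs" "set fs = {f \<in> F. P v \<in> D f}" using fs(1) unfolding face_cycle_def by blast+
  moreover have "length (map other es) = length as" using l es(3) by simp
  ultimately show ?thesis using fs(2) by (intro exI[of _ "map other es"] exI[of _ fs] conjI)
qed

lemma vertex_on_face: "v \<in> V \<Longrightarrow> \<exists>f\<in>F. P v \<in> D f"
proof -
  assume "v \<in> V"
  from vertex_star[OF this] obtain fs where fs: "set fs = {f \<in> F. P v \<in> D f}" "list_all2 (is_gon torus M) as fs" by (elim exE conjE)
  then have "fs \<noteq> []" using degree by auto
  then show ?thesis using fs(1) by (cases fs) auto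
qed

lemma edge_on_face: "e \<in> E \<Longrightarrow> \<exists>f\<in>F. edge_arc M e \<subseteq> D f"
proof -
  assume e: "e \<in> E"
  then obtain u v where uv: "e = {v, u}" "v \<in> V" using edgeE by blast
  from vertex_star[OF uv(2)] obtain ns fs where s: "set ns = {u. {v, u} \<in> E}" "length ns = length as"
    "set fs = {f \<in> F. P v \<in> D f}" "list_all2 (is_gon torus M) as fs"
    "\<forall>i<length as. edge_arc M {v, ns ! i} \<subseteq> D (fs ! i) \<and> edge_arc M {v, ns ! (Suc i mod length as)} \<subseteq> D (fs ! i)" by (elim exE conjE)
  have "u \<in> set ns" using s(1) e uv(1) by blast
  then obtain i where i: "i < length as" "ns ! i = u" using s(2) by (auto simp: in_set_conv_nth)
  then have "fs ! i \<in> F" using s(3,4) nth_mem[of i fs] by (auto dest: list_all2_lengthD)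
  then show ?thesis using s(5) i uv(1) by blast
qed

text \<open>Every face has a vertex, and the type lists the finitely many faces at each of the
  finitely many vertices.\<close>

lemma finite_faces: "finite F"
proof -
  have "finite {f \<in> F. P v \<in> D f}" if "v \<in> V" for v
  proof -
    from vertex_star[OF that] obtain fs where "set fs = {f \<in> F. P v \<in> D f}" by (elim exE conjE)
    then show ?thesis using List.finite_set[of fs] by simp
  qed
  moreover have "F \<subseteq> (\<Union>v\<in>V. {f \<in> F. P v \<in> D f})" using face_has_vertex by blast
  ultimately show ?thesis by (rule finite_subset[rotated, OF finite_UN_I[OF finV]])
qed

lemma faces_cover: "(\<Union>f\<in>F. D f) = torus"
proof
  show "(\<Union>f\<in>F. D f) \<subseteq> torus" using closed_face(3) by blast
  show "torus \<subseteq> (\<Union>f\<in>F. D f)"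
  proof
    fix x assume x: "x \<in> torus"
    consider "x \<notin> K" | v where "v \<in> V" "x = P v" | e where "e \<in> E" "x \<in> edge_arc M e"
      unfolding skeleton_def by blast
    then show "x \<in> (\<Union>f\<in>F. D f)"
    proof cases
      case 1
      then obtain f where "f \<in> F" "x \<in> f" using face(4) x by blast
      then show ?thesis using face_sub(1) by blast
    qed (use vertex_on_face edge_on_face in blast)+
  qed
qed

text \<open>A common point of two different faces is on the boundary of both. It lies on an edge of
  each; these edges coincide or meet only in common vertices.\<close>

lemma meeting_faces:
  assumes f: "f \<in> F" "f' \<in> F" and x: "x \<in> D f" "x \<in> D f'"
  shows "\<exists>v\<in>V. P v \<in> D f \<and> P v \<in> D f'"
proof (cases "f = f'")
  case True
  then show ?thesis using face_has_vertex[OF f(1)] by blast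
next
  case False
  obtain c c' where c: "gon f c" "gon f' c'" using gon_exists f by blast
  have cE: "cycle_edges c \<subseteq> E" "cycle_edges c' \<subseteq> E" "D f - f = (\<Union>e\<in>cycle_edges c. edge_arc M e)"
    "D f' - f' = (\<Union>e\<in>cycle_edges c'. edge_arc M e)"
    using c unfolding gon_def graph_cycle_def by blast+
  have "x \<in> K"
  proof (rule ccontr)
    assume "x \<notin> K"
    then have "x \<in> f" "x \<in> f'" using closed_face(4) f x by blast+
    then show False using face(5)[OF f] False by blast
  qed
  then have "x \<in> D f - f" "x \<in> D f' - f'" using x face_sub(2)[OF f(1)] face_sub(2)[OF f(2)] by blast+
  then obtain e e' where e: "e \<in> cycle_edges c" "x \<in> edge_arc M e" "e' \<in> cycle_edges c'" "x \<in> edge_arc M e'"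
    unfolding cE(3,4) by blast
  have "\<exists>v. v \<in> e \<and> v \<in> e'"
  proof (cases "e = e'")
    case True
    then show ?thesis using edgeE[of e] e(1) cE(1) by blast
  next
    case False
    then have "x \<in> P ` (e \<inter> e')" using emb(7)[of e e'] e cE(1,2) by blast
    then show ?thesis by blast
  qed
  then obtain v where v: "v \<in> e" "v \<in> e'" by blast
  have "v \<in> set c" "v \<in> set c'" using v e(1,3) cycle_vertices[of c] cycle_vertices[of c'] by blast+
  moreover have "v \<in> V" using v(1) e(1) cE(1) E_sub by blast
  ultimately show ?thesis using gon_vertex[OF c(1)] gon_vertex[OF c(2)] by blast
qed

text \<open>If no edge leaves \<open>U\<close>, the vertices of a face are all in \<open>U\<close>
  or all outside, as its boundary cycle is connected. Since meeting faces have a common vertex, the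
  closed faces of the two kinds would split the torus into two nonempty disjoint closed
  sets.\<close>

lemma graph_connected:
  assumes U: "U \<subseteq> V" "U \<noteq> {}" "U \<noteq> V"
  shows "\<exists>u\<in>U. \<exists>w\<in>V - U. {u, w} \<in> E"
proof (rule ccontr)
  assume "\<not> ?thesis"
  then have no: "w \<in> U" if "u \<in> U" "{u, w} \<in> E" for u w using that E_sub by blast
  define A where "A W = (\<Union>f\<in>{f \<in> F. \<exists>v\<in>W. P v \<in> D f}. D f)" for W
  have closed: "closed (A W)" for W unfolding A_def
    by (intro closed_UN ballI compact_imp_closed closed_face(2)) (use finite_faces in auto)
  have allU: "w \<in> U" if f: "f \<in> F" "v \<in> U" "P v \<in> D f" "w \<in> V" "P w \<in> D f" for f v w
  proof -
    obtain c where c: "gon f c" using gon_exists[OF f(1)] by blast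
    have "v \<in> set c" "w \<in> set c" using gon_vertex[OF c] f U(1) by blast+
    moreover have "x \<in> U \<longleftrightarrow> y \<in> U" if "{x, y} \<in> cycle_edges c" for x y
      using that no[of x y] no[of y x] gonD(4)[OF c] by (auto simp: insert_commute)
    ultimately show ?thesis using cycle_connected[of c "\<lambda>x. x \<in> U" v w] f(2) by blast
  qed
  have "A U \<inter> torus = {} \<or> A (V - U) \<inter> torus = {}"
  proof (rule connected_closedD[OF torus_space(2) _ _ closed closed])
    show "torus \<subseteq> A U \<union> A (V - U)"
    proof
      fix x assume "x \<in> torus"
      then obtain f where f: "f \<in> F" "x \<in> D f" using faces_cover by blast
      obtain v where v: "v \<in> V" "P v \<in> D f" using face_has_vertex[OF f(1)] by blast
      show "x \<in> A U \<union> A (V - U)"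
      proof (cases "v \<in> U")
        case True
        then have "x \<in> A U" using f v(2) unfolding A_def by blast
        then show ?thesis by blast
      next
        case False
        then have "x \<in> A (V - U)" using f v unfolding A_def by blast
        then show ?thesis by blast
      qed
    qed
    have "x \<notin> A (V - U)" if x: "x \<in> A U" for x
    proof
      assume y: "x \<in> A (V - U)"
      obtain f u where f: "f \<in> F" "u \<in> U" "P u \<in> D f" "x \<in> D f" using x unfolding A_def by blast
      obtain f' u' where f': "f' \<in> F" "u' \<in> V - U" "P u' \<in> D f'" "x \<in> D f'" using y unfolding A_def by blast
      obtain v where v: "v \<in> V" "P v \<in> D f" "P v \<in> D f'" using meeting_faces[OF f(1) f'(1) f(4) f'(4)] by blast
      have "v \<in> U" using allU[OF f(1-3) v(1,2)] .
      then have "u' \<in> U" using allU[OF f'(1) _ v(3) _ f'(3)] f'(2) by blast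
      then show False using f'(2) by blast
    qed
    then show "A U \<inter> A (V - U) \<inter> torus = {}" by blast
  qed
  moreover have "A W \<inter> torus \<noteq> {}" if w: "w \<in> W" "w \<in> V" for w W
  proof -
    obtain f where "f \<in> F" "P w \<in> D f" using vertex_on_face[OF w(2)] by blast
    then have "P w \<in> A W" using w(1) unfolding A_def by blast
    then show ?thesis using emb(2) w(2) by blast
  qed
  moreover obtain u w where "u \<in> U" "u \<in> V" "w \<in> V - U" "w \<in> V" using U by blast
  ultimately show False by metis
qed

definition boundary :: "(complex \<times> complex) set \<Rightarrow> 'v list" where
  "boundary f = (SOME c. gon f c \<and> positive f c)"

lemma boundary: "f \<in> F \<Longrightarrow> gon f (boundary f) \<and> positive f (boundary f)"
  unfolding boundary_def by (rule someI_ex) (rule positive_exists)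

text \<open>The coherent orientation comes from taking the positive boundary of every face; the
  lengths carry over from the type because they do not depend on the chosen cycle.\<close>

lemma polygonal_map: "polygonal_map V E F boundary as"
proof (rule polygonal_map.intro[OF finV V_nonempty edgeE _ degree])
  show "graph_cycle V E (boundary f)" if "f \<in> F" for f using boundary[OF that] by (simp add: gon_def)
  show "\<exists>u\<in>U. \<exists>w\<in>V - U. {u, w} \<in> E" if "U \<subseteq> V" "U \<noteq> {}" "U \<noteq> V" for U
    using graph_connected[OF that] .
  show "f = g" if d: "f \<in> F" "g \<in> F" "d \<in> darts (boundary f)" "d \<in> darts (boundary g)" for f g d
  proof -
    obtain u v where "d = (u, v)" by (cases d)
    then show ?thesis using positive_dart_unique[of f "boundary f" u v g "boundary g"] boundary d by simp
  qed
  show "\<exists>ns fs. distinct ns \<and> distinct fs \<and> length ns = length as \<and>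
      set ns = {u. {v, u} \<in> E} \<and> set fs = {f \<in> F. v \<in> set (boundary f)} \<and> map (\<lambda>f. length (boundary f)) fs = as \<and>
      (\<forall>i<length as. {v, ns ! i} \<in> cycle_edges (boundary (fs ! i)) \<and>
        {v, ns ! (Suc i mod length as)} \<in> cycle_edges (boundary (fs ! i)))" if v: "v \<in> V" for v
  proof -
    from vertex_star[OF v] obtain ns fs where s: "distinct ns" "distinct fs" "length ns = length as"
      "set ns = {u. {v, u} \<in> E}" "set fs = {f \<in> F. P v \<in> D f}" "list_all2 (is_gon torus M) as fs"
      "\<forall>i<length as. edge_arc M {v, ns ! i} \<subseteq> D (fs ! i) \<and> edge_arc M {v, ns ! (Suc i mod length as)} \<subseteq> D (fs ! i)"
      by (elim exE conjE)
    have l: "length fs = length as" using s(6) by (simp add: list_all2_lengthD)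
    have fF: "fs ! i \<in> F" if "i < length as" for i using s(5) l nth_mem[of i fs] that by auto
    have bd: "{v, ns ! j} \<in> cycle_edges (boundary (fs ! i))"
      if "i < length as" "j < length as" "edge_arc M {v, ns ! j} \<subseteq> D (fs ! i)" for i j
    proof -
      have "{v, ns ! j} \<in> E" using s(3,4) nth_mem[of j ns] that(2) by auto
      then show ?thesis using gon_edge boundary fF[OF that(1)] that(3) by blast
    qed
    have "set fs = {f \<in> F. v \<in> set (boundary f)}" unfolding s(5) using gon_vertex[OF _ v] boundary by blast
    moreover have "map (\<lambda>f. length (boundary f)) fs = as"
    proof (rule nth_equalityI)
      fix i assume i: "i < length (map (\<lambda>f. length (boundary f)) fs)"
      then have "is_gon torus M (as ! i) (fs ! i)" using s(6) by (simp add: list_all2_conv_all_nth)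
      then obtain c where c: "gon (fs ! i) c" "length c = as ! i"
        using fF[of i] i l unfolding is_gon_def gon_def by auto
      then show "map (\<lambda>f. length (boundary f)) fs ! i = as ! i"
        using gon_unique(2)[OF c(1), of "boundary (fs ! i)"] boundary[OF fF[of i]] i l by simp
    qed (simp add: l)
    moreover have "\<forall>i<length as. {v, ns ! i} \<in> cycle_edges (boundary (fs ! i)) \<and>
        {v, ns ! (Suc i mod length as)} \<in> cycle_edges (boundary (fs ! i))"
    proof (intro allI impI)
      fix i assume i: "i < length as"
      then have "Suc i mod length as < length as" by (intro mod_less_divisor) linarith
      then show "{v, ns ! i} \<in> cycle_edges (boundary (fs ! i)) \<and>
          {v, ns ! (Suc i mod length as)} \<in> cycle_edges (boundary (fs ! i))"
        using bd i s(7) by blast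
    qed
    ultimately show ?thesis using s(1-4) by (intro exI[of _ ns] exI[of _ fs] conjI)
  qed
qed

end

theorem theorem1p2:
  fixes M :: "('v, complex \<times> complex) drawing"
  assumes "map_on torus M"
    and "as \<in> {[3, 3, 3, 4, 4], [3, 3, 4, 3, 4], [6, 3, 6, 3], [6, 4, 3, 4],
               [3, 3, 3, 3, 6], [4, 8, 8], [4, 6, 12]}"
    and "has_type torus M as"
  shows "hamiltonian (verts M) (edges M)"
proof -
  have "torus_map M as" using assms by unfold_locales auto
  then interpret polygonal_map "verts M" "edges M" "faces torus M" "torus_map.boundary M" as
    by (rule torus_map.polygonal_map)
  show ?thesis using hamiltonian_semi_equivelar[OF assms(2)] .
qed

end
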